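(* The fixed point $(0,\tilde x_{out})$ of the analytic diffeomorphism $F$ (the analytic extension of the Reinhardt–Poincaré map to a neighborhood of $(0,\tilde x_{out})\in\mathbb R^4$) is hyperbolic. The local unstable manifold is a $C^\infty$ curve. In a neighborhood of the fixed point, the local stable manifold coincides with the three-dimensional exceptional divisor $r=0$.
   Context: Notation: $\langle X,Y\rangle=\mathrm{trace}(XY)$, $[X,Y]=XY-YX$ on $\mathfrak{sl}_2(\mathbb R)$; $J=\begin{pmatrix}0&-1\\ 1&0\end{pmatrix}$, $R=\exp(J\pi/3)$; for $u=(u_0,u_1,u_2)$, $Z_u=\begin{pmatrix}\frac{u_1-u_2}{\sqrt3}&\frac{u_0-2u_1-2u_2}{3}\\ u_0&\frac{u_2-u_1}{\sqrt3}\end{pmatrix}$; $\mathbf e_1,\mathbf e_2,\mathbf e_3$ is the standard basis of $\mathbb R^3$. Reinhardt ODE (with $\lambda_{cost}=-1$) for constant control $u$: with $P=Z_u/\langle Z_u,X\rangle$, $X'=[P,X]$, $\Lambda_1'=[\Lambda_1,X]$, $\Lambda_R'=[P,\Lambda_R]-\langle\Lambda_R,P\rangle[P,X]-[\Lambda_1+\frac32J,X]$. Switching functions: $\chi_{ij}(X,\Lambda_R)=\big\langle\Lambda_R,\frac{Z_{\mathbf e_j}}{\langle Z_{\mathbf e_j},X\rangle}-\frac{Z_{\mathbf e_i}}{\langle Z_{\mathbf e_i},X\rangle}\big\rangle$. Hamiltonian: $\mathcal H(Z_u,X,\Lambda_1,\Lambda_R)=\langle\Lambda_1+\frac32J,X\rangle-\frac{\langle\Lambda_R,Z_u\rangle}{\langle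 X,Z_u\rangle}$. Local coordinates $(r,\tilde x)\in\mathbb R^4$, $\tilde x=(\tilde x_{21},\tilde\ell_{11},\tilde\ell_{21})$: for $r>0$ small they represent the triple $(X,\Lambda_1,\Lambda_R)$ with $$X=\begin{pmatrix}r&-\frac{1+r^2}{1+r\tilde x_{21}}\\ 1+r\tilde x_{21}&-r\end{pmatrix},$$ $\Lambda_1\in\mathfrak{sl}_2(\mathbb R)$ having $(1,1)$ entry $r^2\tilde\ell_{11}$, $(2,1)$ entry $-\frac32+r^2\tilde\ell_{21}$ and $\det\Lambda_1=\frac94$, and $\Lambda_R\in\mathfrak{sl}_2(\mathbb R)$ the unique solution of the linear equations $\langle X,\Lambda_R\rangle=0$, $\mathcal H(Z_{\mathbf e_2},X,\Lambda_1,\Lambda_R)=0$, $\chi_{23}(X,\Lambda_R)=0$. Reinhardt–Poincaré map $F$ (for $r>0$, near the fixed point): solve the ODE with constant control $\mathbf e_2$ from the initial condition represented by $(r,\tilde x)$ until the first positive time at which $\chi_{21}=0$, apply $Y\mapsto R^{-1}YR$ to each of $X,\Lambda_1,\Lambda_R$, and express the result in the coordinates $(r,\tilde x)$. This map extends to an analytic diffeomorphism $F$ in a neighborhood of the fixed point $(0,\tilde x_{out})$, including non-positive $r$, preserving $\{r=0\}$. The point $\tilde x_{out}=\big(\frac{x_1}{y_1},\frac{3x_2}{2y_1^2},-\frac{3y_2}{2y_1^2}\big)\approx(-2.39,-4.90,-1.12)$, where $$x_1+iy_1=-1+i\tfrac{-1+s}{\sqrt3(1+s)},\qquad x_2+iy_2=-\tfrac{-1+s^3}{\sqrt3(1+s^3)}+i\tfrac{1-3s-2s^2-3s^3+s^4}{3(1+s+s^3+s^4)},$$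 and $s\approx6.27$ is the unique real root $>1$ of $1-5s-7s^2-5s^3-7s^4-5s^5+s^6$. A fixed point of a diffeomorphism is hyperbolic if its tangent map there has no eigenvalues of absolute value $1$; local stable and unstable manifolds are the usual ones for a hyperbolic fixed point. *)

theory Defs
  imports "HOL-Analysis.Analysis"
begin

section \<open>Matrices\<close>

type_synonym mat22 = "real^2^2"

definition mk_mat :: "real \<Rightarrow> real \<Rightarrow> real \<Rightarrow> real \<Rightarrow> mat22" where
  "mk_mat a b c d = vector [vector [a, b], vector [c, d]]"

definition trace_form :: "mat22 \<Rightarrow> mat22 \<Rightarrow> real" where
  "trace_form X Y = trace (X ** Y)"

definition lie_bracket :: "mat22 \<Rightarrow> mat22 \<Rightarrow> mat22" where
  "lie_bracket X Y = X ** Y - Y ** X"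

definition in_sl2 :: "mat22 \<Rightarrow> bool" where
  "in_sl2 X \<longleftrightarrow> trace X = 0"

text \<open>Multiplication \<open>*\<close> on vector types is componentwise, so powers of matrices are
  iterations of \<open>**\<close> and the exponential is given by its power series.\<close>

definition matrix_exp :: "mat22 \<Rightarrow> mat22" where
  "matrix_exp A = (\<Sum>n. (1 / fact n) *\<^sub>R (((**) A ^^ n) (mat 1)))"

definition J_mat :: mat22 where
  "J_mat = mk_mat 0 (-1) 1 0"

definition R_mat :: mat22 where
  "R_mat = matrix_exp ((pi / 3) *\<^sub>R J_mat)"

section \<open>The Reinhardt system\<close>

text \<open>The control components \<open>u\<^sub>0, u\<^sub>1, u\<^sub>2\<close> are \<open>u $ 1, u $ 2, u $ 3\<close>.\<close>

definition Z_ctrl :: "real^3 \<Rightarrow> mat22" where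
  "Z_ctrl u = mk_mat ((u $ 2 - u $ 3) / sqrt 3) ((u $ 1 - 2 * u $ 2 - 2 * u $ 3) / 3)
                     (u $ 1) ((u $ 3 - u $ 2) / sqrt 3)"

abbreviation e_vec :: "3 \<Rightarrow> real^3" where
  "e_vec j \<equiv> axis j 1"

definition P_ctrl :: "real^3 \<Rightarrow> mat22 \<Rightarrow> mat22" where
  "P_ctrl u X = (1 / trace_form (Z_ctrl u) X) *\<^sub>R Z_ctrl u"

text \<open>All the quotients below are meaningful where this holds; it does so near \<open>J\<close>.\<close>

definition denominators_nonzero :: "mat22 \<Rightarrow> bool" where
  "denominators_nonzero X \<longleftrightarrow> (\<forall>j. trace_form (Z_ctrl (e_vec j)) X \<noteq> 0)"

definition switching_function :: "3 \<Rightarrow> 3 \<Rightarrow> mat22 \<Rightarrow> mat22 \<Rightarrow> real" where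
  "switching_function i j X LR = trace_form LR (P_ctrl (e_vec j) X - P_ctrl (e_vec i) X)"

definition hamiltonian :: "mat22 \<Rightarrow> mat22 \<Rightarrow> mat22 \<Rightarrow> mat22 \<Rightarrow> real" where
  "hamiltonian Z X L1 LR =
     trace_form (L1 + (3/2) *\<^sub>R J_mat) X - trace_form LR Z / trace_form X Z"

definition reinhardt_solution ::
  "real^3 \<Rightarrow> real \<Rightarrow> (real \<Rightarrow> mat22) \<Rightarrow> (real \<Rightarrow> mat22) \<Rightarrow> (real \<Rightarrow> mat22) \<Rightarrow> bool" where
  "reinhardt_solution u T X L1 LR \<longleftrightarrow>
     (\<forall>t\<in>{0..T}.
        denominators_nonzero (X t) \<and> trace_form (Z_ctrl u) (X t) \<noteq> 0 \<and>
        (X has_vector_derivative lie_bracket (P_ctrl u (X t)) (X t)) (at t within {0..T}) \<and>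
        (L1 has_vector_derivative lie_bracket (L1 t) (X t)) (at t within {0..T}) \<and>
        (LR has_vector_derivative
           (lie_bracket (P_ctrl u (X t)) (LR t)
            - trace_form (LR t) (P_ctrl u (X t)) *\<^sub>R lie_bracket (P_ctrl u (X t)) (X t)
            - lie_bracket (L1 t + (3/2) *\<^sub>R J_mat) (X t))) (at t within {0..T}))"

section \<open>Local coordinates and the Reinhardt--Poincare map\<close>

text \<open>A point \<open>q\<close> of \<open>real^4\<close> stands for
  \<open>(r, x\<^sub>2\<^sub>1, l\<^sub>1\<^sub>1, l\<^sub>2\<^sub>1)\<close>, where the last three are the rescaled (tilde) coordinates.
  The last conjunct says that \<open>LR\<close> is the one and only solution of the linear system.\<close>

definition represents :: "real^4 \<Rightarrow> mat22 \<Rightarrow> mat22 \<Rightarrow> mat22 \<Rightarrow> bool" where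
  "represents q X L1 LR \<longleftrightarrow>
     q $ 1 > 0 \<and> 1 + q $ 1 * q $ 2 \<noteq> 0 \<and>
     X = mk_mat (q $ 1) (- ((1 + (q $ 1)\<^sup>2) / (1 + q $ 1 * q $ 2)))
                (1 + q $ 1 * q $ 2) (- (q $ 1)) \<and>
     denominators_nonzero X \<and>
     in_sl2 L1 \<and> L1 $ 1 $ 1 = (q $ 1)\<^sup>2 * q $ 3 \<and> L1 $ 2 $ 1 = - (3/2) + (q $ 1)\<^sup>2 * q $ 4 \<and>
     det L1 = 9/4 \<and>
     (\<forall>M. (in_sl2 M \<and> trace_form X M = 0 \<and> hamiltonian (Z_ctrl (e_vec 2)) X L1 M = 0 \<and>
            switching_function 2 3 X M = 0)
          \<longleftrightarrow> M = LR)"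

definition rotate_back :: "mat22 \<Rightarrow> mat22" where
  "rotate_back Y = matrix_inv R_mat ** Y ** R_mat"

text \<open>The Poincare map for \<open>r > 0\<close>, as a relation between a point and its image;
  \<open>T\<close> is the first positive zero of the switching function along the trajectory.\<close>

definition reinhardt_poincare :: "real^4 \<Rightarrow> real^4 \<Rightarrow> bool" where
  "reinhardt_poincare q q' \<longleftrightarrow>
     (\<exists>T X L1 LR. T > 0 \<and>
        represents q (X 0) (L1 0) (LR 0) \<and>
        reinhardt_solution (e_vec 2) T X L1 LR \<and>
        switching_function 2 1 (X T) (LR T) = 0 \<and>
        (\<forall>t. 0 < t \<and> t < T \<longrightarrow> switching_function 2 1 (X t) (LR t) \<noteq> 0) \<and>
        represents q' (rotate_back (X T)) (rotate_back (L1 T)) (rotate_back (LR T)))"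

section \<open>The fixed point\<close>

definition s_root :: real where
  "s_root = (THE s. s > 1 \<and> 1 - 5 * s - 7 * s^2 - 5 * s^3 - 7 * s^4 - 5 * s^5 + s^6 = 0)"

definition z1_out :: complex where
  "z1_out = (let s = s_root in Complex (- 1) ((- 1 + s) / (sqrt 3 * (1 + s))))"

definition z2_out :: complex where
  "z2_out = (let s = s_root in
     Complex (- ((- 1 + s^3) / (sqrt 3 * (1 + s^3))))
             ((1 - 3 * s - 2 * s^2 - 3 * s^3 + s^4) / (3 * (1 + s + s^3 + s^4))))"

text \<open>The point \<open>(0, x_out)\<close> of \<open>real^4\<close>.\<close>

definition q_out :: "real^4" where
  "q_out = vector [0, Re z1_out / Im z1_out,
                      3 * Re z2_out / (2 * (Im z1_out)\<^sup>2),
                      - (3 * Im z2_out / (2 * (Im z1_out)\<^sup>2))]"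

section \<open>Analytic diffeomorphisms and hyperbolic fixed points\<close>

text \<open>Local expansion in a convergent power series indexed by multi-indices
  \<open>k :: nat^'n\<close>.\<close>

definition real_analytic_on :: "(real^'n \<Rightarrow> real^'m) \<Rightarrow> (real^'n) set \<Rightarrow> bool" where
  "real_analytic_on f U \<longleftrightarrow>
     (\<forall>a\<in>U. \<exists>e>0. \<exists>c :: nat^'n \<Rightarrow> real^'m. \<forall>x\<in>ball a e \<inter> U.
        ((\<lambda>k. (\<Prod>i\<in>UNIV. (x $ i - a $ i) ^ (k $ i)) *\<^sub>R c k) has_sum f x) UNIV)"

definition analytic_diffeomorphism_on :: "(real^'n) set \<Rightarrow> (real^'n \<Rightarrow> real^'n) \<Rightarrow> bool" where
  "analytic_diffeomorphism_on U F \<longleftrightarrow>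
     open U \<and> open (F ` U) \<and> inj_on F U \<and>
     real_analytic_on F U \<and> real_analytic_on (inv_into U F) (F ` U)"

text \<open>Complex eigenvalues of a real linear map, through its complexified matrix.\<close>

definition complex_eigenvalue :: "(real^'n \<Rightarrow> real^'n) \<Rightarrow> complex \<Rightarrow> bool" where
  "complex_eigenvalue T c \<longleftrightarrow>
     (\<exists>v. v \<noteq> 0 \<and> (\<chi> i j. complex_of_real (matrix T $ i $ j)) *v v = c *s v)"

definition hyperbolic_fixed_point :: "(real^'n \<Rightarrow> real^'n) \<Rightarrow> real^'n \<Rightarrow> bool" where
  "hyperbolic_fixed_point F p \<longleftrightarrow>
     F p = p \<and>
     (\<exists>T. (F has_derivative T) (at p) \<and> (\<forall>c. complex_eigenvalue T c \<longrightarrow> cmod c \<noteq> 1))"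

text \<open>The local manifolds relative to a neighborhood \<open>N\<close> of \<open>p\<close> on which \<open>F\<close> is injective:
  points whose forward (backward) orbit stays in \<open>N\<close> and converges to \<open>p\<close>.\<close>

definition local_stable_manifold ::
  "('a::topological_space \<Rightarrow> 'a) \<Rightarrow> 'a set \<Rightarrow> 'a \<Rightarrow> 'a set" where
  "local_stable_manifold F N p =
     {x. (\<forall>n. (F ^^ n) x \<in> N) \<and> (\<lambda>n. (F ^^ n) x) \<longlonglongrightarrow> p}"

definition local_unstable_manifold ::
  "('a::topological_space \<Rightarrow> 'a) \<Rightarrow> 'a set \<Rightarrow> 'a \<Rightarrow> 'a set" where
  "local_unstable_manifold F N p =
     {x. \<exists>y. y 0 = x \<and> (\<forall>n. y n \<in> N) \<and> (\<forall>n. F (y (Suc n)) = y n) \<and> y \<longlonglongrightarrow> p}"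

definition smooth_on_interval :: "real \<Rightarrow> real \<Rightarrow> (real \<Rightarrow> 'a::real_normed_vector) \<Rightarrow> bool" where
  "smooth_on_interval a b g \<longleftrightarrow>
     (\<exists>D :: nat \<Rightarrow> real \<Rightarrow> 'a. D 0 = g \<and>
        (\<forall>n. \<forall>t\<in>{a<..<b}. (D n has_vector_derivative D (Suc n) t) (at t)))"

text \<open>Embedded curves: homeomorphic images of an open interval under a \<open>C\<^sup>\<infinity>\<close> immersion.\<close>

definition smooth_curve :: "'a::real_normed_vector set \<Rightarrow> bool" where
  "smooth_curve C \<longleftrightarrow>
     (\<exists>a b g h. a < b \<and> homeomorphism {a<..<b} C g h \<and> smooth_on_interval a b g \<and>
        (\<forall>t\<in>{a<..<b}. vector_derivative g (at t) \<noteq> 0))"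

text \<open>\<open>F\<close> on \<open>U\<close> is an analytic extension of the Reinhardt--Poincare map to a
  neighborhood of \<open>(0, x_out)\<close>. That \<open>F\<close> fixes this point is not demanded here;
  it is part of \<open>hyperbolic_fixed_point\<close>.\<close>

definition reinhardt_poincare_extension :: "(real^4) set \<Rightarrow> (real^4 \<Rightarrow> real^4) \<Rightarrow> bool" where
  "reinhardt_poincare_extension U F \<longleftrightarrow>
     q_out \<in> U \<and> analytic_diffeomorphism_on U F \<and>
     (\<forall>q\<in>U. q $ 1 > 0 \<longrightarrow> reinhardt_poincare q (F q)) \<and>
     F ` {q \<in> U. q $ 1 = 0} = {q \<in> F ` U. q $ 1 = 0}"

end

theory Submission
  imports Defs "HOL-Complex_Analysis.Cauchy_Integral_Formula"
begin

text \<open>Rescale time by \<open>t = r \<tau>\<close>. As \<open>r \<rightarrow> 0\<close> the Reinhardt trajectories become polynomial in \<open>\<tau>\<close>: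
  \<open>X = J + O(r)\<close>, \<open>\<Lambda>\<^sub>1 + 3/2 J = O(r\<^sup>2)\<close> and \<open>\<Lambda>\<^sub>R = O(r\<^sup>3)\<close> have leading terms of degree 1, 2 and 3, and the
  switching function is a cubic with a single positive root. By continuity this determines
  \<open>F\<close> on \<open>r = 0\<close> and the multiplier of \<open>r\<close>: at \<open>q_out\<close> the latter is \<open>s > 1\<close>, and implicit
  differentiation shows that the derivative along the divisor is a contraction for the \<open>l\<^sup>1\<close> norm.
  The unstable curve is the limit of \<open>F\<^sup>n (p + t v / s\<^sup>n)\<close>, with \<open>v\<close> an eigenvector for \<open>s\<close>. It converges
  for complex \<open>t\<close> because the Lipschitz constant of \<open>F\<close> near \<open>p\<close> is below \<open>s\<^sup>2\<close> in a suitable norm,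
  so it is holomorphic, hence smooth. \<open>F\<close> contracts the distance to this curve and expands \<open>r\<close>,
  which identifies both local manifolds.\<close>

section \<open>Complexification of a real-analytic map\<close>

text \<open>Across \<open>r = 0\<close> nothing is known of \<open>F\<close> beyond analyticity and
  invariance of the divisor: the differential equation speaks only of \<open>r > 0\<close>.
  Leading-order asymptotics give the multiplier of \<open>r\<close> and the derivative along the
  divisor, and invariance makes the rest of the first row of the derivative zero. The rest of the
  first column belongs to the next order and is never computed; the saddle theorem is therefore
  stated for an arbitrary such column, which a weighted norm absorbs. The \<open>l\<^sup>1\<close>
  norm is used because its operator norm is the largest column sum: nine crude entry bounds give
  hyperbolicity and contraction without a characteristic polynomial. Complex parameters are used
  because a locally uniform limit of holomorphic maps has all its derivatives at once, where a real
  argument would have to control each order. The return time is the second obstacle: it is not known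
  beforehand to be \<open>O(r)\<close> or to depend smoothly on the initial point. The first is
  deduced from the signs of the switching function, the second from the differentiability of
  \<open>F\<close>.\<close>

definition mpower :: "('a::comm_monoid_mult)^'n \<Rightarrow> nat^'n \<Rightarrow> 'a" where
  "mpower z k = (\<Prod>i\<in>UNIV. z $ i ^ (k $ i))"

definition mdeg :: "nat^'n \<Rightarrow> nat" where
  "mdeg k = (\<Sum>i\<in>UNIV. k $ i)"

lemma norm_mpower_le:
  fixes z :: "complex^'n"
  assumes "\<And>i. norm (z $ i) \<le> d"
  shows "norm (mpower z k) \<le> d ^ mdeg k"
proof -
  have "norm (mpower z k) = (\<Prod>i\<in>UNIV. norm (z $ i) ^ (k $ i))"
    by (simp add: mpower_def norm_power flip: prod_norm)
  also have "\<dots> \<le> (\<Prod>i\<in>UNIV. d ^ (k $ i))"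
    by (intro prod_mono conjI power_mono assms) auto
  also have "\<dots> = d ^ mdeg k"
    by (simp add: mdeg_def power_sum)
  finally show ?thesis .
qed

text \<open>Rescaling both points to the unit polydisc reduces the claim to the Lipschitz bounds for
  products and powers of numbers of norm at most 1. In degree 0 the truncated exponent
  \<open>mdeg k - 1\<close> is harmless, the factor \<open>mdeg k\<close> being 0.\<close>

lemma norm_mpower_diff_le:
  fixes z w :: "complex^'n"
  assumes d: "d > 0" and z: "\<And>i. norm (z $ i) \<le> d" and w: "\<And>i. norm (w $ i) \<le> d"
  shows "norm (mpower z k - mpower w k)
           \<le> real (mdeg k) * d ^ (mdeg k - 1) * (\<Sum>i\<in>UNIV. norm (z $ i - w $ i))"
proof -
  define u where "u x = (\<chi> i. x $ i / of_real d)" for x :: "complex^'n"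
  have scale: "mpower x k = of_real d ^ mdeg k * mpower (u x) k" for x :: "complex^'n"
    using d by (simp add: mpower_def u_def mdeg_def power_sum power_divide prod_dividef)
  have u1: "norm (u x $ i) \<le> 1" if "\<And>i. norm (x $ i) \<le> d" for x :: "complex^'n" and i
    using d that[of i] by (simp add: u_def norm_divide)
  have "norm (mpower (u z) k - mpower (u w) k) \<le> (\<Sum>i\<in>UNIV. norm (u z $ i ^ (k $ i) - u w $ i ^ (k $ i)))"
    unfolding mpower_def
    by (rule norm_prod_diff) (use u1[OF z] u1[OF w] in \<open>auto simp: norm_power power_le_one\<close>)
  also have "\<dots> \<le> (\<Sum>i\<in>UNIV. real (k $ i) * norm (u z $ i - u w $ i))"
    by (intro sum_mono norm_power_diff u1 z w)
  also have "\<dots> = (\<Sum>i\<in>UNIV. real (k $ i) * norm (z $ i - w $ i)) / d"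
    using d by (simp add: u_def norm_divide sum_divide_distrib flip: diff_divide_distrib)
  also have "\<dots> \<le> (\<Sum>i\<in>UNIV. real (mdeg k) * norm (z $ i - w $ i)) / d"
    using d by (intro divide_right_mono sum_mono mult_right_mono) (auto simp: mdeg_def intro: member_le_sum)
  finally have le: "norm (mpower (u z) k - mpower (u w) k)
      \<le> real (mdeg k) * (\<Sum>i\<in>UNIV. norm (z $ i - w $ i)) / d"
    by (simp add: sum_distrib_left)
  have "norm (mpower z k - mpower w k) = d ^ mdeg k * norm (mpower (u z) k - mpower (u w) k)"
    using d by (simp add: scale[of z] scale[of w] norm_mult norm_power flip: right_diff_distrib)
  also have "\<dots> \<le> d ^ mdeg k * (real (mdeg k) * (\<Sum>i\<in>UNIV. norm (z $ i - w $ i)) / d)"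
    using d le by (intro mult_left_mono) auto
  also have "\<dots> = real (mdeg k) * d ^ (mdeg k - 1) * (\<Sum>i\<in>UNIV. norm (z $ i - w $ i))"
    using d by (cases "mdeg k") auto
  finally show ?thesis .
qed

lemma axis_nat_eq_iff: "axis i (Suc 0) = axis j (Suc 0) \<longleftrightarrow> i = j"
  by (simp add: axis_eq_axis)

lemma mdeg_axis: "mdeg (axis i (Suc 0)) = 1"
  by (simp add: mdeg_def axis_def)

lemma mdeg_eq_0: "mdeg k = 0 \<longleftrightarrow> k = 0"
  by (simp add: mdeg_def vec_eq_iff)

lemma mdeg_eq_1:
  assumes "mdeg k = 1"
  obtains i where "k = axis i 1"
proof -
  obtain i where i: "k $ i \<noteq> 0"
    using assms mdeg_eq_0[of k] by (auto simp: vec_eq_iff)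
  have "(\<Sum>j\<in>UNIV. k $ j) = k $ i + (\<Sum>j\<in>UNIV-{i}. k $ j)"
    by (simp add: sum.remove)
  then have "k $ i = 1" "(\<Sum>j\<in>UNIV-{i}. k $ j) = 0"
    using assms i unfolding mdeg_def by linarith+
  then have "k = axis i 1"
    unfolding vec_eq_iff axis_def by auto
  then show ?thesis using that by blast
qed

lemma mpower_axis: "mpower z (axis i (Suc 0)) = z $ i"
proof -
  have "mpower z (axis i (Suc 0)) = (\<Prod>j\<in>UNIV. if j = i then z $ i else 1)"
    unfolding mpower_def by (rule prod.cong) (auto simp: axis_def)
  then show ?thesis by simp
qed

text \<open>Absorbs the degree produced by differentiating a monomial: if
  \<open>d \<le> e / 2\<close>, then \<open>(n + 2) * d ^ n\<close> is at most
  \<open>2 * e ^ n\<close>.\<close>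

lemma real_power_half_bound: "real (n + 2) \<le> 2 * 2 ^ n"
  by (induction n) auto

text \<open>The terms of degree at least two gain a factor \<open>d\<close>, uniformly in the multi-index.\<close>

lemma norm_mpower_remainder_le:
  fixes z w :: "complex^'n"
  assumes d: "0 < d" "d \<le> e / 2" and z: "\<And>i. norm (z $ i) \<le> d" and w: "\<And>i. norm (w $ i) \<le> d"
  shows "norm (mpower z k - mpower w k - (\<Sum>i\<in>UNIV. if k = axis i 1 then z $ i - w $ i else 0))
           \<le> 2 * d / e\<^sup>2 * e ^ mdeg k * (\<Sum>i\<in>UNIV. norm (z $ i - w $ i))"
proof -
  have e: "e > 0" using d by simp
  have nn: "0 \<le> 2 * d / e\<^sup>2 * e ^ mdeg k * (\<Sum>i\<in>UNIV. norm (z $ i - w $ i))"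
    using d e by (intro mult_nonneg_nonneg) (auto intro: sum_nonneg)
  consider "mdeg k = 0" | "mdeg k = 1" | n where "mdeg k = n + 2"
    by (metis One_nat_def add_2_eq_Suc' not0_implies_Suc)
  then show ?thesis
  proof cases
    case 1
    then have "k = 0" by (simp add: mdeg_eq_0)
    then have "(\<Sum>i\<in>UNIV. if k = axis i 1 then z $ i - w $ i else 0) = 0"
      by (intro sum.neutral) (auto simp: vec_eq_iff axis_def)
    with \<open>k = 0\<close> nn show ?thesis by (simp add: mpower_def)
  next
    case 2
    then obtain j where j: "k = axis j 1" by (rule mdeg_eq_1)
    then have "(\<Sum>i\<in>UNIV. if k = axis i 1 then z $ i - w $ i else 0) = z $ j - w $ j"
      by (simp add: axis_nat_eq_iff)
    with j nn show ?thesis by (simp add: mpower_axis)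
  next
    case 3
    have "(\<Sum>i\<in>UNIV. if k = axis i 1 then z $ i - w $ i else 0) = 0"
      using 3 by (intro sum.neutral) (auto simp: mdeg_axis)
    moreover have "real (mdeg k) * d ^ (mdeg k - 1) \<le> 2 * d / e\<^sup>2 * e ^ mdeg k"
    proof -
      have "real (n + 2) * d ^ n \<le> 2 * 2 ^ n * (e / 2) ^ n"
        using d real_power_half_bound[of n] by (intro mult_mono power_mono) auto
      also have "\<dots> = 2 * e ^ n" by (simp add: power_divide)
      finally have "d * (real (n + 2) * d ^ n) \<le> d * (2 * e ^ n)"
        using d by (intro mult_left_mono) auto
      then show ?thesis using 3 e by (simp add: power_add power2_eq_square field_simps)
    qed
    then have "real (mdeg k) * d ^ (mdeg k - 1) * (\<Sum>i\<in>UNIV. norm (z $ i - w $ i))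
        \<le> 2 * d / e\<^sup>2 * e ^ mdeg k * (\<Sum>i\<in>UNIV. norm (z $ i - w $ i))"
      by (intro mult_right_mono sum_nonneg) auto
    ultimately show ?thesis
      using norm_mpower_diff_le[OF d(1) z w, of k] by simp
  qed
qed

section \<open>Complex extension and its strict derivative\<close>

definition cvec :: "real^'n \<Rightarrow> complex^'n" where
  "cvec x = (\<chi> i. complex_of_real (x $ i))"

lemma cvec_nth [simp]: "cvec x $ i = complex_of_real (x $ i)"
  by (simp add: cvec_def)

text \<open>Bounds the Lipschitz constant of \<open>H - T\<close> on the polydisc of radius
  \<open>d\<close> by \<open>C * d\<close>. The two-point form is what contraction estimates need;
  with \<open>w = 0\<close> it is the quadratic Taylor remainder.\<close>

definition quadratic_remainder :: "(complex^'n \<Rightarrow> complex^'n) \<Rightarrow> real^'n^'n \<Rightarrow> real \<Rightarrow> real \<Rightarrow> bool" where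
  "quadratic_remainder H T e C \<longleftrightarrow> (\<forall>d z w j. 0 < d \<longrightarrow> d \<le> e / 2 \<longrightarrow>
      (\<forall>i. norm (z $ i) \<le> d) \<longrightarrow> (\<forall>i. norm (w $ i) \<le> d) \<longrightarrow>
      norm (H z $ j - H w $ j - (\<Sum>i\<in>UNIV. complex_of_real (T $ j $ i) * (z $ i - w $ i)))
        \<le> C * d * (\<Sum>i\<in>UNIV. norm (z $ i - w $ i)))"

lemma quadratic_remainderD:
  assumes "quadratic_remainder H T e C" "0 < d" "d \<le> e / 2"
    and "\<And>i. norm (z $ i) \<le> d" "\<And>i. norm (w $ i) \<le> d"
  shows "norm (H z $ j - H w $ j - (\<Sum>i\<in>UNIV. complex_of_real (T $ j $ i) * (z $ i - w $ i)))
        \<le> C * d * (\<Sum>i\<in>UNIV. norm (z $ i - w $ i))"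
  using assms unfolding quadratic_remainder_def by blast

text \<open>Holomorphy is required only along holomorphic maps of one variable, which avoids any
  notion of holomorphy in several variables; a curve is all that is constructed later. The power
  series itself is hidden from here on.\<close>

locale complexification =
  fixes f :: "real^'n \<Rightarrow> real^'n" and H :: "complex^'n \<Rightarrow> complex^'n"
    and e :: real and T :: "real^'n^'n"
  assumes radius_pos: "e > 0"
    and zero: "H 0 = 0"
    and real_values: "\<And>x j. (\<And>i. \<bar>x $ i\<bar> \<le> e) \<Longrightarrow> H (cvec x) $ j = complex_of_real (f x $ j)"
    and strictly_differentiable: "\<exists>C\<ge>0. quadratic_remainder H T e C"
    and holomorphic_comp: "\<And>S h j. open S \<Longrightarrow> (\<And>i. (\<lambda>t. h t $ i) holomorphic_on S) \<Longrightarrow>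
        (\<And>t i. t \<in> S \<Longrightarrow> norm (h t $ i) \<le> e) \<Longrightarrow> (\<lambda>t. H (h t) $ j) holomorphic_on S"

lemma has_sum_diff:
  fixes f g :: "'a \<Rightarrow> 'b::topological_ab_group_add"
  assumes "(f has_sum a) A" "(g has_sum b) A"
  shows "((\<lambda>x. f x - g x) has_sum (a - b)) A"
  using has_sum_add[OF assms(1), of "\<lambda>x. - g x" "- b"] assms(2) by (simp add: has_sum_uminus)

lemma real_analytic_on_complexification:
  fixes F :: "real^'n \<Rightarrow> real^'n"
  assumes an: "real_analytic_on F U" and U: "open U" "p \<in> U"
  obtains H e T where "complexification (\<lambda>x. F (p + x) - F p) H e T"
proof -
  obtain e0 c where e0: "e0 > 0" and
    c: "\<And>x. x \<in> ball p e0 \<inter> U \<Longrightarrow>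
      ((\<lambda>k. (\<Prod>i\<in>UNIV. (x $ i - p $ i) ^ (k $ i)) *\<^sub>R c k) has_sum F x) UNIV"
    using an U(2) unfolding real_analytic_on_def by blast
  obtain e1 where e1: "e1 > 0" "ball p e1 \<subseteq> ball p e0 \<inter> U"
    using U e0 open_contains_ball[of "ball p e0 \<inter> U"] by (metis IntI centre_in_ball open_Int open_ball)
  \<comment> \<open>The polydisc of radius \<open>e\<close> has to fit into a Euclidean ball; the
    comparison goes through the sum of the coordinates.\<close>
  define e where "e = e1 / (2 * real CARD('n))"
  have e: "e > 0" using e1 by (simp add: e_def)
  have inb: "p + x \<in> ball p e1" if "\<And>i. \<bar>x $ i\<bar> \<le> e" for x
  proof -
    have "norm x \<le> (\<Sum>i\<in>UNIV. \<bar>x $ i\<bar>)" by (rule norm_le_l1_cart)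
    also have "\<dots> \<le> (\<Sum>i\<in>(UNIV::'n set). e)" by (intro sum_mono that)
    also have "\<dots> < e1" using e1 by (simp add: e_def)
    finally show ?thesis by (simp add: dist_norm)
  qed
  have hs: "((\<lambda>k. mpower x k * (c k $ j)) has_sum F (p + x) $ j) UNIV"
    if "\<And>i. \<bar>x $ i\<bar> \<le> e" for x j
  proof -
    have "p + x \<in> ball p e0 \<inter> U" using inb[OF that] e1 by blast
    from has_sum_bounded_linear[OF bounded_linear_vec_nth c[OF this], of j]
    show ?thesis by (simp add: mpower_def)
  qed
  define a where "a j k = \<bar>c k $ j\<bar> * e ^ mdeg k" for j k
  \<comment> \<open>Convergence at the single corner point \<open>(e, ..., e)\<close> is enough: an
    unconditionally convergent real sum converges absolutely, and it dominates the complex series on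
    the whole closed polydisc.\<close>
  have a_summable: "a j summable_on UNIV" for j
  proof -
    have "((\<lambda>k. mpower (\<chi> i. e) k * (c k $ j)) has_sum F (p + (\<chi> i. e)) $ j) UNIV"
      using e by (intro hs) simp
    then have "(\<lambda>k. mpower (\<chi> i. e) k * (c k $ j)) summable_on UNIV"
      by (rule has_sum_imp_summable)
    then have "(\<lambda>k. \<bar>mpower (\<chi> i. e) k * (c k $ j)\<bar>) summable_on UNIV"
      unfolding summable_on_iff_abs_summable_on_real[of "\<lambda>k. mpower (\<chi> i. e) k * (c k $ j)"] real_norm_def .
    moreover have "\<bar>mpower (\<chi> i. e) k * (c k $ j)\<bar> = a j k" for k :: "nat^'n"
      using e by (simp add: a_def mpower_def mdeg_def abs_mult power_sum prod_nonneg)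
    ultimately show ?thesis by simp
  qed
  define t where "t j k z = complex_of_real (c k $ j) * mpower z k" for j k z
  have t_le: "norm (t j k z) \<le> a j k" if "\<And>i. norm (z $ i) \<le> e" for j k z
    using norm_mpower_le[of z e k] that by (simp add: t_def a_def norm_mult mult_left_mono)
  define G where "G j z = (\<Sum>\<^sub>\<infinity>k. t j k z)" for j z
  have t_sum: "((\<lambda>k. t j k z) has_sum G j z) UNIV" if "\<And>i. norm (z $ i) \<le> e" for j z
  proof -
    have "(\<lambda>k. norm (t j k z)) summable_on UNIV"
      by (rule Infinite_Sum.abs_summable_on_comparison_test'[OF a_summable[of j]]) (use t_le that in auto)
    then show ?thesis unfolding G_def by (rule has_sum_infsum[OF abs_summable_summable])
  qed
  define H where "H z = (\<chi> j. G j z - G j 0)" for z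
  define T :: "real^'n^'n" where "T = (\<chi> j i. c (axis i (Suc 0)) $ j)"
  have mp: "mpower (cvec x) k = complex_of_real (mpower x k)" for x k
    by (simp add: mpower_def)
  have G_real: "G j (cvec x) = complex_of_real (F (p + x) $ j)" if "\<And>i. \<bar>x $ i\<bar> \<le> e" for j x
  proof -
    have "((\<lambda>k. t j k (cvec x)) has_sum complex_of_real (F (p + x) $ j)) UNIV"
      using has_sum_of_real[OF hs[OF that, of j], where 'a=complex]
      by (simp add: t_def mp mult.commute)
    moreover have "((\<lambda>k. t j k (cvec x)) has_sum G j (cvec x)) UNIV"
      using that by (intro t_sum) simp
    ultimately show ?thesis using has_sum_unique by blast
  qed
  have cvec0: "cvec 0 = (0 :: complex^'n)" by (simp add: vec_eq_iff)
  have diff: "norm (H z $ j - H w $ j - (\<Sum>i\<in>UNIV. complex_of_real (T $ j $ i) * (z $ i - w $ i)))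
      \<le> 2 * d / e\<^sup>2 * infsum (a j) UNIV * (\<Sum>i\<in>UNIV. norm (z $ i - w $ i))"
    if d: "0 < d" "d \<le> e / 2" and z: "\<And>i. norm (z $ i) \<le> d" and w: "\<And>i. norm (w $ i) \<le> d"
    for z w j d
  proof -
    define \<mu> where "\<mu> = (\<Sum>i\<in>UNIV. norm (z $ i - w $ i))"
    define l where "l k = (\<Sum>i\<in>UNIV. if k = axis i (Suc 0) then z $ i - w $ i else 0)" for k
    have z': "norm (z $ i) \<le> e" and w': "norm (w $ i) \<le> e" for i
      using z[of i] w[of i] d by linarith+
    \<comment> \<open>The linear part is itself written as a sum over multi-indices, supported on
      the unit ones, so that it can be subtracted termwise.\<close>
    have "((\<lambda>k. complex_of_real (c k $ j) * l k)
            has_sum (\<Sum>i\<in>UNIV. complex_of_real (T $ j $ i) * (z $ i - w $ i))) UNIV"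
    proof (rule has_sum_finite_neutralI)
      show "finite (range (\<lambda>i::'n. axis i (Suc 0)))" by simp
      show "complex_of_real (c k $ j) * l k = 0" if "k \<in> UNIV - range (\<lambda>i::'n. axis i (Suc 0))" for k
        using that by (auto simp: l_def intro!: sum.neutral)
      have "(\<Sum>k\<in>range (\<lambda>i. axis i (Suc 0)). complex_of_real (c k $ j) * l k)
          = (\<Sum>i\<in>UNIV. complex_of_real (c (axis i (Suc 0)) $ j) * l (axis i (Suc 0)))"
        by (subst sum.reindex) (auto simp: inj_on_def axis_nat_eq_iff)
      also have "\<dots> = (\<Sum>i\<in>UNIV. complex_of_real (T $ j $ i) * (z $ i - w $ i))"
        by (simp add: l_def axis_nat_eq_iff T_def)
      finally show "(\<Sum>i\<in>UNIV. complex_of_real (T $ j $ i) * (z $ i - w $ i))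
          = (\<Sum>k\<in>range (\<lambda>i. axis i (Suc 0)). complex_of_real (c k $ j) * l k)" by simp
    qed simp
    then have "((\<lambda>k. t j k z - t j k w - complex_of_real (c k $ j) * l k)
        has_sum (G j z - G j w - (\<Sum>i\<in>UNIV. complex_of_real (T $ j $ i) * (z $ i - w $ i)))) UNIV"
      using t_sum[OF z', of j] t_sum[OF w', of j] by (intro has_sum_diff)
    moreover have "((\<lambda>k. 2 * d / e\<^sup>2 * \<mu> * a j k) has_sum (2 * d / e\<^sup>2 * \<mu> * infsum (a j) UNIV)) UNIV"
      by (intro has_sum_cmult_right has_sum_infsum a_summable)
    moreover have "norm (t j k z - t j k w - complex_of_real (c k $ j) * l k)
        \<le> 2 * d / e\<^sup>2 * \<mu> * a j k" for k
    proof -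
      have "norm (t j k z - t j k w - complex_of_real (c k $ j) * l k)
          = \<bar>c k $ j\<bar> * norm (mpower z k - mpower w k - l k)"
        by (simp add: t_def norm_mult flip: right_diff_distrib)
      also have "\<dots> \<le> \<bar>c k $ j\<bar> * (2 * d / e\<^sup>2 * e ^ mdeg k * \<mu>)"
        unfolding l_def \<mu>_def
        using norm_mpower_remainder_le[OF d z w, of k] by (intro mult_left_mono) simp_all
      finally show ?thesis by (simp add: a_def mult_ac)
    qed
    ultimately have "norm (G j z - G j w - (\<Sum>i\<in>UNIV. complex_of_real (T $ j $ i) * (z $ i - w $ i)))
        \<le> 2 * d / e\<^sup>2 * \<mu> * infsum (a j) UNIV"
      by (rule norm_infsum_le)
    then show ?thesis by (simp add: H_def \<mu>_def mult_ac)
  qed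
  define A where "A = 1 + (\<Sum>j\<in>UNIV. infsum (a j) UNIV)"
  have a_nn: "0 \<le> infsum (a j) UNIV" for j
    using e by (intro infsum_nonneg) (simp add: a_def)
  have A: "infsum (a j) UNIV \<le> A" "A > 0" for j
    using member_le_sum[of j UNIV "\<lambda>j. infsum (a j) UNIV"] a_nn
    by (simp_all add: A_def add_pos_nonneg sum_nonneg)
  have "complexification (\<lambda>x. F (p + x) - F p) H e T"
  proof
    show "e > 0" by (fact e)
    show "H 0 = 0" by (simp add: H_def vec_eq_iff)
    show "H (cvec x) $ j = complex_of_real ((F (p + x) - F p) $ j)" if "\<And>i. \<bar>x $ i\<bar> \<le> e" for x j
      using G_real[OF that, of j] G_real[of 0 j] e by (simp add: H_def cvec0)
    show "\<exists>C\<ge>0. quadratic_remainder H T e C"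
      unfolding quadratic_remainder_def
    proof (intro exI conjI allI impI)
      show "0 \<le> 2 * A / e\<^sup>2" using A by simp
      fix d j and z w :: "complex^'n"
      assume d: "0 < d" "d \<le> e / 2"
        and zw: "\<forall>i. norm (z $ i) \<le> d" "\<forall>i. norm (w $ i) \<le> d"
      have "2 * d / e\<^sup>2 * infsum (a j) UNIV \<le> 2 * A / e\<^sup>2 * d"
        using mult_left_mono[OF A(1)[of j], of "2 * d / e\<^sup>2"] d by (simp add: mult_ac)
      then have "2 * d / e\<^sup>2 * infsum (a j) UNIV * (\<Sum>i\<in>UNIV. norm (z $ i - w $ i))
          \<le> 2 * A / e\<^sup>2 * d * (\<Sum>i\<in>UNIV. norm (z $ i - w $ i))"
        by (rule mult_right_mono) (simp add: sum_nonneg)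
      then show "norm (H z $ j - H w $ j - (\<Sum>i\<in>UNIV. complex_of_real (T $ j $ i) * (z $ i - w $ i)))
          \<le> 2 * A / e\<^sup>2 * d * (\<Sum>i\<in>UNIV. norm (z $ i - w $ i))"
        using diff[OF d zw(1)[rule_format] zw(2)[rule_format], of j] by linarith
    qed
    show "(\<lambda>s. H (h s) $ j) holomorphic_on S"
      if S: "open S" and h: "\<And>i. (\<lambda>s. h s $ i) holomorphic_on S"
        and le: "\<And>s i. s \<in> S \<Longrightarrow> norm (h s $ i) \<le> e" for S h j
    proof -
      have hol: "(\<lambda>s. \<Sum>k\<in>K. t j k (h s)) holomorphic_on S" for K
        unfolding t_def mpower_def by (intro holomorphic_intros h)
      \<comment> \<open>The sum over multi-indices is unordered, so the M-test and the theorem on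
        uniform limits of holomorphic functions are used along the filter of finite index
        sets.\<close>
      have ul: "uniform_limit S (\<lambda>K s. \<Sum>k\<in>K. t j k (h s)) (\<lambda>s. G j (h s)) (finite_subsets_at_top UNIV)"
        unfolding G_def
        by (rule Weierstrass_m_test_general[OF _ a_summable[of j]]) (use t_le le in auto)
      have "(\<lambda>s. G j (h s)) holomorphic_on S"
      proof -
        have "\<exists>f'. ((\<lambda>s. G j (h s)) has_field_derivative f') (at x)" if x: "x \<in> S" for x
        proof -
          obtain r where r: "r > 0" "cball x r \<subseteq> S"
            using S x open_contains_cball[of S] by auto
          have "(\<lambda>s. G j (h s)) holomorphic_on ball x r"
          proof (rule holomorphic_uniform_limit)
            show "\<forall>\<^sub>F K in finite_subsets_at_top UNIV.
                continuous_on (cball x r) (\<lambda>s. \<Sum>k\<in>K. t j k (h s)) \<and>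
                (\<lambda>s. \<Sum>k\<in>K. t j k (h s)) holomorphic_on ball x r"
            proof (intro always_eventually allI conjI)
              fix K
              show "continuous_on (cball x r) (\<lambda>s. \<Sum>k\<in>K. t j k (h s))"
                by (intro holomorphic_on_imp_continuous_on holomorphic_on_subset[OF hol r(2)])
              show "(\<lambda>s. \<Sum>k\<in>K. t j k (h s)) holomorphic_on ball x r"
                using r by (intro holomorphic_on_subset[OF hol]) auto
            qed
            show "uniform_limit (cball x r) (\<lambda>K s. \<Sum>k\<in>K. t j k (h s)) (\<lambda>s. G j (h s))
                (finite_subsets_at_top UNIV)"
              by (rule uniform_limit_on_subset[OF ul r(2)])
          qed auto
          with r show ?thesis
            by (auto simp: holomorphic_on_open)
        qed
        then show ?thesis using S by (simp add: holomorphic_on_open)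
      qed
      then show ?thesis by (simp add: H_def) (intro holomorphic_intros)
    qed
  qed
  then show ?thesis by (rule that)
qed

section \<open>The unstable curve of a saddle\<close>

text \<open>In block form with coordinate \<open>a\<close> first, \<open>T\<close> is lower
  triangular, with \<open>\<mu>\<close> in the corner and an \<open>l1\<close>-contraction on the
  hyperplane. The entries of column \<open>a\<close> below the corner are unrestricted.\<close>

locale saddle = complexification f H e T
  for f :: "real^'n \<Rightarrow> real^'n" and H e T +
  fixes a :: 'n and \<mu> \<kappa> :: real
  assumes row: "T $ a $ j = (if j = a then \<mu> else 0)"
    and expanding: "\<mu> > 1"
    and columns: "j \<noteq> a \<Longrightarrow> (\<Sum>i\<in>UNIV. \<bar>T $ i $ j\<bar>) \<le> \<kappa>"
    and contracting: "\<kappa> < 1"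
begin

text \<open>Row \<open>a\<close> of \<open>T - \<mu>\<close> vanishes, so there is a kernel vector
  \<open>u\<close>. If \<open>u $ a\<close> were 0, then \<open>T\<close> would not increase the
  \<open>l1\<close> norm of \<open>u\<close>, against \<open>\<mu> > 1\<close>; so \<open>u\<close>
  can be normalised.\<close>

lemma unstable_eigenvector:
  obtains v where "T *v v = \<mu> *\<^sub>R v" "v $ a = 1"
proof -
  define M where "M = T - \<mu> *\<^sub>R mat 1"
  have "row a M = 0"
    by (simp add: M_def row_def vec_eq_iff row mat_def)
  then have "det M = 0" by (rule det_zero_row)
  then have "\<not> invertible M" by (simp add: invertible_det_nz)
  then obtain u where u: "M *v u = 0" "u \<noteq> 0"
    by (auto simp: invertible_left_inverse matrix_left_invertible_ker)
  have Tu: "T *v u = \<mu> *\<^sub>R u"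
    using u(1) by (simp add: M_def matrix_vector_mult_diff_rdistrib scaleR_matrix_vector_assoc[symmetric])
  have "u $ a \<noteq> 0"
  proof
    assume ua: "u $ a = 0"
    define S where "S = (\<Sum>i\<in>UNIV. \<bar>u $ i\<bar>)"
    have "\<mu> * S = (\<Sum>i\<in>UNIV. \<bar>(T *v u) $ i\<bar>)"
      using expanding by (simp add: Tu S_def sum_distrib_left abs_mult)
    also have "\<dots> \<le> (\<Sum>i\<in>UNIV. \<Sum>j\<in>UNIV. \<bar>T $ i $ j\<bar> * \<bar>u $ j\<bar>)"
      by (intro sum_mono) (simp add: matrix_vector_mult_def order_trans[OF sum_abs] abs_mult)
    also have "\<dots> = (\<Sum>j\<in>UNIV. (\<Sum>i\<in>UNIV. \<bar>T $ i $ j\<bar>) * \<bar>u $ j\<bar>)"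
      by (subst sum.swap) (simp add: sum_distrib_right)
    also have "\<dots> \<le> (\<Sum>j\<in>UNIV. 1 * \<bar>u $ j\<bar>)"
    proof (intro sum_mono)
      fix j
      show "(\<Sum>i\<in>UNIV. \<bar>T $ i $ j\<bar>) * \<bar>u $ j\<bar> \<le> 1 * \<bar>u $ j\<bar>"
        using columns[of j] contracting ua mult_right_mono[of "\<Sum>i\<in>UNIV. \<bar>T $ i $ j\<bar>" 1 "\<bar>u $ j\<bar>"]
        by (cases "j = a") auto
    qed
    finally have "(\<mu> - 1) * S \<le> 0" by (simp add: S_def algebra_simps)
    then have "S \<le> 0" using expanding by (simp add: mult_le_0_iff)
    then have "\<bar>u $ i\<bar> \<le> 0" for i
      using member_le_sum[of i UNIV "\<lambda>i. \<bar>u $ i\<bar>"] by (simp add: S_def)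
    with u(2) show False by (simp add: vec_eq_iff)
  qed
  with Tu show ?thesis
    by (intro that[of "(1 / u $ a) *\<^sub>R u"]) (auto simp: matrix_vector_mult_scaleR)
qed

end

text \<open>A weight on the \<open>a\<close>-coordinate makes the operator norm of \<open>T\<close> at most
  \<open>\<mu> + \<eta>\<close>, whatever the size of the off-diagonal entries of its column \<open>a\<close>.\<close>

locale weighted = saddle f H e T a \<mu> \<kappa>
  for f :: "real^'n \<Rightarrow> real^'n" and H e T a \<mu> \<kappa> +
  fixes K C :: real
  assumes K1: "K \<ge> 1" and K2: "(\<Sum>i\<in>UNIV - {a}. \<bar>T $ i $ a\<bar>) \<le> K * (\<mu>\<^sup>2 - \<mu>) / 4"
    and C0: "C \<ge> 0"
    and C: "quadratic_remainder H T e C"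
begin

definition wt :: "'n \<Rightarrow> real" where
  "wt i = (if i = a then K else 1)"

definition nu :: "complex^'n \<Rightarrow> real" where
  "nu z = (\<Sum>i\<in>UNIV. wt i * norm (z $ i))"

definition W :: real where
  "W = (\<Sum>i\<in>UNIV. wt i)"

definition T\<^sub>C :: "complex^'n \<Rightarrow> complex^'n" where
  "T\<^sub>C z = (\<chi> j. \<Sum>i\<in>UNIV. complex_of_real (T $ j $ i) * z $ i)"

lemma wt_ge_1: "1 \<le> wt i"
  using K1 by (simp add: wt_def)

lemma W_ge_1: "1 \<le> W"
proof -
  have "1 \<le> wt a" by (rule wt_ge_1)
  also have "wt a \<le> W"
    unfolding W_def using wt_ge_1 by (intro member_le_sum) (auto intro: order_trans[of 0 1])
  finally show ?thesis .
qed

lemma nu_nonneg: "0 \<le> nu z"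
  using wt_ge_1 by (auto simp: nu_def intro!: sum_nonneg mult_nonneg_nonneg intro: order_trans[of 0 1])

lemma nu_triangle: "nu (z + w) \<le> nu z + nu w"
  unfolding nu_def sum.distrib[symmetric]
proof (rule sum_mono)
  fix i
  have "wt i * norm ((z + w) $ i) \<le> wt i * (norm (z $ i) + norm (w $ i))"
    using wt_ge_1[of i] norm_triangle_ineq[of "z $ i" "w $ i"] by (intro mult_left_mono) auto
  then show "wt i * norm ((z + w) $ i) \<le> wt i * norm (z $ i) + wt i * norm (w $ i)"
    by (simp add: distrib_left)
qed

lemma sum_norm_le_nu: "(\<Sum>i\<in>UNIV. norm (z $ i)) \<le> nu z"
  unfolding nu_def using wt_ge_1 mult_right_mono[OF wt_ge_1 norm_ge_zero] by (intro sum_mono) auto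

lemma component_le_nu: "norm (z $ i) \<le> nu z"
  using member_le_sum[of i UNIV "\<lambda>i. norm (z $ i)"] sum_norm_le_nu[of z] by simp

lemma nu_scale: "nu (c *s z) = norm c * nu z"
  by (simp add: nu_def norm_mult sum_distrib_left mult_ac)

lemma nu_T: "nu (T\<^sub>C z) \<le> (\<mu> + (\<mu>\<^sup>2 - \<mu>) / 4) * nu z"
proof -
  define \<eta> where "\<eta> = (\<mu>\<^sup>2 - \<mu>) / 4"
  have \<eta>: "\<eta> > 0" using expanding by (simp add: \<eta>_def power2_eq_square)
  have "nu (T\<^sub>C z) \<le> (\<Sum>i\<in>UNIV. wt i * (\<Sum>j\<in>UNIV. \<bar>T $ i $ j\<bar> * norm (z $ j)))"
    unfolding nu_def T\<^sub>C_def
    using wt_ge_1 by (intro sum_mono mult_left_mono)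
      (auto intro!: order_trans[OF norm_sum] simp: norm_mult intro: order_trans[of 0 1])
  also have "\<dots> = (\<Sum>j\<in>UNIV. (\<Sum>i\<in>UNIV. wt i * \<bar>T $ i $ j\<bar>) * norm (z $ j))"
    unfolding sum_distrib_left sum_distrib_right by (subst sum.swap) (simp add: mult_ac)
  also have "\<dots> \<le> (\<Sum>j\<in>UNIV. (\<mu> + \<eta>) * wt j * norm (z $ j))"
  proof (intro sum_mono mult_right_mono)
    fix j
    show "(\<Sum>i\<in>UNIV. wt i * \<bar>T $ i $ j\<bar>) \<le> (\<mu> + \<eta>) * wt j"
    proof (cases "j = a")
      case True
      have "(\<Sum>i\<in>UNIV. wt i * \<bar>T $ i $ j\<bar>) = K * \<mu> + (\<Sum>i\<in>UNIV - {a}. \<bar>T $ i $ a\<bar>)"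
        using expanding by (subst sum.remove[of _ a]) (auto simp: wt_def row True)
      also have "\<dots> \<le> K * \<mu> + K * \<eta>"
        using K2 by (simp add: \<eta>_def)
      finally show ?thesis by (simp add: wt_def True algebra_simps)
    next
      case False
      have "(\<Sum>i\<in>UNIV. wt i * \<bar>T $ i $ j\<bar>) = (\<Sum>i\<in>UNIV. \<bar>T $ i $ j\<bar>)"
        using False by (intro sum.cong) (auto simp: wt_def row)
      also have "\<dots> \<le> \<kappa>" using columns False by blast
      finally show ?thesis using False contracting expanding \<eta> by (simp add: wt_def)
    qed
  qed auto
  also have "\<dots> = (\<mu> + \<eta>) * nu z"
    unfolding nu_def sum_distrib_left by (simp add: mult_ac)
  finally show ?thesis by (simp add: \<eta>_def)
qed

lemma nu_remainder:
  assumes d: "0 < d" "d \<le> e / 2" and z: "nu z \<le> d" and w: "nu w \<le> d"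
  shows "nu (H z - H w - T\<^sub>C (z - w)) \<le> W * C * d * nu (z - w)"
proof -
  have z': "norm (z $ i) \<le> d" and w': "norm (w $ i) \<le> d" for i
    using component_le_nu[of z i] component_le_nu[of w i] z w by auto
  have "nu (H z - H w - T\<^sub>C (z - w)) \<le> (\<Sum>i\<in>UNIV. wt i * (C * d * nu (z - w)))"
    unfolding nu_def
  proof (intro sum_mono mult_left_mono)
    fix i
    have "norm ((H z - H w - T\<^sub>C (z - w)) $ i) \<le> C * d * (\<Sum>i\<in>UNIV. norm (z $ i - w $ i))"
      using quadratic_remainderD[OF C d z' w', of i] by (simp add: T\<^sub>C_def)
    also have "\<dots> \<le> C * d * nu (z - w)"
      using sum_norm_le_nu[of "z - w"] C0 d by (intro mult_left_mono) auto
    finally show "norm ((H z - H w - T\<^sub>C (z - w)) $ i) \<le> C * d * (\<Sum>i\<in>UNIV. wt i * norm ((z - w) $ i))"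
      by (simp add: nu_def)
    show "0 \<le> wt i" using wt_ge_1[of i] by linarith
  qed
  also have "\<dots> = W * C * d * nu (z - w)"
    unfolding W_def sum_distrib_right by (simp add: mult_ac)
  finally show ?thesis .
qed

text \<open>A share \<open>\<mu> + (\<mu>\<^sup>2 - \<mu>) / 4\<close> comes from \<open>T\<close>
  and another \<open>(\<mu>\<^sup>2 - \<mu>) / 4\<close> is left for the remainder; the total is the
  midpoint of \<open>\<mu>\<close> and \<open>\<mu>\<^sup>2\<close>.\<close>

definition L :: real where "L = (\<mu> + \<mu>\<^sup>2) / 2"

lemma L: "0 < L" "L < \<mu>\<^sup>2"
proof -
  have "\<mu> < \<mu>\<^sup>2" using expanding by (simp add: power2_eq_square)
  then show "0 < L" "L < \<mu>\<^sup>2" using expanding unfolding L_def by auto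
qed

text \<open>The second bound brings the Lipschitz constant \<open>W * C * \<delta>\<close> of the
  remainder down to a quarter of the gap \<open>\<mu>\<^sup>2 - \<mu>\<close>; the added 1 keeps the
  denominator positive when \<open>C = 0\<close>.\<close>

definition \<delta> :: real where
  "\<delta> = min (e / 2) ((\<mu>\<^sup>2 - \<mu>) / (4 * (1 + W * C)))"

lemma \<delta>: "0 < \<delta>" "\<delta> \<le> e / 2" "W * C * \<delta> \<le> (\<mu>\<^sup>2 - \<mu>) / 4"
proof -
  have q: "0 < \<mu>\<^sup>2 - \<mu>" using expanding by (simp add: power2_eq_square)
  have WC: "0 \<le> W * C" using W_ge_1 C0 by simp
  show "0 < \<delta>"
    using q WC radius_pos by (auto simp: \<delta>_def intro!: divide_pos_pos)
  show "\<delta> \<le> e / 2"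
    unfolding \<delta>_def by (rule min.cobounded1)
  have "W * C * \<delta> \<le> W * C * ((\<mu>\<^sup>2 - \<mu>) / (4 * (1 + W * C)))"
    using WC by (intro mult_left_mono) (simp_all add: \<delta>_def)
  also have "\<dots> \<le> (\<mu>\<^sup>2 - \<mu>) / 4"
    using q WC by (simp add: divide_simps)
  finally show "W * C * \<delta> \<le> (\<mu>\<^sup>2 - \<mu>) / 4" .
qed

lemma H_lipschitz:
  assumes z: "nu z \<le> \<delta>" and w: "nu w \<le> \<delta>"
  shows "nu (H z - H w) \<le> L * nu (z - w)"
proof -
  have "nu (H z - H w) \<le> nu (H z - H w - T\<^sub>C (z - w)) + nu (T\<^sub>C (z - w))"
    using nu_triangle[of "H z - H w - T\<^sub>C (z - w)" "T\<^sub>C (z - w)"] by simp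
  also have "\<dots> \<le> W * C * \<delta> * nu (z - w) + (\<mu> + (\<mu>\<^sup>2 - \<mu>) / 4) * nu (z - w)"
    by (intro add_mono nu_remainder nu_T \<delta> z w)
  also have "\<dots> \<le> (\<mu>\<^sup>2 - \<mu>) / 4 * nu (z - w) + (\<mu> + (\<mu>\<^sup>2 - \<mu>) / 4) * nu (z - w)"
    using \<delta>(3) nu_nonneg by (intro add_mono mult_right_mono) auto
  also have "\<dots> = L * nu (z - w)" by (simp add: L_def field_simps)
  finally show ?thesis .
qed

text \<open>The remainder estimate is taken on the ball of radius \<open>nu z\<close> itself, which
  yields the square; radius 0 is excluded there, hence the case distinction.\<close>

lemma H_quadratic:
  assumes z: "nu z \<le> \<delta>"
  shows "nu (H z - T\<^sub>C z) \<le> W * C * (nu z)\<^sup>2"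
proof (cases "nu z = 0")
  case True
  then have "norm (z $ i) \<le> 0" for i using component_le_nu[of z i] by simp
  then have "z = 0" by (simp add: vec_eq_iff)
  then show ?thesis by (simp add: zero nu_def T\<^sub>C_def)
next
  case False
  then have "0 < nu z" using nu_nonneg[of z] by simp
  then have "nu (H z - H 0 - T\<^sub>C (z - 0)) \<le> W * C * nu z * nu (z - 0)"
    using z \<delta>(2) by (intro nu_remainder) (auto simp: nu_def)
  then show ?thesis by (simp add: zero power2_eq_square mult_ac)
qed

end

section \<open>The unstable curve as a limit of rescaled iterates\<close>

context weighted
begin

context
  fixes v :: "real^'n"
  assumes v: "T *v v = \<mu> *\<^sub>R v" "v $ a = 1"
begin

text \<open>\<open>G n t\<close> is the n-th iterate of \<open>H\<close> at \<open>v\<close> scaled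
  by \<open>t / \<mu> ^ n\<close>. Peeling off the outermost \<open>H\<close> leaves the same
  expression at \<open>t / \<mu>\<close>, so inductions stay on one fixed disc of
  parameters.\<close>

fun G :: "nat \<Rightarrow> complex \<Rightarrow> complex^'n" where
  "G 0 t = t *s cvec v"
| "G (Suc n) t = H (G n (t / of_real \<mu>))"

text \<open>Passing from \<open>t\<close> to \<open>t / \<mu>\<close> divides a quadratic error by
  \<open>\<mu>\<^sup>2\<close>, and one application of \<open>H\<close> multiplies it by at most
  \<open>L\<close>: \<open>\<theta>\<close> is the net factor. \<open>B\<close> measures the first
  error and \<open>B'\<close> the geometric sum of all of them; \<open>r\<close> keeps the iterates
  in the ball of radius \<open>\<delta>\<close>, and \<open>r \<le> 1\<close> allows the square of
  \<open>norm t\<close> to be bounded by \<open>norm t\<close>.\<close>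

definition \<theta> :: real where "\<theta> = L / \<mu>\<^sup>2"
definition B :: real where "B = W * C * (nu (cvec v))\<^sup>2 / \<mu>\<^sup>2"
definition B' :: real where "B' = B / (1 - \<theta>)"
definition r :: real where "r = min 1 (\<delta> / (nu (cvec v) + B' + 1))"

lemma \<theta>: "0 < \<theta>" "\<theta> < 1"
  using L expanding by (simp_all add: \<theta>_def)

lemma B_nonneg: "0 \<le> B" "0 \<le> B'"
  using W_ge_1 C0 \<theta> by (simp_all add: B_def B'_def)

lemma r: "0 < r" "r \<le> 1" "r * (nu (cvec v) + B') \<le> \<delta>"
proof -
  have D: "0 < nu (cvec v) + B' + 1" using nu_nonneg[of "cvec v"] B_nonneg by simp
  show "0 < r" "r \<le> 1" using D \<delta> by (auto simp: r_def)
  have "r * (nu (cvec v) + B') \<le> r * (nu (cvec v) + B' + 1)"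
    using \<open>0 < r\<close> by simp
  also have "\<dots> \<le> \<delta> / (nu (cvec v) + B' + 1) * (nu (cvec v) + B' + 1)"
    using D by (intro mult_right_mono) (auto simp: r_def)
  also have "\<dots> = \<delta>" using D by simp
  finally show "r * (nu (cvec v) + B') \<le> \<delta>" .
qed

lemma nu_near_line:
  assumes "nu (z - t *s cvec v) \<le> B' * (norm t)\<^sup>2" "norm t \<le> r"
  shows "nu z \<le> \<delta>"
proof -
  have "nu z \<le> nu (z - t *s cvec v) + nu (t *s cvec v)"
    using nu_triangle[of "z - t *s cvec v" "t *s cvec v"] by simp
  also have "\<dots> \<le> B' * (norm t)\<^sup>2 + norm t * nu (cvec v)"
    using assms by (simp add: nu_scale)
  also have "\<dots> \<le> B' * norm t + norm t * nu (cvec v)"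
    using assms(2) r(2) B_nonneg mult_left_le_one_le[of "norm t" "norm t"]
    by (intro add_mono mult_left_mono) (auto simp: power2_eq_square)
  also have "\<dots> = norm t * (nu (cvec v) + B')" by (simp add: algebra_simps)
  also have "\<dots> \<le> r * (nu (cvec v) + B')"
    using assms(2) B_nonneg nu_nonneg by (intro mult_right_mono) auto
  finally show ?thesis using r(3) by simp
qed

lemma T\<^sub>C_v: "T\<^sub>C (t *s cvec v) = (t * of_real \<mu>) *s cvec v"
proof -
  have "(\<Sum>i\<in>UNIV. complex_of_real (T $ j $ i) * (t * complex_of_real (v $ i)))
      = t * of_real \<mu> * complex_of_real (v $ j)" for j
  proof -
    have "(\<Sum>i\<in>UNIV. T $ j $ i * v $ i) = \<mu> * v $ j"
      using v(1) by (simp add: vec_eq_iff matrix_vector_mult_def)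
    then have "t * complex_of_real (\<Sum>i\<in>UNIV. T $ j $ i * v $ i) = t * of_real (\<mu> * v $ j)"
      by simp
    then show ?thesis by (simp add: sum_distrib_left mult_ac)
  qed
  then show ?thesis by (simp add: T\<^sub>C_def vec_eq_iff)
qed

lemma geometric_le: "B * (\<Sum>m<n. \<theta> ^ m) \<le> B'"
proof -
  have "(\<Sum>m<n. \<theta> ^ m) \<le> 1 / (1 - \<theta>)"
    using \<theta> by (simp add: sum_gp_strict divide_right_mono)
  then show ?thesis using B_nonneg mult_left_mono by (fastforce simp: B'_def)
qed

lemma norm_divide_le: "norm (t / of_real \<mu>) \<le> norm t" for t :: complex
proof -
  have "norm (t / of_real \<mu>) = norm t / \<mu>" using expanding by (simp add: norm_divide)
  also have "\<dots> \<le> norm t" using expanding mult_left_mono[of 1 \<mu> "norm t"] by (simp add: divide_simps)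
  finally show ?thesis .
qed

lemma norm_divide_less: "norm t < r \<Longrightarrow> norm (t / of_real \<mu>) < r" for t :: complex
  using norm_divide_le order_le_less_trans by blast

text \<open>The two estimates need each other: closeness to the line follows by summing the
  increments, and it puts the iterates where the Lipschitz bound for the next increment
  holds.\<close>

lemma G_bounds:
  assumes "norm t \<le> r"
  shows "nu (G n t - t *s cvec v) \<le> B * (\<Sum>m<n. \<theta> ^ m) * (norm t)\<^sup>2"
    and "nu (G (Suc n) t - G n t) \<le> \<theta> ^ n * B * (norm t)\<^sup>2"
proof -
  have sc: "(norm (t / of_real \<mu>))\<^sup>2 = (norm t)\<^sup>2 / \<mu>\<^sup>2" for t :: complex
    by (simp add: norm_divide power_divide)
  have "\<forall>t. norm t \<le> r \<longrightarrow> nu (G n t - t *s cvec v) \<le> B * (\<Sum>m<n. \<theta> ^ m) * (norm t)\<^sup>2 \<and>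
      nu (G (Suc n) t - G n t) \<le> \<theta> ^ n * B * (norm t)\<^sup>2"
  proof (induction n)
    case 0
    show ?case
    proof (intro allI impI conjI)
      fix t :: complex assume t: "norm t \<le> r"
      show "nu (G 0 t - t *s cvec v) \<le> B * (\<Sum>m<0. \<theta> ^ m) * (norm t)\<^sup>2"
        by (simp add: nu_def)
      define s where "s = t / of_real \<mu>"
      have s: "norm s \<le> r" using norm_divide_le[of t] t by (simp add: s_def)
      \<comment> \<open>As \<open>v\<close> is an eigenvector, the first increment is exactly the
        Taylor remainder at \<open>s *s cvec v\<close>.\<close>
      have "t *s cvec v = T\<^sub>C (s *s cvec v)"
        using expanding by (simp add: T\<^sub>C_v s_def)
      then have "nu (G (Suc 0) t - G 0 t) = nu (H (s *s cvec v) - T\<^sub>C (s *s cvec v))"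
        by (simp add: s_def)
      also have "\<dots> \<le> W * C * (nu (s *s cvec v))\<^sup>2"
        by (rule H_quadratic, rule nu_near_line[OF _ s]) (use B_nonneg in \<open>simp add: nu_def\<close>)
      also have "\<dots> = \<theta> ^ 0 * B * (norm t)\<^sup>2"
        unfolding nu_scale power_mult_distrib s_def sc by (simp add: B_def)
      finally show "nu (G (Suc 0) t - G 0 t) \<le> \<theta> ^ 0 * B * (norm t)\<^sup>2" .
    qed
  next
    case (Suc n)
    have first: "nu (G (Suc n) t - t *s cvec v) \<le> B * (\<Sum>m<Suc n. \<theta> ^ m) * (norm t)\<^sup>2"
      if "norm t \<le> r" for t
    proof -
      have "nu (G (Suc n) t - t *s cvec v) \<le> nu (G (Suc n) t - G n t) + nu (G n t - t *s cvec v)"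
        using nu_triangle[of "G (Suc n) t - G n t" "G n t - t *s cvec v"] by simp
      also have "\<dots> \<le> \<theta> ^ n * B * (norm t)\<^sup>2 + B * (\<Sum>m<n. \<theta> ^ m) * (norm t)\<^sup>2"
        using Suc that by (intro add_mono) auto
      also have "\<dots> = B * (\<Sum>m<Suc n. \<theta> ^ m) * (norm t)\<^sup>2" by (simp add: algebra_simps)
      finally show ?thesis .
    qed
    have dom: "nu (G k t) \<le> \<delta>" if t: "norm t \<le> r" and k: "k = n \<or> k = Suc n" for t k
    proof (rule nu_near_line[OF _ t])
      have "nu (G k t - t *s cvec v) \<le> B * (\<Sum>m<k. \<theta> ^ m) * (norm t)\<^sup>2"
        using k first[OF t] Suc t by blast
      also have "\<dots> \<le> B' * (norm t)\<^sup>2" by (intro mult_right_mono geometric_le) auto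
      finally show "nu (G k t - t *s cvec v) \<le> B' * (norm t)\<^sup>2" .
    qed
    show ?case
    proof (intro allI impI conjI)
      fix t :: complex assume t: "norm t \<le> r"
      show "nu (G (Suc n) t - t *s cvec v) \<le> B * (\<Sum>m<Suc n. \<theta> ^ m) * (norm t)\<^sup>2"
        using first t .
      define s where "s = t / of_real \<mu>"
      have s: "norm s \<le> r" using norm_divide_le[of t] t by (simp add: s_def)
      have "nu (G (Suc (Suc n)) t - G (Suc n) t) = nu (H (G (Suc n) s) - H (G n s))"
        by (simp add: s_def)
      also have "\<dots> \<le> L * nu (G (Suc n) s - G n s)"
        using dom[OF s] by (intro H_lipschitz) blast+
      also have "\<dots> \<le> L * (\<theta> ^ n * B * (norm s)\<^sup>2)"
        using Suc s L by (intro mult_left_mono) auto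
      also have "\<dots> = \<theta> ^ Suc n * B * (norm t)\<^sup>2"
        unfolding s_def sc by (simp add: \<theta>_def)
      finally show "nu (G (Suc (Suc n)) t - G (Suc n) t) \<le> \<theta> ^ Suc n * B * (norm t)\<^sup>2" .
    qed
  qed
  then show "nu (G n t - t *s cvec v) \<le> B * (\<Sum>m<n. \<theta> ^ m) * (norm t)\<^sup>2"
    "nu (G (Suc n) t - G n t) \<le> \<theta> ^ n * B * (norm t)\<^sup>2"
    using assms by blast+
qed

lemma G_near_line: "norm t \<le> r \<Longrightarrow> nu (G n t - t *s cvec v) \<le> B' * (norm t)\<^sup>2"
  using G_bounds(1)[of t n] mult_right_mono[OF geometric_le[of n], of "(norm t)\<^sup>2"] by simp

lemma G_domain: "norm t \<le> r \<Longrightarrow> nu (G n t) \<le> \<delta>"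
  using nu_near_line G_near_line by blast

lemma G_holomorphic: "(\<lambda>t. G n t $ i) holomorphic_on ball 0 r"
proof (induction n arbitrary: i)
  case 0
  show ?case by (simp add: holomorphic_intros)
next
  case (Suc n)
  have "(\<lambda>t. H (G n (t / of_real \<mu>)) $ i) holomorphic_on ball 0 r"
  proof (rule holomorphic_comp)
    show "(\<lambda>t. G n (t / of_real \<mu>) $ j) holomorphic_on ball 0 r" for j
    proof -
      have "((\<lambda>t. G n t $ j) \<circ> (\<lambda>t. t / of_real \<mu>)) holomorphic_on ball 0 r"
        by (rule holomorphic_on_compose_gen[OF _ Suc])
          (use expanding norm_divide_less in \<open>auto intro!: holomorphic_intros\<close>)
      then show ?thesis by (simp add: o_def)
    qed
    show "norm (G n (t / of_real \<mu>) $ j) \<le> e" if "t \<in> ball 0 r" for t j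
    proof -
      have "norm (G n (t / of_real \<mu>) $ j) \<le> nu (G n (t / of_real \<mu>))" by (rule component_le_nu)
      also have "\<dots> \<le> \<delta>" using norm_divide_less[of t] that by (intro G_domain) simp
      finally show ?thesis using \<delta>(2) radius_pos by simp
    qed
  qed simp
  then show ?case by simp
qed

lemma G_real: "norm t \<le> r \<Longrightarrow> t \<in> \<real> \<Longrightarrow> G n t $ i \<in> \<real>"
proof (induction n arbitrary: t i)
  case 0
  then show ?case by (auto simp: Reals_mult)
next
  case (Suc n)
  define s where "s = t / of_real \<mu>"
  have s: "norm s \<le> r" using norm_divide_le[of t] Suc.prems by (simp add: s_def)
  have "s \<in> \<real>" using Suc.prems by (simp add: s_def Reals_divide)
  define x :: "real^'n" where "x = (\<chi> i. Re (G n s $ i))"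
  have x: "G n s = cvec x"
    using Suc.IH[OF s \<open>s \<in> \<real>\<close>] by (simp add: x_def vec_eq_iff of_real_Re)
  have "\<bar>x $ j\<bar> \<le> e" for j
  proof -
    have "\<bar>x $ j\<bar> = norm (G n s $ j)" by (simp add: x)
    also have "\<dots> \<le> \<delta>" using component_le_nu G_domain[OF s] order_trans by blast
    finally show ?thesis using \<delta>(2) radius_pos by simp
  qed
  then have "H (cvec x) $ i = complex_of_real (f x $ i)" by (rule real_values)
  then show ?case by (simp add: x flip: s_def)
qed

text \<open>The limit of the iterates, written as a telescoping series because the M-test applies to
  that form.\<close>

definition h :: "'n \<Rightarrow> complex \<Rightarrow> complex" where
  "h i t = t * of_real (v $ i) + (\<Sum>m. G (Suc m) t $ i - G m t $ i)"

lemma G_uniform_limit: "uniform_limit (ball 0 r) (\<lambda>n t. G n t $ i) (h i) sequentially"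
proof -
  have "uniform_limit (ball 0 r) (\<lambda>n t. \<Sum>m<n. G (Suc m) t $ i - G m t $ i)
      (\<lambda>t. \<Sum>m. G (Suc m) t $ i - G m t $ i) sequentially"
  proof (rule Weierstrass_m_test)
    fix n t assume "t \<in> ball (0::complex) r"
    then have t: "norm t \<le> r" by simp
    have "norm (G (Suc n) t $ i - G n t $ i) \<le> nu (G (Suc n) t - G n t)"
      using component_le_nu[of "G (Suc n) t - G n t" i] by simp
    also have "\<dots> \<le> \<theta> ^ n * B * (norm t)\<^sup>2" by (rule G_bounds(2)[OF t])
    also have "\<dots> \<le> \<theta> ^ n * B * 1"
      using t r \<theta> B_nonneg by (intro mult_left_mono) (auto simp: power_le_one)
    finally show "norm (G (Suc n) t $ i - G n t $ i) \<le> B * \<theta> ^ n" by (simp add: mult_ac)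
  next
    show "summable (\<lambda>n. B * \<theta> ^ n)" using \<theta> by (intro summable_mult summable_geometric) simp
  qed
  then have "uniform_limit (ball 0 r) (\<lambda>n t. t * of_real (v $ i) + (\<Sum>m<n. G (Suc m) t $ i - G m t $ i))
      (h i) sequentially"
    unfolding h_def by (intro uniform_limit_intros)
  moreover have "t * of_real (v $ i) + (\<Sum>m<n. G (Suc m) t $ i - G m t $ i) = G n t $ i" for n t
    using sum_lessThan_telescope[of "\<lambda>m. G m t $ i" n] by (simp del: G.simps(2))
  ultimately show ?thesis by simp
qed

lemma G_tendsto: "norm t < r \<Longrightarrow> (\<lambda>n. G n t $ i) \<longlonglongrightarrow> h i t"
  using tendsto_uniform_limitI[OF G_uniform_limit, of t i] by simp

lemma h_holomorphic: "h i holomorphic_on ball 0 r"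
proof (rule holomorphic_uniform_sequence[where f = "\<lambda>n t. G n t $ i"])
  show "\<exists>d>0. cball x d \<subseteq> ball 0 r \<and> uniform_limit (cball x d) (\<lambda>n t. G n t $ i) (h i) sequentially"
    if x: "x \<in> ball 0 r" for x
  proof -
    obtain d where "d > 0" "cball x d \<subseteq> ball 0 r"
      using x open_contains_cball[of "ball (0::complex) r"] by (metis open_ball)
    then show ?thesis using uniform_limit_on_subset[OF G_uniform_limit] by blast
  qed
qed (auto intro: G_holomorphic)

lemma nu_tendsto:
  assumes "\<And>i. (\<lambda>n. z n $ i) \<longlonglongrightarrow> w $ i"
  shows "(\<lambda>n. nu (z n)) \<longlonglongrightarrow> nu w"
  unfolding nu_def by (intro tendsto_intros assms)

lemma h_near_line:
  assumes t: "norm t < r"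
  shows "nu ((\<chi> i. h i t) - t *s cvec v) \<le> B' * (norm t)\<^sup>2"
proof -
  have "(\<lambda>n. nu (G n t - t *s cvec v)) \<longlonglongrightarrow> nu ((\<chi> i. h i t) - t *s cvec v)"
    using G_tendsto[OF t] by (intro nu_tendsto) (auto intro!: tendsto_intros)
  then show ?thesis
    using G_near_line t by (intro LIMSEQ_le_const2) (auto intro: exI[of _ 0])
qed

text \<open>The recursion for \<open>G\<close> in the limit; continuity of \<open>H\<close> at the
  limit point comes from \<open>H_lipschitz\<close>. With \<open>t / \<mu>\<close> inside, both
  arguments lie in the disc where \<open>h\<close> is controlled.\<close>

lemma h_functional_equation:
  assumes t: "norm t < r"
  shows "H (\<chi> i. h i (t / of_real \<mu>)) $ j = h j t"
proof -
  define s where "s = t / of_real \<mu>"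
  have s: "norm s < r" using norm_divide_less[OF t] by (simp add: s_def)
  have dom: "nu (\<chi> i. h i s) \<le> \<delta>" using nu_near_line[OF h_near_line[OF s]] s by simp
  have "(\<lambda>n. nu (G n s - (\<chi> i. h i s))) \<longlonglongrightarrow> nu 0"
    using G_tendsto[OF s] by (intro nu_tendsto) (simp add: LIM_zero)
  from tendsto_mult_left[OF this, of L] have lim0: "(\<lambda>n. L * nu (G n s - (\<chi> i. h i s))) \<longlonglongrightarrow> 0" by (simp add: nu_def)
  have "(\<lambda>n. H (G n s) $ j - H (\<chi> i. h i s) $ j) \<longlonglongrightarrow> 0"
  proof (rule Lim_null_comparison[OF always_eventually lim0], rule allI)
    fix n
    have "norm (H (G n s) $ j - H (\<chi> i. h i s) $ j) \<le> nu (H (G n s) - H (\<chi> i. h i s))"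
      using component_le_nu[of "H (G n s) - H (\<chi> i. h i s)" j] by simp
    also have "\<dots> \<le> L * nu (G n s - (\<chi> i. h i s))"
      using s dom G_domain by (intro H_lipschitz) auto
    finally show "norm (H (G n s) $ j - H (\<chi> i. h i s) $ j) \<le> L * nu (G n s - (\<chi> i. h i s))" .
  qed
  then have "(\<lambda>n. G (Suc n) t $ j) \<longlonglongrightarrow> H (\<chi> i. h i s) $ j"
    by (simp add: LIM_zero_iff flip: s_def)
  moreover have "(\<lambda>n. G (Suc n) t $ j) \<longlonglongrightarrow> h j t"
    using G_tendsto[OF t] by (rule LIMSEQ_Suc)
  ultimately show ?thesis using LIMSEQ_unique unfolding s_def by blast
qed

lemma h_real:
  assumes "\<bar>t\<bar> < r" shows "h i (complex_of_real t) \<in> \<real>"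
proof (rule closed_sequentially[OF closed_complex_Reals])
  show "G n (complex_of_real t) $ i \<in> \<real>" for n using assms by (auto intro!: G_real)
  show "(\<lambda>n. G n (complex_of_real t) $ i) \<longlonglongrightarrow> h i (complex_of_real t)"
    using assms by (intro G_tendsto) simp
qed

end

end

section \<open>Restriction of the curve to real parameters\<close>

lemma has_vector_derivative_vecI:
  fixes f :: "real \<Rightarrow> real^'n"
  assumes "\<And>i. ((\<lambda>t. f t $ i) has_vector_derivative f' $ i) (at x within S)"
  shows "(f has_vector_derivative f') (at x within S)"
  unfolding has_vector_derivative_def
proof (subst has_derivative_componentwise_within, rule ballI)
  fix b :: "real^'n" assume "b \<in> Basis"
  then obtain i where "b = axis i 1" by (auto simp: Basis_vec_def)
  then show "((\<lambda>x. f x \<bullet> b) has_derivative (\<lambda>x. (x *\<^sub>R f') \<bullet> b)) (at x within S)"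
    using assms[of i] by (simp add: inner_axis has_vector_derivative_def)
qed

lemma has_real_derivative_quadratic:
  fixes f :: "real \<Rightarrow> real"
  assumes "r > 0" "\<And>t. \<bar>t\<bar> < r \<Longrightarrow> \<bar>f t - t * c\<bar> \<le> B * t\<^sup>2"
  shows "(f has_real_derivative c) (at 0)"
proof -
  have f0: "f 0 = 0" using assms(2)[of 0] assms(1) by simp
  have "((\<lambda>x. (f (0 + x) - f 0) / x - c) \<longlongrightarrow> 0) (at 0)"
  proof (rule Lim_null_comparison)
    show "\<forall>\<^sub>F x in at 0. norm ((f (0 + x) - f 0) / x - c) \<le> \<bar>B\<bar> * \<bar>x\<bar>"
      unfolding eventually_at
    proof (intro exI conjI ballI impI)
      fix x :: real assume x: "x \<noteq> 0 \<and> dist x 0 < r"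
      then have "\<bar>f x - x * c\<bar> \<le> B * x\<^sup>2" using assms(2) by simp
      also have "\<dots> \<le> \<bar>B\<bar> * x\<^sup>2" by (intro mult_right_mono) auto
      also have "\<dots> = \<bar>B\<bar> * \<bar>x\<bar> * \<bar>x\<bar>" by (metis power2_abs power2_eq_square mult.assoc)
      finally have "\<bar>f x - x * c\<bar> / \<bar>x\<bar> \<le> \<bar>B\<bar> * \<bar>x\<bar>" using x by (simp add: divide_simps)
      also have "\<bar>f x - x * c\<bar> / \<bar>x\<bar> = \<bar>f x / x - c\<bar>"
        using x by (simp add: abs_divide[symmetric] diff_divide_distrib)
      finally show "norm ((f (0 + x) - f 0) / x - c) \<le> \<bar>B\<bar> * \<bar>x\<bar>" by (simp add: f0)
    qed (use assms in auto)
    show "((\<lambda>x. \<bar>B\<bar> * \<bar>x\<bar>) \<longlongrightarrow> 0) (at 0)"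
      by (rule tendsto_eq_intros refl | simp)+
  qed
  then show ?thesis by (simp add: DERIV_def LIM_zero_iff)
qed

context weighted
begin

lemma smooth_curve_aux:
  assumes v: "T *v v = \<mu> *\<^sub>R v" "v $ a = 1"
  shows "\<exists>r g. r > 0 \<and> smooth_on_interval (- r) r g \<and> g 0 = 0 \<and> (g has_vector_derivative v) (at 0) \<and>
    (\<forall>t. \<bar>\<mu> * t\<bar> < r \<longrightarrow> f (g t) = g (\<mu> * t))"
proof -
  define R where "R = r v"
  have R: "R > 0" using r[OF v] by (simp add: R_def)
  define k where "k = h v"
  \<comment> \<open>The complex derivatives supply the whole sequence of real ones. Taking real
    parts loses nothing for \<open>n = 0\<close> inside the disc, where the values are real by
    \<open>h_real\<close>.\<close>
  define D where "D n t = (\<chi> i. Re ((deriv ^^ n) (k i) (complex_of_real t)))" for n t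
  have k_real: "k i (complex_of_real t) = complex_of_real (D 0 t $ i)" if "\<bar>t\<bar> < R" for i t
    using h_real[OF v, of t i] that by (simp add: R_def k_def D_def of_real_Re)
  have smooth: "(D n has_vector_derivative D (Suc n) t) (at t)" if "t \<in> {-R<..<R}" for n t
  proof (rule has_vector_derivative_vecI)
    fix i
    have "((deriv ^^ n) (k i) has_field_derivative (deriv ^^ Suc n) (k i) (complex_of_real t))
        (at (complex_of_real t))"
      using that unfolding k_def
      by (intro has_field_derivative_higher_deriv[OF h_holomorphic[OF v]]) (auto simp: R_def)
    moreover have "(complex_of_real has_vector_derivative 1) (at t)"
      using bounded_linear.has_vector_derivative[OF bounded_linear_of_real has_vector_derivative_id] by simp
    ultimately have "((\<lambda>s. (deriv ^^ n) (k i) (complex_of_real s)) has_vector_derivative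
        (deriv ^^ Suc n) (k i) (complex_of_real t)) (at t)"
      using field_vector_diff_chain_at[of complex_of_real 1 t "(deriv ^^ n) (k i)"]
      by (simp add: o_def)
    from bounded_linear.has_vector_derivative[OF bounded_linear_Re this]
    show "((\<lambda>t. D n t $ i) has_vector_derivative D (Suc n) t $ i) (at t)"
      by (simp add: D_def)
  qed
  have near: "\<bar>D 0 t $ i - t * v $ i\<bar> \<le> B' v * t\<^sup>2" if t: "\<bar>t\<bar> < R" for t i
  proof -
    have "\<bar>D 0 t $ i - t * v $ i\<bar> = norm (((\<chi> i. k i (complex_of_real t)) - complex_of_real t *s cvec v) $ i)"
      using k_real[OF t] by (simp flip: of_real_mult of_real_diff)
    also have "\<dots> \<le> nu ((\<chi> i. k i (complex_of_real t)) - complex_of_real t *s cvec v)"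
      by (rule component_le_nu)
    also have "\<dots> \<le> B' v * (norm (complex_of_real t))\<^sup>2"
      unfolding k_def using t by (intro h_near_line[OF v]) (simp add: R_def)
    finally show ?thesis by simp
  qed
  show ?thesis
  proof (intro exI conjI allI impI)
    show "R > 0" by fact
    show "smooth_on_interval (- R) R (D 0)"
      unfolding smooth_on_interval_def using smooth by (intro exI[of _ D]) auto
    have "D 0 0 $ i = 0" for i using near[of 0 i] R by simp
    then show "D 0 0 = 0" by (simp add: vec_eq_iff)
    show "(D 0 has_vector_derivative v) (at 0)"
    proof (rule has_vector_derivative_vecI)
      fix i
      show "((\<lambda>t. D 0 t $ i) has_vector_derivative v $ i) (at 0)"
        using has_real_derivative_quadratic[OF R near, of i]
        by (simp add: has_real_derivative_iff_has_vector_derivative)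
    qed
    fix t assume t: "\<bar>\<mu> * t\<bar> < R"
    have tR: "\<bar>t\<bar> < R"
      using t expanding mult_right_mono[of 1 \<mu> "\<bar>t\<bar>"] by (simp add: abs_mult)
    have c: "cvec (D 0 t) = (\<chi> i. k i (complex_of_real t))"
      using k_real[OF tR] by (simp add: vec_eq_iff)
    have dom: "\<bar>D 0 t $ i\<bar> \<le> e" for i
    proof -
      have "\<bar>D 0 t $ i\<bar> = norm (cvec (D 0 t) $ i)" by simp
      also have "\<dots> \<le> nu (cvec (D 0 t))" by (rule component_le_nu)
      also have "\<dots> \<le> \<delta>"
        unfolding c k_def using tR by (intro nu_near_line[OF v h_near_line[OF v]]) (auto simp: R_def)
      finally show ?thesis using \<delta>(2) radius_pos by simp
    qed
    have "f (D 0 t) $ j = D 0 (\<mu> * t) $ j" for j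
    proof -
      have "complex_of_real (f (D 0 t) $ j) = H (cvec (D 0 t)) $ j"
        using real_values[OF dom] by simp
      also have "\<dots> = k j (complex_of_real (\<mu> * t))"
        using h_functional_equation[OF v, of "complex_of_real (\<mu> * t)" j] t expanding
        unfolding c k_def by (simp add: R_def norm_mult abs_mult)
      also have "\<dots> = complex_of_real (D 0 (\<mu> * t) $ j)" by (rule k_real[OF t])
      finally show ?thesis by simp
    qed
    then show "f (D 0 t) = D 0 (\<mu> * t)" by (simp add: vec_eq_iff)
  qed
qed

end

context saddle
begin

lemma unstable_curve:
  obtains r g v where "r > 0" "smooth_on_interval (- r) r g" "g 0 = 0"
    "(g has_vector_derivative v) (at 0)" "v $ a = 1"
    "\<And>t. \<bar>\<mu> * t\<bar> < r \<Longrightarrow> f (g t) = g (\<mu> * t)"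
proof -
  obtain v where v: "T *v v = \<mu> *\<^sub>R v" "v $ a = 1" by (rule unstable_eigenvector)
  obtain C where C: "C \<ge> 0" "quadratic_remainder H T e C"
    using strictly_differentiable by blast
  define S where "S = (\<Sum>i\<in>UNIV - {a}. \<bar>T $ i $ a\<bar>)"
  \<comment> \<open>The weight is chosen from the size of the off-diagonal part of column
    \<open>a\<close>, so that this part counts for at most a quarter of the gap
    \<open>\<mu>\<^sup>2 - \<mu>\<close>.\<close>
  define K where "K = max 1 (4 * S / (\<mu>\<^sup>2 - \<mu>))"
  have q: "0 < \<mu>\<^sup>2 - \<mu>" using expanding by (simp add: power2_eq_square)
  have "4 * S / (\<mu>\<^sup>2 - \<mu>) * (\<mu>\<^sup>2 - \<mu>) / 4 \<le> K * (\<mu>\<^sup>2 - \<mu>) / 4"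
    using q by (intro divide_right_mono mult_right_mono) (auto simp: K_def)
  then have "S \<le> K * (\<mu>\<^sup>2 - \<mu>) / 4" using q by simp
  then interpret weighted f H e T a \<mu> \<kappa> K C
    using C by unfold_locales (auto simp: K_def S_def)
  from smooth_curve_aux[OF v] v(2) show ?thesis using that by blast
qed

end

section \<open>Local manifolds of a saddle with an invariant hyperplane\<close>

context saddle
begin

definition l1 :: "real^'n \<Rightarrow> real" where
  "l1 x = (\<Sum>i\<in>UNIV. \<bar>x $ i\<bar>)"

text \<open>Not a trace: this is the part of the \<open>l1\<close> norm that lies along the
  hyperplane.\<close>

definition tr :: "real^'n \<Rightarrow> real" where
  "tr x = (\<Sum>i\<in>UNIV - {a}. \<bar>x $ i\<bar>)"

lemma l1_eq: "l1 x = \<bar>x $ a\<bar> + tr x"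
  unfolding l1_def tr_def by (rule sum.remove) auto

lemma tr_nonneg: "0 \<le> tr x"
  by (simp add: tr_def sum_nonneg)

lemma tr_triangle: "tr (x + y) \<le> tr x + tr y"
  unfolding tr_def sum.distrib[symmetric] by (intro sum_mono) simp

lemma component_le_tr: "i \<noteq> a \<Longrightarrow> \<bar>x $ i\<bar> \<le> tr x"
  unfolding tr_def by (rule member_le_sum) auto

lemma norm_le_l1: "norm x \<le> l1 x"
  unfolding l1_def by (rule norm_le_l1_cart)

lemma sum_off_le: "0 \<le> c \<Longrightarrow> (\<Sum>i\<in>UNIV - {a}. c) \<le> real CARD('n) * c"
  using sum_mono2[of UNIV "UNIV - {a}" "\<lambda>i::'n. c"] by simp

text \<open>The modulus \<open>C * d\<close> of the remainder drops below any given
  \<open>\<eta>\<close> when the polydisc shrinks; the estimate is then read at real points.\<close>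

lemma real_remainder:
  assumes "\<eta> > 0"
  obtains d where "0 < d" "d \<le> e"
    "\<And>x y j. (\<And>i. \<bar>x $ i\<bar> \<le> d) \<Longrightarrow> (\<And>i. \<bar>y $ i\<bar> \<le> d) \<Longrightarrow>
       \<bar>f x $ j - f y $ j - (\<Sum>i\<in>UNIV. T $ j $ i * (x $ i - y $ i))\<bar> \<le> \<eta> * l1 (x - y)"
proof -
  obtain C where C: "C \<ge> 0" "quadratic_remainder H T e C"
    using strictly_differentiable by blast
  define d where "d = min (e / 2) (\<eta> / (1 + C))"
  have d: "0 < d" using assms C(1) radius_pos by (simp add: d_def)
  have d2: "d \<le> e / 2" unfolding d_def by (rule min.cobounded1)
  have "C * d \<le> C * (\<eta> / (1 + C))"
    using C(1) by (intro mult_left_mono) (auto simp: d_def)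
  also have "\<dots> \<le> \<eta>" using C(1) assms by (simp add: field_simps)
  finally have Cd: "C * d \<le> \<eta>" .
  have "\<bar>f x $ j - f y $ j - (\<Sum>i\<in>UNIV. T $ j $ i * (x $ i - y $ i))\<bar> \<le> \<eta> * l1 (x - y)"
    if x: "\<And>i. \<bar>x $ i\<bar> \<le> d" and y: "\<And>i. \<bar>y $ i\<bar> \<le> d" for x y j
  proof -
    have de: "d \<le> e" using d2 radius_pos by simp
    have *: "H (cvec x) $ j = complex_of_real (f x $ j)" "H (cvec y) $ j = complex_of_real (f y $ j)"
      using x y de by (auto intro!: real_values intro: order_trans)
    have "norm (H (cvec x) $ j - H (cvec y) $ j
        - (\<Sum>i\<in>UNIV. complex_of_real (T $ j $ i) * (cvec x $ i - cvec y $ i)))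
        \<le> C * d * (\<Sum>i\<in>UNIV. norm (cvec x $ i - cvec y $ i))"
      using quadratic_remainderD[OF C(2) d d2, of "cvec x" "cvec y" j] x y by simp
    also have "(\<Sum>i\<in>UNIV. norm (cvec x $ i - cvec y $ i)) = l1 (x - y)"
      by (simp add: l1_def flip: of_real_diff)
    also have "C * d * l1 (x - y) \<le> \<eta> * l1 (x - y)"
      using Cd by (intro mult_right_mono) (simp_all add: l1_def sum_nonneg)
    finally show ?thesis
      unfolding * by (simp flip: of_real_diff of_real_mult of_real_sum)
  qed
  then show ?thesis using d d2 radius_pos by (intro that[of d]) auto
qed

end

text \<open>The nonlinear counterpart of the row condition: the hyperplane is mapped into itself not
  only by \<open>T\<close> but, near 0, by \<open>f\<close>.\<close>

locale invariant_saddle = saddle f H e T a \<mu> \<kappa>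
  for f :: "real^'n \<Rightarrow> real^'n" and H e T a \<mu> \<kappa> +
  fixes e1 :: real
  assumes e1: "e1 > 0" and invariant: "x $ a = 0 \<Longrightarrow> norm x < e1 \<Longrightarrow> f x $ a = 0"
begin

lemma f_0: "f 0 = 0"
proof -
  have "complex_of_real (f 0 $ i) = 0" for i
    using real_values[of 0 i] radius_pos zero by (simp add: cvec_def zero_vec_def[symmetric])
  then show ?thesis by (simp add: vec_eq_iff)
qed

text \<open>A point is compared with the curve point having the same \<open>a\<close>-coordinate:
  \<open>T\<close> contracts such a difference and creates no discrepancy in direction
  \<open>a\<close>. The neighbourhood is a box whose two \<open>a\<close>-faces pass through the
  ends of the curve, so every point of it has such a partner.\<close>

lemma local_manifolds:
  assumes M: "open M" "0 \<in> M"
  obtains N where "open N" "0 \<in> N" "N \<subseteq> M"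
    "smooth_curve (local_unstable_manifold f N 0)"
    "local_stable_manifold f N 0 = {x \<in> N. x $ a = 0}"
proof -
  obtain R g v where R: "R > 0" and smooth: "smooth_on_interval (- R) R g" and g0: "g 0 = 0"
    and gv: "(g has_vector_derivative v) (at 0)" "v $ a = 1"
    and fg: "\<And>t. \<bar>\<mu> * t\<bar> < R \<Longrightarrow> f (g t) = g (\<mu> * t)"
    by (rule unstable_curve) blast
  obtain D where D0: "D 0 = g" and D: "\<And>n t. t \<in> {-R<..<R} \<Longrightarrow> (D n has_vector_derivative D (Suc n) t) (at t)"
    using smooth unfolding smooth_on_interval_def by blast
  have D1: "D 1 0 = v"
    using D[of 0 0] R D0 gv(1) vector_derivative_unique_at by fastforce

  \<comment> \<open>As \<open>v $ a = 1\<close>, for small \<open>t\<close> the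
    \<open>a\<close>-component of the velocity lies between 1/2 and 2 while the others are bounded
    by \<open>V\<close>: the curve is a Lipschitz graph over the \<open>a\<close>-axis.\<close>
  define V where "V = tr v + 1"
  have V: "V > 0" using tr_nonneg[of v] by (simp add: V_def)
  have "isCont (D 1) 0" using D[of 0 1] R by (intro has_vector_derivative_continuous) auto
  then have lim: "((\<lambda>t. D 1 t) \<longlongrightarrow> v) (at 0)" using D1 by (simp add: isCont_def)
  have "((\<lambda>t. tr (D 1 t)) \<longlongrightarrow> tr v) (at 0)" unfolding tr_def by (intro tendsto_intros lim)
  moreover have "((\<lambda>t. D 1 t $ a) \<longlongrightarrow> 1) (at 0)" using tendsto_vec_nth[OF lim, of a] gv(2) by simp
  ultimately have "\<forall>\<^sub>F t in at 0. tr (D 1 t) < V \<and> D 1 t $ a > 1 / 2 \<and> D 1 t $ a < 2"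
    by (intro eventually_conj order_tendstoD) (auto simp: V_def)
  then obtain r1' where r1': "r1' > 0" "\<And>t. t \<noteq> 0 \<Longrightarrow> \<bar>t\<bar> < r1' \<Longrightarrow> tr (D 1 t) < V \<and> D 1 t $ a > 1 / 2 \<and> D 1 t $ a < 2"
    unfolding eventually_at by (auto simp: dist_real_def)
  define r1 where "r1 = min r1' R"
  have r1: "r1 > 0" "r1 \<le> R" using r1' R by (auto simp: r1_def)
  have D1_bounds: "tr (D 1 t) < V" "D 1 t $ a > 1 / 2" "D 1 t $ a < 2" if "\<bar>t\<bar> < r1" for t
    using r1'(2)[of t] that gv(2) D1 by (cases "t = 0"; auto simp: r1_def V_def)+
  have g_deriv: "(g has_vector_derivative D 1 t) (at t)" if "\<bar>t\<bar> < R" for t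
    using D[of t 0] D0 that by (simp add: abs_less_iff)
  have g_deriv_i: "((\<lambda>t. g t $ i) has_real_derivative D 1 t $ i) (at t)" if "\<bar>t\<bar> < R" for t i
    using bounded_linear.has_vector_derivative[OF bounded_linear_vec_nth g_deriv[OF that], of i]
    by (simp add: has_real_derivative_iff_has_vector_derivative)
  have mvt: "\<exists>z. \<bar>z\<bar> < r1 \<and> g s $ i - g t $ i = (s - t) * D 1 z $ i" if t: "t < s" "\<bar>t\<bar> < r1" "\<bar>s\<bar> < r1" for s t i
  proof -
    obtain z where "z > t" "z < s" "g s $ i - g t $ i = (s - t) * D 1 z $ i"
    proof -
      have "\<exists>z>t. z < s \<and> g s $ i - g t $ i = (s - t) * D 1 z $ i"
        using t r1 by (intro MVT2 g_deriv_i) auto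
      then show ?thesis using that by blast
    qed
    then show ?thesis using t by (intro exI[of _ z]) auto
  qed
  have ga_lt: "(s - t) / 2 < g s $ a - g t $ a" "g s $ a - g t $ a < 2 * (s - t)"
    if t: "t < s" "\<bar>t\<bar> < r1" "\<bar>s\<bar> < r1" for s t
  proof -
    obtain z where z: "\<bar>z\<bar> < r1" "g s $ a - g t $ a = (s - t) * D 1 z $ a" using mvt[OF t] by blast
    have "(s - t) * (1 / 2) < (s - t) * D 1 z $ a"
      using D1_bounds(2)[OF z(1)] t by (intro mult_strict_left_mono) auto
    then show "(s - t) / 2 < g s $ a - g t $ a" using z by simp
    have "(s - t) * D 1 z $ a < (s - t) * 2"
      using D1_bounds(3)[OF z(1)] t by (intro mult_strict_left_mono) auto
    then show "g s $ a - g t $ a < 2 * (s - t)" using z by simp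
  qed
  have ga: "\<bar>s - t\<bar> \<le> 2 * \<bar>g s $ a - g t $ a\<bar>" "\<bar>g s $ a - g t $ a\<bar> \<le> 2 * \<bar>s - t\<bar>"
    if "\<bar>t\<bar> < r1" "\<bar>s\<bar> < r1" for s t
    using ga_lt[of t s] ga_lt[of s t] that by (cases t s rule: linorder_cases; auto)+
  \<comment> \<open>The mean value theorem is applied to each coordinate with its own intermediate
    point; summing the coordinates costs their number.\<close>
  define V' where "V' = real CARD('n) * V"
  have V': "V' > 0" using V by (simp add: V'_def)
  have gtr: "tr (g s - g t) \<le> V' * \<bar>s - t\<bar>" if st: "\<bar>t\<bar> < r1" "\<bar>s\<bar> < r1" for s t
  proof -
    have one: "\<bar>g s $ i - g t $ i\<bar> \<le> V * \<bar>s - t\<bar>" if i: "i \<noteq> a" and st: "t < s" "\<bar>t\<bar> < r1" "\<bar>s\<bar> < r1" for i s t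
    proof -
      obtain z where z: "\<bar>z\<bar> < r1" "g s $ i - g t $ i = (s - t) * D 1 z $ i" using mvt[OF st] by blast
      have "\<bar>D 1 z $ i\<bar> \<le> V" using component_le_tr[OF i, of "D 1 z"] D1_bounds(1)[OF z(1)] by simp
      from mult_right_mono[OF this, of "\<bar>s - t\<bar>"] z show ?thesis by (simp add: abs_mult mult_ac)
    qed
    have "\<bar>(g s - g t) $ i\<bar> \<le> V * \<bar>s - t\<bar>" if "i \<noteq> a" for i
      using one[OF that, of t s] one[OF that, of s t] st
      by (cases t s rule: linorder_cases) (auto simp: abs_minus_commute)
    then have "tr (g s - g t) \<le> (\<Sum>i\<in>UNIV - {a}. V * \<bar>s - t\<bar>)"
      unfolding tr_def by (intro sum_mono) auto
    also have "\<dots> \<le> V' * \<bar>s - t\<bar>"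
      using sum_off_le[of "V * \<bar>s - t\<bar>"] V by (simp add: V'_def mult_ac)
    finally show ?thesis .
  qed

  define n where "n = real CARD('n)"
  have n: "n \<ge> 1" by (simp add: n_def Suc_le_eq)
  \<comment> \<open>The first bound keeps the expansion rate \<open>\<mu> - \<eta>\<close> above 1,
    the second keeps the contraction rate \<open>k\<close> below 1.\<close>
  define \<eta> where "\<eta> = min ((\<mu> - 1) / 2) ((1 - \<kappa>) / (2 * (n + 2 * V')))"
  have \<eta>: "\<eta> > 0" "\<eta> < \<mu> - 1"
    using expanding contracting n V' unfolding \<eta>_def by (auto simp: min_less_iff_disj)
  \<comment> \<open>\<open>\<kappa> + n * \<eta>\<close> is the contraction of \<open>f\<close>
    between points of equal \<open>a\<close>-coordinate; \<open>2 * V' * \<eta>\<close> is the price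
    of sliding along the curve to make the \<open>a\<close>-coordinates equal again.\<close>
  define k where "k = \<kappa> + n * \<eta> + 2 * V' * \<eta>"
  have k: "k < 1"
  proof -
    have "\<eta> * (n + 2 * V') \<le> (1 - \<kappa>) / (2 * (n + 2 * V')) * (n + 2 * V')"
      using n V' by (intro mult_right_mono) (auto simp: \<eta>_def)
    also have "\<dots> = (1 - \<kappa>) / 2" using n V' by (simp add: field_simps)
    finally show ?thesis using contracting by (simp add: k_def algebra_simps)
  qed
  obtain d where d: "0 < d" "d \<le> e" and rem:
    "\<And>x y j. (\<And>i. \<bar>x $ i\<bar> \<le> d) \<Longrightarrow> (\<And>i. \<bar>y $ i\<bar> \<le> d) \<Longrightarrow>
       \<bar>f x $ j - f y $ j - (\<Sum>i\<in>UNIV. T $ j $ i * (x $ i - y $ i))\<bar> \<le> \<eta> * l1 (x - y)"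
    using real_remainder[OF \<eta>(1)] by blast
  have fa: "\<bar>f x $ a - f y $ a\<bar> \<le> \<eta> * tr (x - y)" and ftr: "tr (f x - f y) \<le> (\<kappa> + n * \<eta>) * tr (x - y)"
    if x: "\<And>i. \<bar>x $ i\<bar> \<le> d" and y: "\<And>i. \<bar>y $ i\<bar> \<le> d" and xy: "x $ a = y $ a" for x y
  proof -
    have l: "l1 (x - y) = tr (x - y)" using xy by (simp add: l1_eq)
    have "(\<Sum>i\<in>UNIV. T $ a $ i * (x $ i - y $ i)) = 0"
      using xy by (intro sum.neutral) (auto simp: row)
    then show "\<bar>f x $ a - f y $ a\<bar> \<le> \<eta> * tr (x - y)" using rem[OF x y, of a] l by simp
    have "tr (f x - f y) \<le> (\<Sum>j\<in>UNIV - {a}. \<eta> * tr (x - y) + (\<Sum>i\<in>UNIV. \<bar>T $ j $ i\<bar> * \<bar>x $ i - y $ i\<bar>))"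
      unfolding tr_def[of "f x - f y"]
    proof (rule sum_mono)
      fix j
      have "\<bar>f x $ j - f y $ j\<bar> \<le> \<eta> * tr (x - y) + \<bar>\<Sum>i\<in>UNIV. T $ j $ i * (x $ i - y $ i)\<bar>"
        using rem[OF x y, of j] unfolding l by linarith
      also have "\<bar>\<Sum>i\<in>UNIV. T $ j $ i * (x $ i - y $ i)\<bar> \<le> (\<Sum>i\<in>UNIV. \<bar>T $ j $ i\<bar> * \<bar>x $ i - y $ i\<bar>)"
        by (rule order_trans[OF sum_abs]) (simp add: abs_mult)
      finally show "\<bar>(f x - f y) $ j\<bar> \<le> \<eta> * tr (x - y) + (\<Sum>i\<in>UNIV. \<bar>T $ j $ i\<bar> * \<bar>x $ i - y $ i\<bar>)"
        by simp
    qed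
    also have "\<dots> = (\<Sum>j\<in>UNIV - {a}. \<eta> * tr (x - y)) + (\<Sum>i\<in>UNIV. (\<Sum>j\<in>UNIV - {a}. \<bar>T $ j $ i\<bar>) * \<bar>x $ i - y $ i\<bar>)"
      by (simp add: sum.distrib sum_distrib_right sum.swap[of _ "UNIV - {a}"])
    also have "\<dots> \<le> n * \<eta> * tr (x - y) + (\<Sum>i\<in>UNIV - {a}. \<kappa> * \<bar>x $ i - y $ i\<bar>)"
    proof (rule add_mono)
      show "(\<Sum>j\<in>UNIV - {a}. \<eta> * tr (x - y)) \<le> n * \<eta> * tr (x - y)"
        using \<eta> tr_nonneg[of "x - y"] sum_off_le[of "\<eta> * tr (x - y)"]
        by (simp add: n_def mult.assoc)
      have "(\<Sum>i\<in>UNIV. (\<Sum>j\<in>UNIV - {a}. \<bar>T $ j $ i\<bar>) * \<bar>x $ i - y $ i\<bar>)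
          = (\<Sum>i\<in>UNIV - {a}. (\<Sum>j\<in>UNIV - {a}. \<bar>T $ j $ i\<bar>) * \<bar>x $ i - y $ i\<bar>)"
        using xy by (subst sum.remove[of _ a]) auto
      also have "\<dots> \<le> (\<Sum>i\<in>UNIV - {a}. \<kappa> * \<bar>x $ i - y $ i\<bar>)"
      proof (intro sum_mono mult_right_mono)
        fix i assume "i \<in> UNIV - {a}"
        then have "(\<Sum>j\<in>UNIV. \<bar>T $ j $ i\<bar>) \<le> \<kappa>" by (intro columns) auto
        moreover have "(\<Sum>j\<in>UNIV - {a}. \<bar>T $ j $ i\<bar>) \<le> (\<Sum>j\<in>UNIV. \<bar>T $ j $ i\<bar>)"
          by (intro sum_mono2) auto
        ultimately show "(\<Sum>j\<in>UNIV - {a}. \<bar>T $ j $ i\<bar>) \<le> \<kappa>" by simp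
      qed auto
      finally show "(\<Sum>i\<in>UNIV. (\<Sum>j\<in>UNIV - {a}. \<bar>T $ j $ i\<bar>) * \<bar>x $ i - y $ i\<bar>)
          \<le> (\<Sum>i\<in>UNIV - {a}. \<kappa> * \<bar>x $ i - y $ i\<bar>)" .
    qed
    also have "\<dots> = (\<kappa> + n * \<eta>) * tr (x - y)"
      by (simp add: tr_def sum_distrib_left distrib_right sum.distrib)
    finally show "tr (f x - f y) \<le> (\<kappa> + n * \<eta>) * tr (x - y)" .
  qed

  obtain m where m: "m > 0" "ball 0 m \<subseteq> M" using M openE by blast
  define \<delta> where "\<delta> = min d (min e1 m) / 4"
  have \<delta>: "\<delta> > 0" "\<delta> \<le> d / 4" "\<delta> \<le> e1 / 4" "\<delta> \<le> m / 4"
    using d e1 m by (auto simp: \<delta>_def)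
  \<comment> \<open>\<open>\<mu> * \<rho> < r1\<close> keeps \<open>g (\<mu> * s)\<close> in the
    range where the curve is a graph; \<open>V' * \<rho> < \<delta>\<close> and
    \<open>2 * \<rho> < \<delta>\<close> keep the curve inside the box and the box small.\<close>
  define \<rho> where "\<rho> = min (r1 / \<mu>) (\<delta> / (V' + 2)) / 2"
  have \<rho>: "\<rho> > 0" "\<mu> * \<rho> < r1" "V' * \<rho> < \<delta>" "2 * \<rho> < \<delta>"
  proof -
    show "\<rho> > 0" using r1 expanding \<delta> V' by (simp add: \<rho>_def)
    have "\<mu> * \<rho> \<le> \<mu> * (r1 / \<mu> / 2)" using expanding by (intro mult_left_mono) (auto simp: \<rho>_def)
    then show "\<mu> * \<rho> < r1" using expanding r1 by simp
    have "2 * \<rho> \<le> \<delta> / (V' + 2)" by (simp add: \<rho>_def)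
    then have "2 * \<rho> * (V' + 2) \<le> \<delta>" using V' by (simp add: pos_le_divide_eq)
    then have "2 * (V' * \<rho>) + 4 * \<rho> \<le> \<delta>" by (simp add: algebra_simps)
    moreover have "V' * \<rho> > 0" using V' \<open>\<rho> > 0\<close> by simp
    ultimately show "V' * \<rho> < \<delta>" "2 * \<rho> < \<delta>" using \<open>\<rho> > 0\<close> by linarith+
  qed
  have "1 * \<rho> \<le> \<mu> * \<rho>" using \<rho> expanding by (intro mult_right_mono) auto
  then have \<rho>r: "\<rho> < r1" using \<rho>(2) by linarith
  define N where "N = {x. g (-\<rho>) $ a < x $ a \<and> x $ a < g \<rho> $ a \<and> tr x < \<delta>}"
  have "open N"
    unfolding N_def tr_def
    by (intro open_Collect_conj open_Collect_less continuous_intros)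
  have N_a: "\<bar>x $ a\<bar> < \<delta>" if "x \<in> N" for x
    using that ga_lt[of 0 \<rho>] ga_lt[of "-\<rho>" 0] \<rho> \<rho>r g0 by (auto simp: N_def)
  have N_d: "\<bar>x $ i\<bar> \<le> d" if "x \<in> N" for x i
    using N_a[OF that] component_le_tr[of i x] that \<delta> by (cases "i = a") (auto simp: N_def)
  have N_norm: "norm x < 2 * \<delta>" if "x \<in> N" for x
    using N_a[OF that] norm_le_l1[of x] that by (auto simp: N_def l1_eq)
  have gN: "g t \<in> N" if "\<bar>t\<bar> < \<rho>" for t
  proof -
    have "V' * \<bar>t\<bar> \<le> V' * \<rho>" using that V' by (intro mult_left_mono) auto
    moreover have "tr (g t) \<le> V' * \<bar>t\<bar>" using gtr[of 0 t] that \<rho>r \<rho> g0 by simp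
    moreover have "- \<rho> < t" "t < \<rho>" using that by (simp_all add: abs_less_iff)
    ultimately show ?thesis
      using ga_lt[of "-\<rho>" t] ga_lt[of t \<rho>] that \<rho>r \<rho> by (auto simp: N_def)
  qed
  have "0 \<in> N" using gN[of 0] \<rho> g0 by simp
  have "N \<subseteq> M" using N_norm m \<delta> by fastforce

  have stable: "local_stable_manifold f N 0 = {x \<in> N. x $ a = 0}"
  proof (intro set_eqI iffI)
    fix x assume "x \<in> {x \<in> N. x $ a = 0}"
    then have x: "x \<in> N" "x $ a = 0" by auto
    \<comment> \<open>\<open>\<kappa>\<close> is bounded only from above, and powers of the rate are
      compared below; hence the maximum with 0.\<close>
    define q where "q = max 0 (\<kappa> + n * \<eta>)"
    have "2 * V' * \<eta> > 0" using V' \<eta> by simp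
    then have q: "0 \<le> q" "q < 1" using k by (auto simp: q_def k_def)
    have step: "(f ^^ j) x \<in> N \<and> ((f ^^ j) x) $ a = 0 \<and> tr ((f ^^ j) x) \<le> q ^ j * \<delta>" for j
    proof (induction j)
      case 0
      then show ?case using x by (simp add: N_def)
    next
      case (Suc j)
      define y where "y = (f ^^ j) x"
      have y: "y \<in> N" "y $ a = 0" "tr y \<le> q ^ j * \<delta>" using Suc by (auto simp: y_def)
      have "f y $ a = 0" using y N_norm[of y] \<delta> by (intro invariant) auto
      have "tr (f y - f 0) \<le> (\<kappa> + n * \<eta>) * tr (y - 0)"
        using y d N_d[OF y(1)] by (intro ftr) auto
      also have "\<dots> \<le> q * tr y"
        using tr_nonneg by (simp add: q_def mult_right_mono)
      finally have 1: "tr (f y) \<le> q * tr y" by (simp add: f_0)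
      also have "\<dots> \<le> q * (q ^ j * \<delta>)" using y q by (intro mult_left_mono) auto
      finally have 2: "tr (f y) \<le> q ^ Suc j * \<delta>" by simp
      have "tr (f y) \<le> tr y" using 1 q tr_nonneg[of y] mult_right_mono[of q 1 "tr y"] by simp
      then have "f y \<in> N" using y(1) \<open>f y $ a = 0\<close> y(2) by (auto simp: N_def)
      then show ?case using 2 \<open>f y $ a = 0\<close> by (simp add: y_def)
    qed
    have "(\<lambda>j. q ^ j * \<delta>) \<longlonglongrightarrow> 0 * \<delta>"
      using q by (intro tendsto_intros LIMSEQ_realpow_zero) auto
    then have lim0: "(\<lambda>j. q ^ j * \<delta>) \<longlonglongrightarrow> 0" by simp
    have "(\<lambda>j. (f ^^ j) x) \<longlonglongrightarrow> 0"
    proof (rule Lim_null_comparison[OF always_eventually lim0], rule allI)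
      fix j
      show "norm ((f ^^ j) x) \<le> q ^ j * \<delta>"
        using step[of j] norm_le_l1[of "(f ^^ j) x"] by (simp add: l1_eq)
    qed
    then show "x \<in> local_stable_manifold f N 0"
      using step by (auto simp: local_stable_manifold_def)
  next
    fix x assume "x \<in> local_stable_manifold f N 0"
    then have orbit: "(f ^^ j) x \<in> N" for j by (auto simp: local_stable_manifold_def)
    have grow: "(\<mu> - \<eta>) * \<bar>y $ a\<bar> \<le> \<bar>f y $ a\<bar>" if y: "y \<in> N" for y
    proof -
      \<comment> \<open>The projection of \<open>y\<close> to the invariant hyperplane. The image of
        \<open>y0\<close> has no \<open>a\<close>-component and \<open>y - y0\<close> lies along the
        axis, so the remainder is controlled by \<open>\<bar>y $ a\<bar>\<close> alone.\<close>
      define y0 where "y0 = (\<chi> i. if i = a then 0 else y $ i)"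
      have y0: "\<bar>y0 $ i\<bar> \<le> d" for i using N_d[OF y, of i] d by (simp add: y0_def)
      have "tr y0 = tr y" unfolding tr_def by (intro sum.cong) (auto simp: y0_def)
      then have "norm y0 < e1"
        using norm_le_l1[of y0] y \<delta> by (auto simp: l1_eq y0_def N_def)
      then have "f y0 $ a = 0" by (intro invariant) (auto simp: y0_def)
      moreover have "(\<Sum>i\<in>UNIV. T $ a $ i * (y $ i - y0 $ i)) = \<mu> * y $ a"
        by (subst sum.remove[of _ a]) (auto simp: row y0_def)
      moreover have "l1 (y - y0) = \<bar>y $ a\<bar>"
        by (auto simp: l1_eq y0_def tr_def intro!: sum.neutral)
      ultimately have "\<bar>f y $ a - \<mu> * y $ a\<bar> \<le> \<eta> * \<bar>y $ a\<bar>"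
        using rem[OF N_d[OF y] y0, of a] by simp
      moreover have "\<bar>\<mu> * y $ a\<bar> = \<mu> * \<bar>y $ a\<bar>" using expanding by (simp add: abs_mult)
      ultimately show ?thesis by (simp add: algebra_simps)
    qed
    have "(\<mu> - \<eta>) ^ j * \<bar>x $ a\<bar> \<le> \<bar>((f ^^ j) x) $ a\<bar>" for j
    proof (induction j)
      case (Suc j)
      have "(\<mu> - \<eta>) ^ Suc j * \<bar>x $ a\<bar> \<le> (\<mu> - \<eta>) * \<bar>((f ^^ j) x) $ a\<bar>"
        using mult_left_mono[OF Suc, of "\<mu> - \<eta>"] \<eta> by (simp add: mult_ac)
      also have "\<dots> \<le> \<bar>((f ^^ Suc j) x) $ a\<bar>" using grow[OF orbit[of j]] by simp
      finally show ?case .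
    qed simp
    then have bd: "(\<mu> - \<eta>) ^ j * \<bar>x $ a\<bar> < \<delta>" for j
      using N_a[OF orbit[of j]] order_le_less_trans by blast
    have "x $ a = 0"
    proof (rule ccontr)
      assume "x $ a \<noteq> 0"
      obtain j where "\<delta> / \<bar>x $ a\<bar> < (\<mu> - \<eta>) ^ j"
        using real_arch_pow[of "\<mu> - \<eta>"] \<eta> by auto
      then have "\<delta> < (\<mu> - \<eta>) ^ j * \<bar>x $ a\<bar>" using \<open>x $ a \<noteq> 0\<close> by (simp add: divide_simps)
      with bd[of j] show False by simp
    qed
    then show "x \<in> {x \<in> N. x $ a = 0}" using orbit[of 0] by simp
  qed

  have g_cont: "continuous_on {-\<rho>..\<rho>} (\<lambda>t. g t $ a)"
    using \<rho>r r1 by (intro continuous_at_imp_continuous_on ballI DERIV_isCont[OF g_deriv_i]) auto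
  have unstable: "local_unstable_manifold f N 0 = g ` {-\<rho><..<\<rho>}"
  proof (intro set_eqI iffI)
    fix x assume "x \<in> local_unstable_manifold f N 0"
    then obtain y where y: "y 0 = x" "\<And>j. y j \<in> N" "\<And>j. f (y (Suc j)) = y j"
      by (auto simp: local_unstable_manifold_def)
    have "\<exists>t. \<bar>t\<bar> < \<rho> \<and> g t $ a = y j $ a" for j
    proof -
      have b: "g (-\<rho>) $ a < y j $ a" "y j $ a < g \<rho> $ a" using y(2)[of j] by (auto simp: N_def)
      obtain t where "-\<rho> \<le> t" "t \<le> \<rho>" "g t $ a = y j $ a"
        using IVT'[of "\<lambda>t. g t $ a" "-\<rho>" "y j $ a" \<rho>] b \<rho> g_cont by auto
      moreover have "t \<noteq> -\<rho>" "t \<noteq> \<rho>" using b calculation by auto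
      ultimately show ?thesis by (intro exI[of _ t]) auto
    qed
    then obtain t where t: "\<And>j. \<bar>t j\<bar> < \<rho>" "\<And>j. g (t j) $ a = y j $ a" by metis
    define D' where "D' j = tr (y j - g (t j))" for j
    \<comment> \<open>\<open>f (g s) = g (\<mu> * s)\<close> is on the curve, but its
      \<open>a\<close>-coordinate may miss that of \<open>y j\<close> by
      \<open>\<eta> * D' (Suc j)\<close>. Moving along the curve to \<open>g (t j)\<close> turns
      this into at most \<open>2 * V' * \<eta> * D' (Suc j)\<close>.\<close>
    have dec: "D' j \<le> k * D' (Suc j)" for j
    proof -
      define s where "s = t (Suc j)"
      have s: "\<bar>s\<bar> < \<rho>" using t by (simp add: s_def)
      have "\<mu> * \<bar>s\<bar> \<le> \<mu> * \<rho>" using s expanding by (intro mult_left_mono) auto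
      moreover have "\<bar>\<mu> * s\<bar> = \<mu> * \<bar>s\<bar>" using expanding by (simp add: abs_mult)
      ultimately have ms: "\<bar>\<mu> * s\<bar> < r1" using \<rho>(2) by linarith
      then have fs: "f (g s) = g (\<mu> * s)" using r1 by (intro fg) auto
      have close: "tr (f (y (Suc j)) - f (g s)) \<le> (\<kappa> + n * \<eta>) * tr (y (Suc j) - g s)"
        "\<bar>f (y (Suc j)) $ a - f (g s) $ a\<bar> \<le> \<eta> * tr (y (Suc j) - g s)"
        by (rule ftr fa; use N_d y(2) gN s t(2) in \<open>auto simp: s_def\<close>)+
      have tj: "\<bar>t j\<bar> < r1" using t(1)[of j] \<rho>r by simp
      have "tr (g (\<mu> * s) - g (t j)) \<le> V' * \<bar>\<mu> * s - t j\<bar>" by (rule gtr[OF tj ms])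
      also have "\<dots> \<le> V' * (2 * \<bar>g (\<mu> * s) $ a - g (t j) $ a\<bar>)"
        using V' by (intro mult_left_mono ga(1) tj ms) auto
      also have "\<bar>g (\<mu> * s) $ a - g (t j) $ a\<bar> = \<bar>f (y (Suc j)) $ a - f (g s) $ a\<bar>"
        using y(3)[of j] t(2)[of j] by (simp add: fs abs_minus_commute)
      also have "V' * (2 * \<dots>) \<le> V' * (2 * (\<eta> * tr (y (Suc j) - g s)))"
        using V' close(2) by (intro mult_left_mono) auto
      finally have 2: "tr (g (\<mu> * s) - g (t j)) \<le> 2 * V' * \<eta> * tr (y (Suc j) - g s)" by simp
      have "D' j \<le> tr (f (y (Suc j)) - f (g s)) + tr (g (\<mu> * s) - g (t j))"
        using tr_triangle[of "f (y (Suc j)) - f (g s)" "g (\<mu> * s) - g (t j)"] y(3)[of j]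
        by (simp add: D'_def fs)
      also have "\<dots> \<le> (\<kappa> + n * \<eta>) * tr (y (Suc j) - g s) + 2 * V' * \<eta> * tr (y (Suc j) - g s)"
        using close(1) 2 by (rule add_mono)
      also have "\<dots> = k * D' (Suc j)" by (simp add: k_def D'_def s_def algebra_simps)
      finally show ?thesis .
    qed
    have D'0: "0 \<le> D' j" "D' j \<le> 2 * \<delta>" for j
    proof -
      have "tr (- g (t j)) = tr (g (t j))" by (simp add: tr_def)
      then show "0 \<le> D' j" "D' j \<le> 2 * \<delta>"
        using tr_triangle[of "y j" "- g (t j)"] y(2)[of j] gN[OF t(1)[of j]]
        by (auto simp: D'_def N_def tr_nonneg)
    qed
    define k' where "k' = max 0 k"
    have k': "0 \<le> k'" "k' < 1" using k by (auto simp: k'_def)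
    \<comment> \<open>The distance stays bounded along the whole backward orbit, so this inequality
      forces \<open>D' 0\<close> to vanish as \<open>j\<close> grows.\<close>
    have "D' 0 \<le> k' ^ j * D' j" for j
    proof (induction j)
      case (Suc j)
      have "D' j \<le> k' * D' (Suc j)"
        using dec[of j] D'0(1)[of "Suc j"] mult_right_mono[of k k' "D' (Suc j)"] by (simp add: k'_def)
      then have "k' ^ j * D' j \<le> k' ^ j * (k' * D' (Suc j))" using k' by (intro mult_left_mono) auto
      with Suc show ?case by (simp add: mult_ac)
    qed simp
    then have le: "D' 0 \<le> k' ^ j * (2 * \<delta>)" for j
      using D'0(2)[of j] k' mult_left_mono[of "D' j" "2 * \<delta>" "k' ^ j"] order_trans by fastforce
    have "(\<lambda>j. k' ^ j * (2 * \<delta>)) \<longlonglongrightarrow> 0 * (2 * \<delta>)"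
      using k' by (intro tendsto_intros LIMSEQ_realpow_zero) auto
    then have "D' 0 \<le> 0" using le by (intro LIMSEQ_le_const[of _ 0]) auto
    then have "(y 0 - g (t 0)) $ i = 0" for i
      using component_le_tr[of i "y 0 - g (t 0)"] t(2)[of 0] by (cases "i = a") (auto simp: D'_def)
    then have "x = g (t 0)" using y(1) by (simp add: vec_eq_iff)
    then show "x \<in> g ` {-\<rho><..<\<rho>}" using t(1)[of 0] by (intro image_eqI) auto
  next
    fix x assume "x \<in> g ` {-\<rho><..<\<rho>}"
    then obtain t where "t \<in> {-\<rho><..<\<rho>}" "x = g t" by blast
    then have t: "\<bar>t\<bar> < \<rho>" "x = g t" by auto
    \<comment> \<open>The backward orbit on the curve: \<open>f\<close> multiplies the parameter by
      \<open>\<mu>\<close>.\<close>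
    define s where "s j = t / \<mu> ^ j" for j
    have s: "\<bar>s j\<bar> < \<rho>" for j
    proof -
      have "\<bar>s j\<bar> = \<bar>t\<bar> / \<mu> ^ j" using expanding by (simp add: s_def abs_divide)
      also have "\<dots> \<le> \<bar>t\<bar>" using expanding mult_left_mono[OF one_le_power[of \<mu> j], of "\<bar>t\<bar>"]
        by (simp add: divide_simps)
      finally show ?thesis using t by simp
    qed
    have "s \<longlonglongrightarrow> 0"
    proof -
      have "(\<lambda>j. t * (1 / \<mu>) ^ j) \<longlonglongrightarrow> t * 0"
        using expanding by (intro tendsto_intros LIMSEQ_realpow_zero) auto
      then show ?thesis by (simp add: s_def[abs_def] power_divide)
    qed
    moreover have "isCont g 0"
      using g_deriv[of 0] R by (intro has_vector_derivative_continuous) auto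
    ultimately have "(\<lambda>j. g (s j)) \<longlonglongrightarrow> g 0" by (rule isCont_tendsto_compose[rotated])
    moreover have "f (g (s (Suc j))) = g (s j)" for j
    proof -
      have e: "\<mu> * s (Suc j) = s j" using expanding by (simp add: s_def)
      show ?thesis using fg[of "s (Suc j)"] s[of j] \<rho>r r1 by (simp add: e)
    qed
    ultimately show "x \<in> local_unstable_manifold f N 0"
      unfolding local_unstable_manifold_def using t s gN g0
      by (intro CollectI exI[of _ "\<lambda>j. g (s j)"]) (auto simp: s_def)
  qed

  have "smooth_curve (g ` {-\<rho><..<\<rho>})"
    unfolding smooth_curve_def
  proof (intro exI conjI)
    show "- \<rho> < \<rho>" using \<rho> by simp
    have inj: "inj_on g {-\<rho><..<\<rho>}"
    proof (rule inj_onI)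
      fix s t assume "s \<in> {-\<rho><..<\<rho>}" "t \<in> {-\<rho><..<\<rho>}" "g s = g t"
      then show "s = t" using ga(1)[of t s] \<rho>r by auto
    qed
    show "homeomorphism {-\<rho><..<\<rho>} (g ` {-\<rho><..<\<rho>}) g (the_inv_into {-\<rho><..<\<rho>} g)"
    proof (rule homeomorphismI)
      show "continuous_on {-\<rho><..<\<rho>} g"
        using \<rho>r r1
        by (intro continuous_at_imp_continuous_on ballI has_vector_derivative_continuous[OF g_deriv]) auto
      \<comment> \<open>The parameter can be recovered from the \<open>a\<close>-coordinate alone,
        whose velocity exceeds 1/2; this is the Lipschitz constant of the inverse.\<close>
      have "2-lipschitz_on (g ` {-\<rho><..<\<rho>}) (the_inv_into {-\<rho><..<\<rho>} g)"
      proof (rule lipschitz_onI)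
        fix x y assume "x \<in> g ` {-\<rho><..<\<rho>}" "y \<in> g ` {-\<rho><..<\<rho>}"
        then obtain s t where st: "s \<in> {-\<rho><..<\<rho>}" "x = g s" "t \<in> {-\<rho><..<\<rho>}" "y = g t" by auto
        have "\<bar>s - t\<bar> \<le> 2 * \<bar>g s $ a - g t $ a\<bar>" using ga(1)[of t s] st \<rho>r by auto
        also have "\<bar>g s $ a - g t $ a\<bar> \<le> norm (g s - g t)"
          using component_le_norm_cart[of "g s - g t" a] by simp
        finally show "dist (the_inv_into {-\<rho><..<\<rho>} g x) (the_inv_into {-\<rho><..<\<rho>} g y) \<le> 2 * dist x y"
          using st inj by (simp add: the_inv_into_f_f dist_norm)
      qed simp
      then show "continuous_on (g ` {-\<rho><..<\<rho>}) (the_inv_into {-\<rho><..<\<rho>} g)"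
        by (rule lipschitz_on_continuous_on)
    qed (use inj in \<open>auto simp: the_inv_into_f_f\<close>)
    show "smooth_on_interval (- \<rho>) \<rho> g"
      unfolding smooth_on_interval_def using D0 D \<rho>r r1 by (intro exI[of _ D]) auto
    show "\<forall>t\<in>{-\<rho><..<\<rho>}. vector_derivative g (at t) \<noteq> 0"
    proof
      fix t assume "t \<in> {-\<rho><..<\<rho>}"
      then have t: "\<bar>t\<bar> < r1" "\<bar>t\<bar> < R" using \<rho>r r1 by auto
      have "vector_derivative g (at t) = D 1 t" by (rule vector_derivative_at[OF g_deriv[OF t(2)]])
      moreover have "D 1 t \<noteq> 0" using D1_bounds(2)[OF t(1)] by auto
      ultimately show "vector_derivative g (at t) \<noteq> 0" by simp
    qed
  qed
  then show ?thesis
    using that \<open>open N\<close> \<open>0 \<in> N\<close> \<open>N \<subseteq> M\<close> stable unstable by simp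
qed

end

section \<open>Transfer to an arbitrary fixed point\<close>

lemma (in complexification) has_derivative_at_0: "(f has_derivative (*v) T) (at 0)"
proof -
  obtain C where C: "C \<ge> 0" "quadratic_remainder H T e C"
    using strictly_differentiable by blast
  define n where "n = real CARD('n)"
  have cvec0: "cvec 0 = (0 :: complex^'n)" by (simp add: vec_eq_iff)
  have f0: "f 0 = 0"
    using real_values[of 0] radius_pos by (simp add: vec_eq_iff cvec0 zero)
  have est: "norm (f x - T *v x) \<le> n * (C * n) * (norm x * norm x)" if x: "norm x \<le> e / 2" for x
  proof (cases "x = 0")
    case True
    then show ?thesis by (simp add: f0)
  next
    case False
    have xi: "\<bar>x $ i\<bar> \<le> norm x" for i by (rule component_le_norm_cart)
    have "\<bar>(f x - T *v x) $ j\<bar> \<le> C * n * (norm x * norm x)" for j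
    proof -
      have "norm (H (cvec x) $ j - H (cvec 0) $ j
          - (\<Sum>i\<in>UNIV. complex_of_real (T $ j $ i) * (cvec x $ i - cvec 0 $ i)))
          \<le> C * norm x * (\<Sum>i\<in>UNIV. norm (cvec x $ i - cvec 0 $ i))"
        using quadratic_remainderD[OF C(2), of "norm x" "cvec x" "cvec 0" j] x xi False by simp
      also have "\<dots> \<le> C * norm x * (\<Sum>i\<in>(UNIV::'n set). norm x)"
        using C(1) xi by (intro mult_left_mono sum_mono) auto
      also have "\<dots> = C * n * (norm x * norm x)" by (simp add: n_def)
      finally have "norm (complex_of_real (f x $ j) - (\<Sum>i\<in>UNIV. complex_of_real (T $ j $ i) * complex_of_real (x $ i)))
          \<le> C * n * (norm x * norm x)"
        using real_values[of x j] x order_trans[OF xi, of "e"] radius_pos by (simp add: cvec0 zero)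
      also have "complex_of_real (f x $ j) - (\<Sum>i\<in>UNIV. complex_of_real (T $ j $ i) * complex_of_real (x $ i))
          = complex_of_real ((f x - T *v x) $ j)"
        by (simp add: matrix_vector_mult_def)
      finally show ?thesis unfolding norm_of_real .
    qed
    then have "(\<Sum>j\<in>UNIV. \<bar>(f x - T *v x) $ j\<bar>) \<le> (\<Sum>j\<in>(UNIV::'n set). C * n * (norm x * norm x))"
      by (intro sum_mono)
    then show ?thesis using norm_le_l1_cart[of "f x - T *v x"] by (simp add: n_def)
  qed
  show ?thesis
    unfolding has_derivative_at
  proof
    show "bounded_linear ((*v) T)" by (rule matrix_vector_mul_bounded_linear)
    show "((\<lambda>h. norm (f (0 + h) - f 0 - T *v h) / norm h) \<longlongrightarrow> 0) (at 0)"
    proof (rule Lim_null_comparison)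
      show "\<forall>\<^sub>F h in at 0. norm (norm (f (0 + h) - f 0 - T *v h) / norm h) \<le> n * (C * n) * norm h"
        unfolding eventually_at
      proof (intro exI[of _ "e / 2"] conjI ballI impI)
        fix h :: "real^'n" assume "h \<noteq> 0 \<and> dist h 0 < e / 2"
        then show "norm (norm (f (0 + h) - f 0 - T *v h) / norm h) \<le> n * (C * n) * norm h"
          using est[of h] by (simp add: f0 divide_simps mult_ac)
      qed (use radius_pos in auto)
      show "((\<lambda>h. n * (C * n) * norm h) \<longlongrightarrow> 0) (at 0)"
        by (rule tendsto_eq_intros refl | simp)+
    qed
  qed
qed

lemma complexification_has_derivative:
  assumes "complexification (\<lambda>x. F (p + x) - F p) H e T"
  shows "(F has_derivative (*v) T) (at p)"
  using complexification.has_derivative_at_0[OF assms]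
  by (simp add: has_derivative_at matrix_vector_mul_bounded_linear)

lemma real_analytic_on_has_derivative:
  fixes F :: "real^'n \<Rightarrow> real^'n"
  assumes "real_analytic_on F U" "open U" "p \<in> U"
  obtains T where "(F has_derivative (*v) T) (at p)"
proof -
  obtain H e T where "complexification (\<lambda>x. F (p + x) - F p) H e T"
    using assms by (rule real_analytic_on_complexification)
  from complexification_has_derivative[OF this] show ?thesis by (rule that)
qed

lemma smooth_curve_translate:
  fixes C :: "'a::real_normed_vector set"
  assumes "smooth_curve C"
  shows "smooth_curve ((+) p ` C)"
proof -
  obtain a b g h D where ab: "a < b" and hom: "homeomorphism {a<..<b} C g h" and D0: "D 0 = g"
    and D: "\<forall>n. \<forall>t\<in>{a<..<b}. (D n has_vector_derivative D (Suc n) t) (at t)"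
    and nz: "\<forall>t\<in>{a<..<b}. vector_derivative g (at t) \<noteq> 0"
    using assms unfolding smooth_curve_def smooth_on_interval_def by blast
  define D' where "D' n = (if n = 0 then (\<lambda>t. p + g t) else D n)" for n :: nat
  have D': "(D' n has_vector_derivative D' (Suc n) t) (at t)" if "t \<in> {a<..<b}" for n t
  proof (cases n)
    case 0
    have "(g has_vector_derivative D 1 t) (at t)" using D D0 that by force
    then show ?thesis by (auto simp: D'_def 0 intro!: derivative_eq_intros)
  next
    case (Suc m)
    then show ?thesis using D that by (simp add: D'_def)
  qed
  have "homeomorphism {a<..<b} ((+) p ` C) ((+) p \<circ> g) (h \<circ> (\<lambda>x. x - p))"
    by (rule homeomorphism_compose[OF hom]) (auto simp: homeomorphism_def image_image intro!: continuous_intros)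
  moreover have "smooth_on_interval a b (\<lambda>t. p + g t)"
    unfolding smooth_on_interval_def using D' by (intro exI[of _ D']) (auto simp: D'_def)
  moreover have "vector_derivative (\<lambda>t. p + g t) (at t) \<noteq> 0" if "t \<in> {a<..<b}" for t
  proof -
    have g: "(g has_vector_derivative D 1 t) (at t)" using D D0 that by force
    have "((\<lambda>t. p + g t) has_vector_derivative D 1 t) (at t)" using D'[OF that, of 0] by (simp add: D'_def)
    then show ?thesis using nz that vector_derivative_at[OF g] vector_derivative_at by metis
  qed
  ultimately show ?thesis
    using ab unfolding smooth_curve_def o_def by blast
qed

theorem analytic_saddle_manifolds:
  fixes F :: "real^'n \<Rightarrow> real^'n" and T :: "real^'n^'n"
  assumes an: "real_analytic_on F U" and U: "open U" "p \<in> U" and fixpt: "F p = p"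
    and inv: "\<And>q. q \<in> U \<Longrightarrow> q $ a = p $ a \<Longrightarrow> F q $ a = p $ a"
    and T: "(F has_derivative (*v) T) (at p)"
    and row: "\<And>j. T $ a $ j = (if j = a then \<mu> else 0)" and \<mu>: "\<mu> > 1"
    and columns: "\<And>j. j \<noteq> a \<Longrightarrow> (\<Sum>i\<in>UNIV. \<bar>T $ i $ j\<bar>) \<le> \<kappa>" and \<kappa>: "\<kappa> < 1"
    and M: "open M" "p \<in> M"
  obtains N where "open N" "p \<in> N" "N \<subseteq> M"
    "smooth_curve (local_unstable_manifold F N p)"
    "local_stable_manifold F N p = {q \<in> N. q $ a = p $ a}"
proof -
  define f where "f x = F (p + x) - p" for x
  obtain H e T' where "complexification (\<lambda>x. F (p + x) - F p) H e T'"
    using an U by (rule real_analytic_on_complexification)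
  \<comment> \<open>Uniqueness of the derivative identifies the degree-one coefficients of the power
    series with the given matrix.\<close>
  moreover from complexification_has_derivative[OF this] T have "(*v) T' = (*v) T"
    by (rule has_derivative_unique)
  then have "T' = T" by (metis matrix_of_matrix_vector_mul)
  ultimately interpret complexification f H e T
    using fixpt by (simp add: f_def[abs_def])
  obtain m where m: "m > 0" "ball p m \<subseteq> U" using U openE by blast
  interpret invariant_saddle f H e T a \<mu> \<kappa> m
  proof
    show "f x $ a = 0" if "x $ a = 0" "norm x < m" for x
      using that m(2) inv[of "p + x"] by (auto simp: f_def dist_norm subset_eq)
  qed (fact row \<mu> columns \<kappa> m)+
  have "open ((+) (- p) ` M)" using M(1) by (rule open_translation)
  moreover have "0 \<in> (+) (- p) ` M" using M(2) by (force simp: image_iff)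
  ultimately obtain N where N: "open N" "0 \<in> N" "N \<subseteq> (+) (- p) ` M"
    "smooth_curve (local_unstable_manifold f N 0)" "local_stable_manifold f N 0 = {x \<in> N. x $ a = 0}"
    by (rule local_manifolds)
  \<comment> \<open>Translation by \<open>p\<close> conjugates \<open>f\<close> to \<open>F\<close>,
    so orbits, limits and both local manifolds correspond.\<close>
  have iter: "(F ^^ k) q = p + (f ^^ k) (q - p)" for k q
    by (induction k) (simp_all add: f_def)
  have mem: "q \<in> (+) p ` N \<longleftrightarrow> q - p \<in> N" for q
    by (force simp: image_iff)
  have tend: "(\<lambda>k. p + x k) \<longlonglongrightarrow> p \<longleftrightarrow> x \<longlonglongrightarrow> 0" for x
    using LIM_zero_iff[of "\<lambda>k. p + x k" p sequentially] by simp
  have "local_stable_manifold F ((+) p ` N) p = (+) p ` local_stable_manifold f N 0"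
  proof -
    have "q \<in> local_stable_manifold F ((+) p ` N) p \<longleftrightarrow> q - p \<in> local_stable_manifold f N 0" for q
      unfolding local_stable_manifold_def by (simp add: iter mem tend)
    then show ?thesis by (force simp: image_iff)
  qed
  also have "\<dots> = {q \<in> (+) p ` N. q $ a = p $ a}"
    unfolding N(5) by auto
  finally have st: "local_stable_manifold F ((+) p ` N) p = {q \<in> (+) p ` N. q $ a = p $ a}" .
  have "q \<in> local_unstable_manifold F ((+) p ` N) p \<longleftrightarrow> q - p \<in> local_unstable_manifold f N 0" for q
  proof
    assume "q \<in> local_unstable_manifold F ((+) p ` N) p"
    then obtain y where "y 0 = q" "\<forall>n. y n \<in> (+) p ` N" "\<forall>n. F (y (Suc n)) = y n" "y \<longlonglongrightarrow> p"
      unfolding local_unstable_manifold_def by blast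
    then show "q - p \<in> local_unstable_manifold f N 0"
      unfolding local_unstable_manifold_def mem
      by (intro CollectI exI[of _ "\<lambda>n. y n - p"]) (simp add: f_def LIM_zero)
  next
    assume "q - p \<in> local_unstable_manifold f N 0"
    then obtain y where "y 0 = q - p" "\<forall>n. y n \<in> N" "\<forall>n. f (y (Suc n)) = y n" "y \<longlonglongrightarrow> 0"
      unfolding local_unstable_manifold_def by blast
    then show "q \<in> local_unstable_manifold F ((+) p ` N) p"
      unfolding local_unstable_manifold_def
      by (intro CollectI exI[of _ "\<lambda>n. p + y n"]) (simp add: tend, simp add: f_def algebra_simps)
  qed
  then have un: "local_unstable_manifold F ((+) p ` N) p = (+) p ` local_unstable_manifold f N 0"
    by (force simp: image_iff)
  show ?thesis
  proof (rule that)
    show "open ((+) p ` N)" using N(1) by (rule open_translation)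
    show "p \<in> (+) p ` N" using N(2) by (force simp: image_iff)
    show "(+) p ` N \<subseteq> M" using N(3) by auto
    show "smooth_curve (local_unstable_manifold F ((+) p ` N) p)"
      unfolding un by (rule smooth_curve_translate[OF N(4)])
  qed (fact st)
qed

section \<open>Asymptotic bounds on short trajectories\<close>

locale short_time =
  fixes T :: "real \<Rightarrow> real" and K :: real
  assumes T_nonneg: "\<forall>\<^sub>F r in at_right 0. 0 \<le> T r" and K: "0 < K"
begin

text \<open>A trajectory is available only up to its return time \<open>T r\<close>, which nothing
  bounds by a multiple of \<open>r\<close> in advance. The window is therefore cut off at
  \<open>K * r\<close>; that the return lies inside it is proved afterwards.\<close>

definition dom :: "real \<Rightarrow> real set" where
  "dom r = {0..min (T r) (K * r)}"

abbreviation evt :: "(real \<Rightarrow> real \<Rightarrow> bool) \<Rightarrow> bool" where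
  "evt Q \<equiv> \<forall>\<^sub>F r in at_right 0. \<forall>t\<in>dom r. Q r t"

text \<open>The notion \<open>O(r^n)\<close> for \<open>r\<close> tending to 0 from the right,
  uniformly on the window. There \<open>t\<close> itself is \<open>O(r)\<close>, so powers of
  \<open>r\<close> and of \<open>t\<close> count alike.\<close>

definition bnd :: "nat \<Rightarrow> (real \<Rightarrow> real \<Rightarrow> 'a::real_normed_vector) \<Rightarrow> bool" where
  "bnd n f \<longleftrightarrow> (\<exists>C. evt (\<lambda>r t. norm (f r t) \<le> C * r ^ n))"

lemma eventually_pos: "\<forall>\<^sub>F r in at_right 0. (0::real) < r"
  by (simp add: eventually_at_right_less)

lemma eventually_lt: "0 < c \<Longrightarrow> \<forall>\<^sub>F r in at_right 0. r < (c::real)"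
  by (rule eventually_at_right_real[THEN eventually_mono]) auto

lemma bndE:
  assumes "bnd n f"
  obtains C where "C > 0" "evt (\<lambda>r t. norm (f r t) \<le> C * r ^ n)"
proof -
  obtain C where C: "evt (\<lambda>r t. norm (f r t) \<le> C * r ^ n)"
    using assms unfolding bnd_def by blast
  have "evt (\<lambda>r t. norm (f r t) \<le> max C 1 * r ^ n)"
    using C eventually_pos
  proof eventually_elim
    case (elim r)
    then have "C * r ^ n \<le> max C 1 * r ^ n" by (intro mult_right_mono) auto
    then show ?case using elim by (meson order_trans)
  qed
  then show ?thesis by (intro that[of "max C 1"]) auto
qed

lemma bnd_dominated:
  assumes "bnd n g" "evt (\<lambda>r t. norm (f r t) \<le> norm (g r t))"
  shows "bnd n f"
proof -
  obtain C where C: "evt (\<lambda>r t. norm (g r t) \<le> C * r ^ n)"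
    using assms(1) unfolding bnd_def by blast
  have "evt (\<lambda>r t. norm (f r t) \<le> C * r ^ n)"
    using assms(2) C by eventually_elim (meson order_trans)
  then show ?thesis unfolding bnd_def by blast
qed

lemma bnd_cong:
  assumes "bnd n g" "evt (\<lambda>r t. f r t = g r t)"
  shows "bnd n f"
  by (rule bnd_dominated[OF assms(1)], rule eventually_mono[OF assms(2)]) auto

lemma bnd_mono:
  assumes "bnd m f" "n \<le> m"
  shows "bnd n f"
proof -
  obtain C where C: "C > 0" "evt (\<lambda>r t. norm (f r t) \<le> C * r ^ m)"
    using assms(1) by (rule bndE)
  have "evt (\<lambda>r t. norm (f r t) \<le> C * r ^ n)"
    using C(2) eventually_pos eventually_lt[OF zero_less_one]
  proof eventually_elim
    case (elim r)
    then have "C * r ^ m \<le> C * r ^ n"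
      using C(1) assms(2) by (intro mult_left_mono power_decreasing) auto
    then show ?case using elim by (meson order_trans)
  qed
  then show ?thesis unfolding bnd_def by blast
qed

lemma bnd_add:
  assumes "bnd n f" "bnd n g"
  shows "bnd n (\<lambda>r t. f r t + g r t)"
proof -
  obtain C where C: "evt (\<lambda>r t. norm (f r t) \<le> C * r ^ n)"
    using assms(1) unfolding bnd_def by blast
  obtain C' where C': "evt (\<lambda>r t. norm (g r t) \<le> C' * r ^ n)"
    using assms(2) unfolding bnd_def by blast
  have "evt (\<lambda>r t. norm (f r t + g r t) \<le> (C + C') * r ^ n)"
    using C C'
  proof eventually_elim
    case (elim r)
    show ?case
    proof
      fix t assume "t \<in> dom r"
      then show "norm (f r t + g r t) \<le> (C + C') * r ^ n"
        using elim norm_triangle_ineq[of "f r t" "g r t"] by (force simp: algebra_simps)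
    qed
  qed
  then show ?thesis unfolding bnd_def by blast
qed

lemma bnd_minus: "bnd n f \<Longrightarrow> bnd n (\<lambda>r t. - f r t)"
  by (erule bnd_dominated) simp

lemma bnd_diff: "bnd n f \<Longrightarrow> bnd n g \<Longrightarrow> bnd n (\<lambda>r t. f r t - g r t)"
  using bnd_add[OF _ bnd_minus] by simp

lemma bnd_bilinear:
  assumes "bounded_bilinear b" "bnd n f" "bnd m g"
  shows "bnd (n + m) (\<lambda>r t. b (f r t) (g r t))"
proof -
  obtain C where C: "C > 0" "evt (\<lambda>r t. norm (f r t) \<le> C * r ^ n)"
    using assms(2) by (rule bndE)
  obtain C' where C': "C' > 0" "evt (\<lambda>r t. norm (g r t) \<le> C' * r ^ m)"
    using assms(3) by (rule bndE)
  obtain B where B: "B > 0" "\<And>x y. norm (b x y) \<le> norm x * norm y * B"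
    using bounded_bilinear.pos_bounded[OF assms(1)] by blast
  have "evt (\<lambda>r t. norm (b (f r t) (g r t)) \<le> (C * C' * B) * r ^ (n + m))"
    using C(2) C'(2) eventually_pos
  proof eventually_elim
    case (elim r)
    show ?case
    proof
      fix t assume t: "t \<in> dom r"
      have "norm (b (f r t) (g r t)) \<le> norm (f r t) * norm (g r t) * B" by (rule B(2))
      also have "\<dots> \<le> (C * r ^ n) * (C' * r ^ m) * B"
        using elim t B(1) C(1) by (intro mult_right_mono mult_mono) auto
      finally show "norm (b (f r t) (g r t)) \<le> (C * C' * B) * r ^ (n + m)"
        by (simp add: power_add mult_ac)
    qed
  qed
  then show ?thesis unfolding bnd_def by blast
qed

lemma bnd_const: "bnd 0 (\<lambda>r t. c)"
  unfolding bnd_def by (intro exI[of _ "norm c"]) simp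

lemma bnd_r: "bnd 1 (\<lambda>r t. r)"
proof -
  have "evt (\<lambda>r t. norm r \<le> 1 * r ^ 1)"
    using eventually_pos by eventually_elim simp
  then show ?thesis unfolding bnd_def by blast
qed

lemma bnd_t: "bnd 1 (\<lambda>r t. t)"
  unfolding bnd_def by (intro exI[of _ K] always_eventually) (auto simp: dom_def)

lemma bnd_scaleR: "bnd n f \<Longrightarrow> bnd m g \<Longrightarrow> bnd (n + m) (\<lambda>r t. f r t *\<^sub>R g r t)"
  by (rule bnd_bilinear[OF bounded_bilinear_scaleR])

lemma bnd_mult: "bnd n f \<Longrightarrow> bnd m g \<Longrightarrow> bnd (n + m) (\<lambda>r t. f r t * g r t :: real)"
  by (rule bnd_bilinear[OF bounded_bilinear_mult])

lemma bnd_cmult: "bnd n f \<Longrightarrow> bnd n (\<lambda>r t. c * f r t :: real)"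
  using bnd_mult[OF bnd_const] by simp

lemma bnd_cscaleR: "bnd n f \<Longrightarrow> bnd n (\<lambda>r t. c *\<^sub>R f r t)"
  using bnd_scaleR[OF bnd_const] by simp

lemma zero_in_dom: "\<forall>\<^sub>F r in at_right 0. 0 \<in> dom r"
  using T_nonneg eventually_pos by eventually_elim (use K in \<open>simp add: dom_def\<close>)

lemma bnd_initial: "bnd n f \<Longrightarrow> bnd n (\<lambda>r t. f r 0)"
proof -
  assume "bnd n f"
  then obtain C where C: "evt (\<lambda>r t. norm (f r t) \<le> C * r ^ n)"
    unfolding bnd_def by blast
  have "evt (\<lambda>r t. norm (f r 0) \<le> C * r ^ n)"
    using C zero_in_dom by eventually_elim auto
  then show ?thesis unfolding bnd_def by blast
qed

lemma increment_bound:
  fixes f :: "real \<Rightarrow> 'a::real_normed_vector"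
  assumes "\<And>s. s \<in> {0..u} \<Longrightarrow> (f has_vector_derivative f' s) (at s within {0..u})"
    and "\<And>s. s \<in> {0..u} \<Longrightarrow> norm (f' s) \<le> B" and "t \<in> {0..u}"
  shows "norm (f t - f 0) \<le> B * t"
proof -
  have "norm (f t - f 0) \<le> B * norm (t - 0)"
  proof (rule differentiable_bound[of "{0..u}" f "\<lambda>s h. h *\<^sub>R f' s"])
    show "(f has_derivative (\<lambda>h. h *\<^sub>R f' s)) (at s within {0..u})" if "s \<in> {0..u}" for s
      using assms(1)[OF that] by (simp add: has_vector_derivative_def)
    show "onorm (\<lambda>h. h *\<^sub>R f' s) \<le> B" if "s \<in> {0..u}" for s
    proof (rule onorm_le)
      fix h :: real
      show "norm (h *\<^sub>R f' s) \<le> B * norm h"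
        using mult_right_mono[OF assms(2)[OF that], of "\<bar>h\<bar>"] by (simp add: mult.commute)
    qed
  qed (use assms(3) in auto)
  then show ?thesis using assms(3) by simp
qed

text \<open>Integration over a window of length \<open>O(r)\<close> gains one power of
  \<open>r\<close>. All expansions rest on this: an error \<open>O(r^n)\<close> in the derivative
  costs only \<open>O(r^(n+1))\<close> in the function.\<close>

lemma bnd_integrate:
  assumes D: "evt (\<lambda>r t. (f r has_vector_derivative f' r t) (at t within dom r))"
    and f': "bnd n f'" and f0: "bnd (Suc n) (\<lambda>r t. f r 0)"
  shows "bnd (Suc n) f"
proof -
  obtain C where C: "C > 0" "evt (\<lambda>r t. norm (f' r t) \<le> C * r ^ n)"
    using f' by (rule bndE)
  obtain C0 where C0: "C0 > 0" "evt (\<lambda>r t. norm (f r 0) \<le> C0 * r ^ Suc n)"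
    using f0 by (rule bndE)
  have "evt (\<lambda>r t. norm (f r t) \<le> (C * K + C0) * r ^ Suc n)"
    using D C(2) C0(2) eventually_pos
  proof eventually_elim
    case (elim r)
    show ?case
    proof
      fix t assume t: "t \<in> dom r"
      have "norm (f r t - f r 0) \<le> C * r ^ n * t"
        by (rule increment_bound[where f' = "f' r"]) (use elim t in \<open>auto simp: dom_def\<close>)
      also have "\<dots> \<le> C * r ^ n * (K * r)"
        using t elim C(1) by (intro mult_left_mono) (auto simp: dom_def)
      finally have "norm (f r t - f r 0) \<le> C * K * r ^ Suc n" by (simp add: mult_ac)
      moreover have "norm (f r 0) \<le> C0 * r ^ Suc n" using elim t by blast
      moreover have "norm (f r t) \<le> norm (f r t - f r 0) + norm (f r 0)"
        using norm_triangle_ineq[of "f r t - f r 0" "f r 0"] by simp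
      ultimately show "norm (f r t) \<le> (C * K + C0) * r ^ Suc n" by (simp add: distrib_right)
    qed
  qed
  then show ?thesis unfolding bnd_def by blast
qed

text \<open>For times so short that \<open>B K r \<le> 1/2\<close>, the maximum of a solution is at most twice
  its initial value plus the forcing.\<close>

lemma bnd_gronwall:
  assumes D: "evt (\<lambda>r t. (f r has_vector_derivative f' r t) (at t within dom r))"
    and f': "evt (\<lambda>r t. norm (f' r t) \<le> B * norm (f r t) + C * r ^ n)"
    and f0: "bnd m (\<lambda>r t. f r 0)" and mn: "m \<le> Suc n" and BC: "0 \<le> B" "0 \<le> C"
  shows "bnd m f"
proof -
  obtain C0 where C0: "C0 > 0" "evt (\<lambda>r t. norm (f r 0) \<le> C0 * r ^ m)"
    using f0 by (rule bndE)
  have "\<forall>\<^sub>F r in at_right 0. r < 1 / (2 * (B + 1) * K)"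
    using K BC by (intro eventually_lt) simp
  then have "evt (\<lambda>r t. norm (f r t) \<le> (2 * C0 + 2 * C * K) * r ^ m)"
    using D f' C0(2) eventually_pos eventually_lt[OF zero_less_one] zero_in_dom
  proof eventually_elim
    case (elim r)
    have cont: "continuous_on (dom r) (f r)"
      using elim(2) by (auto simp: continuous_on_eq_continuous_within intro: has_vector_derivative_continuous)
    have "compact (dom r)" by (simp add: dom_def)
    then obtain s where s: "s \<in> dom r" and max: "\<And>t. t \<in> dom r \<Longrightarrow> norm (f r t) \<le> norm (f r s)"
      using continuous_attains_sup[of "dom r" "\<lambda>t. norm (f r t)"] elim(7) cont
      by (metis continuous_on_norm empty_iff)
    define m0 where "m0 = norm (f r s)"
    have m0: "0 \<le> m0" by (simp add: m0_def)
    have "norm (f r s - f r 0) \<le> (B * m0 + C * r ^ n) * s"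
    proof (rule increment_bound[where f' = "f' r"])
      show "norm (f' r t) \<le> B * m0 + C * r ^ n" if "t \<in> {0..min (T r) (K * r)}" for t
      proof -
        have "t \<in> dom r" using that by (simp add: dom_def)
        then have "norm (f' r t) \<le> B * norm (f r t) + C * r ^ n" "B * norm (f r t) \<le> B * m0"
          using elim(3) max[of t] BC by (auto simp: m0_def intro: mult_left_mono)
        then show ?thesis by linarith
      qed
    qed (use elim s in \<open>auto simp: dom_def\<close>)
    also have "\<dots> \<le> (B * m0 + C * r ^ n) * (K * r)"
      using s BC m0 elim by (intro mult_left_mono) (auto simp: dom_def)
    also have "\<dots> = B * K * r * m0 + C * K * r ^ Suc n" by (simp add: algebra_simps)
    also have "\<dots> \<le> 1 / 2 * m0 + C * K * r ^ m"
    proof (intro add_mono mult_right_mono mult_left_mono)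
      have "r * (2 * (B + 1) * K) < 1"
        using elim(1) K BC by (simp add: pos_less_divide_eq)
      moreover have "r * (2 * (B + 1) * K) = 2 * (B * K * r) + 2 * (K * r)" by (simp add: algebra_simps)
      moreover have "0 < K * r" using K elim by simp
      ultimately show "B * K * r \<le> 1 / 2" by linarith
      show "r ^ Suc n \<le> r ^ m" using mn elim by (intro power_decreasing) auto
    qed (use m0 BC K in auto)
    finally have "norm (f r s - f r 0) \<le> 1 / 2 * m0 + C * K * r ^ m" .
    moreover have "m0 \<le> norm (f r s - f r 0) + norm (f r 0)"
      using norm_triangle_ineq[of "f r s - f r 0" "f r 0"] by (simp add: m0_def)
    moreover have "norm (f r 0) \<le> C0 * r ^ m" using elim by blast
    ultimately have "m0 \<le> 2 * (C0 * r ^ m) + 2 * (C * K * r ^ m)" by linarith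
    then have "m0 \<le> (2 * C0 + 2 * C * K) * r ^ m" by (simp add: algebra_simps)
    then show ?case using max order_trans by (fastforce simp: m0_def)
  qed
  then show ?thesis unfolding bnd_def by blast
qed

lemma bnd_inverse:
  assumes f: "bnd 1 (\<lambda>r t. f r t - c)" and c: "c \<noteq> (0::real)"
  shows "bnd 1 (\<lambda>r t. 1 / f r t - 1 / c)" "evt (\<lambda>r t. f r t \<noteq> 0)"
proof -
  obtain C where C: "C > 0" "evt (\<lambda>r t. norm (f r t - c) \<le> C * r ^ 1)"
    using f by (rule bndE)
  have c': "0 < \<bar>c\<bar> / (2 * C)" using c C by simp
  have ev: "evt (\<lambda>r t. \<bar>f r t - c\<bar> \<le> C * r \<and> \<bar>c\<bar> / 2 \<le> \<bar>f r t\<bar>)"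
    using C(2) eventually_lt[OF c']
  proof eventually_elim
    case (elim r)
    have "r < \<bar>c\<bar> / (2 * C)" using elim(2) c C by simp
    then have "C * r < \<bar>c\<bar> / 2" using C by (simp add: field_simps)
    show ?case
    proof
      fix t assume "t \<in> dom r"
      then have "\<bar>f r t - c\<bar> \<le> C * r" using elim(1) by simp
      with \<open>C * r < \<bar>c\<bar> / 2\<close> show "\<bar>f r t - c\<bar> \<le> C * r \<and> \<bar>c\<bar> / 2 \<le> \<bar>f r t\<bar>" by linarith
    qed
  qed
  then show "evt (\<lambda>r t. f r t \<noteq> 0)"
    by eventually_elim (use c in force)
  have "evt (\<lambda>r t. norm (1 / f r t - 1 / c) \<le> (2 * C / c\<^sup>2) * r ^ 1)"
    using ev eventually_pos
  proof eventually_elim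
    case (elim r)
    show ?case
    proof
      fix t assume t: "t \<in> dom r"
      then have ft: "\<bar>f r t - c\<bar> \<le> C * r" "\<bar>c\<bar> / 2 \<le> \<bar>f r t\<bar>" using elim by auto
      then have nz: "f r t \<noteq> 0" using c by auto
      have "norm (1 / f r t - 1 / c) = \<bar>f r t - c\<bar> / (\<bar>f r t\<bar> * \<bar>c\<bar>)"
        using nz c by (simp add: field_simps flip: abs_mult abs_divide) (simp add: abs_minus_commute)
      also have "\<dots> \<le> C * r / (\<bar>c\<bar> / 2 * \<bar>c\<bar>)"
      proof (rule frac_le)
        have "0 < \<bar>c\<bar>" using c by simp
        then show "0 < \<bar>c\<bar> / 2 * \<bar>c\<bar>" by (intro mult_pos_pos) auto
        show "\<bar>c\<bar> / 2 * \<bar>c\<bar> \<le> \<bar>f r t\<bar> * \<bar>c\<bar>"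
          using ft(2) by (intro mult_right_mono) auto
      qed (use ft C elim in auto)
      also have "\<dots> = 2 * C / c\<^sup>2 * r ^ 1" by (simp add: power2_eq_square flip: abs_mult)
      finally show "norm (1 / f r t - 1 / c) \<le> (2 * C / c\<^sup>2) * r ^ 1" .
    qed
  qed
  then show "bnd 1 (\<lambda>r t. 1 / f r t - 1 / c)" unfolding bnd_def by blast
qed

end

section \<open>Asymptotics of the Reinhardt system at the exceptional divisor\<close>

lemma mk_mat_nth [simp]:
  "mk_mat p q r s $ 1 $ 1 = p" "mk_mat p q r s $ 1 $ 2 = q"
  "mk_mat p q r s $ 2 $ 1 = r" "mk_mat p q r s $ 2 $ 2 = s"
  by (simp_all add: mk_mat_def)

lemma vector_4 [simp]:
  "(vector [p, q, r, s] :: ('a::zero)^4) $ 1 = p" "(vector [p, q, r, s] :: ('a::zero)^4) $ 2 = q"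
  "(vector [p, q, r, s] :: ('a::zero)^4) $ 3 = r" "(vector [p, q, r, s] :: ('a::zero)^4) $ 4 = s"
  unfolding vector_def by simp_all

lemma mat22_eq_iff:
  "(A :: mat22) = B \<longleftrightarrow> A $ 1 $ 1 = B $ 1 $ 1 \<and> A $ 1 $ 2 = B $ 1 $ 2 \<and> A $ 2 $ 1 = B $ 2 $ 1 \<and> A $ 2 $ 2 = B $ 2 $ 2"
  by (auto simp: vec_eq_iff forall_2)

lemma matmul_nth: "((A :: mat22) ** B) $ i $ j = A $ i $ 1 * B $ 1 $ j + A $ i $ 2 * B $ 2 $ j"
  by (simp add: matrix_matrix_mult_def sum_2)

lemma trace_22: "trace (A :: mat22) = A $ 1 $ 1 + A $ 2 $ 2"
  by (simp add: trace_def sum_2)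

lemma trace_form_eq: "trace_form A B = A $ 1 $ 1 * B $ 1 $ 1 + A $ 1 $ 2 * B $ 2 $ 1 + (A $ 2 $ 1 * B $ 1 $ 2 + A $ 2 $ 2 * B $ 2 $ 2)"
  by (simp add: trace_form_def trace_22 matmul_nth)

lemma lie_bracket_nth:
  "lie_bracket A B $ i $ j = A $ i $ 1 * B $ 1 $ j + A $ i $ 2 * B $ 2 $ j - (B $ i $ 1 * A $ 1 $ j + B $ i $ 2 * A $ 2 $ j)"
  by (simp add: lie_bracket_def matmul_nth)

lemmas mat22_simps = mat22_eq_iff trace_form_eq lie_bracket_nth

lemma bounded_bilinear_trace_form: "bounded_bilinear trace_form"
proof -
  have "bilinear trace_form"
    unfolding bilinear_def linear_iff by (auto simp: trace_form_eq algebra_simps)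
  then show ?thesis by (simp add: bilinear_conv_bounded_bilinear)
qed

lemma bounded_bilinear_lie_bracket: "bounded_bilinear lie_bracket"
proof -
  have "bilinear lie_bracket"
    unfolding bilinear_def linear_iff by (auto simp: mat22_simps algebra_simps)
  then show ?thesis by (simp add: bilinear_conv_bounded_bilinear)
qed

interpretation trace_form: bounded_bilinear trace_form by (rule bounded_bilinear_trace_form)
interpretation lie_bracket: bounded_bilinear lie_bracket by (rule bounded_bilinear_lie_bracket)

lemma Z_ctrl_1: "Z_ctrl (e_vec 1) = mk_mat 0 (1 / 3) 1 0"
  and Z_ctrl_2: "Z_ctrl (e_vec 2) = mk_mat (1 / sqrt 3) (- (2 / 3)) 0 (- (1 / sqrt 3))"
  and Z_ctrl_3: "Z_ctrl (e_vec 3) = mk_mat (- (1 / sqrt 3)) (- (2 / 3)) 0 (1 / sqrt 3)"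
  by (simp_all add: Z_ctrl_def axis_def)

lemma mk_mat_eq_scaleR:
  "mk_mat p q r s = p *\<^sub>R mk_mat 1 0 0 0 + q *\<^sub>R mk_mat 0 1 0 0 + r *\<^sub>R mk_mat 0 0 1 0 + s *\<^sub>R mk_mat 0 0 0 1"
  by (simp add: mat22_simps)

context short_time
begin

lemma bnd_mk_mat:
  assumes "bnd n p" "bnd n q" "bnd n u" "bnd n v"
  shows "bnd n (\<lambda>r t. mk_mat (p r t) (q r t) (u r t) (v r t))"
proof -
  have *: "bnd n (\<lambda>r t. f r t *\<^sub>R E)" if "bnd n f" for f and E :: mat22
    using bnd_scaleR[OF that bnd_const] by simp
  show ?thesis unfolding mk_mat_eq_scaleR[of "p _ _"] by (intro bnd_add * assms)
qed

lemma bnd_trace_form: "bnd n f \<Longrightarrow> bnd m g \<Longrightarrow> bnd (n + m) (\<lambda>r t. trace_form (f r t) (g r t))"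
  by (rule bnd_bilinear[OF bounded_bilinear_trace_form])

lemma bnd_lie_bracket: "bnd n f \<Longrightarrow> bnd m g \<Longrightarrow> bnd (n + m) (\<lambda>r t. lie_bracket (f r t) (g r t))"
  by (rule bnd_bilinear[OF bounded_bilinear_lie_bracket])

lemma bnd_power: "bnd 1 f \<Longrightarrow> bnd n (\<lambda>r t. f r t ^ n :: real)"
proof (induction n)
  case 0
  then show ?case by (simp add: bnd_const)
next
  case (Suc n)
  then show ?case using bnd_mult[of 1 f n "\<lambda>r t. f r t ^ n"] by simp
qed

lemma bnd_rt: "bnd (i + j) (\<lambda>r t. c * r ^ i * t ^ j)"
  by (intro bnd_mult bnd_cmult bnd_power bnd_r bnd_t)

text \<open>Serves for the a priori orders of \<open>X\<close>, \<open>L\<close> and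
  \<open>M\<close>, each of which solves a linear equation once the preceding quantities are
  bounded; the leading terms are found later by integration.\<close>

lemma bnd_linear_system:
  assumes D: "evt (\<lambda>r t. (f r has_vector_derivative f' r t) (at t within dom r))"
    and eq: "evt (\<lambda>r t. norm (f' r t) \<le> p r t * norm (f r t) + q r t)"
    and p: "bnd 0 p" and q: "bnd n q"
    and f0: "bnd m (\<lambda>r t. f r 0)" and mn: "m \<le> Suc n"
  shows "bnd m f"
proof -
  obtain B where B: "B > 0" "evt (\<lambda>r t. norm (p r t) \<le> B * r ^ 0)"
    using p by (rule bndE)
  obtain C where C: "C > 0" "evt (\<lambda>r t. norm (q r t) \<le> C * r ^ n)"
    using q by (rule bndE)
  have "evt (\<lambda>r t. norm (f' r t) \<le> B * norm (f r t) + C * r ^ n)"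
    using eq B(2) C(2)
  proof eventually_elim
    case (elim r)
    show ?case
    proof
      fix t assume t: "t \<in> dom r"
      have "p r t * norm (f r t) \<le> B * norm (f r t)"
        using elim t by (intro mult_right_mono) (auto simp: abs_le_iff)
      then show "norm (f' r t) \<le> B * norm (f r t) + C * r ^ n"
        using elim t by (force simp: abs_le_iff)
    qed
  qed
  then show ?thesis using B(1) C(1) by (intro bnd_gronwall[OF D _ f0 mn]) auto
qed

end

lemma trace_form_Z_bracket: "trace_form Z (lie_bracket (k *\<^sub>R Z) X) = 0"
  by (simp add: trace_form_eq lie_bracket_nth algebra_simps)

text \<open>Minus the leading coefficient of the switching function
  \<open>\<chi>\<^sub>2\<^sub>1\<close>: at time \<open>r * \<tau>\<close> that function is
  \<open>- r ^ 3\<close> times this cubic, up to \<open>O(r^4)\<close>.\<close>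

definition switching_cubic :: "real \<Rightarrow> real \<Rightarrow> real \<Rightarrow> real \<Rightarrow> real" where
  "switching_cubic x l m \<tau> = 6 * (l + m * x) + (6 * l + 2 * sqrt 3 * m) * \<tau>
     + (9 * x - 3 * sqrt 3) * \<tau>\<^sup>2 + 2 * sqrt 3 * \<tau> ^ 3"

text \<open>The base point \<open>x\<close>, \<open>l\<close>, \<open>m\<close> is fixed and only
  \<open>r\<close> varies: an arbitrary solution is taken for each small \<open>r\<close>, with no
  assumption on its dependence on \<open>r\<close>.\<close>

locale reinhardt_family = short_time T K for T :: "real \<Rightarrow> real" and K +
  fixes x l m :: real and X L M :: "real \<Rightarrow> real \<Rightarrow> mat22"
  assumes init: "\<forall>\<^sub>F r in at_right 0. represents (vector [r, x, l, m]) (X r 0) (L r 0) (M r 0)"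
    and sol: "\<forall>\<^sub>F r in at_right 0. reinhardt_solution (e_vec 2) (T r) (X r) (L r) (M r)"
begin

abbreviation \<sigma> where "\<sigma> \<equiv> switching_cubic x l m"
text \<open>\<open>A\<close> is the small part of \<open>L\<close>, which tends to
  \<open>- (3/2) J\<close>. The constants describe leading behaviour: \<open>P0\<close> is the limit
  of \<open>P\<close>, \<open>S0\<close> and \<open>W0\<close> belong to the initial
  \<open>X - J\<close> and \<open>A\<close>, \<open>S1 = [P0, J]\<close> is the limiting velocity of
  \<open>X\<close>, and \<open>Y0\<close> belongs to the initial \<open>M\<close>.\<close>

definition P where "P r t = P_ctrl (e_vec 2) (X r t)"
definition A where "A r t = L r t + (3/2) *\<^sub>R J_mat"
definition P0 :: mat22 where "P0 = mk_mat (- (sqrt 3 / 2)) 1 0 (sqrt 3 / 2)"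
definition S0 :: mat22 where "S0 = mk_mat 1 x x (- 1)"
definition S1 :: mat22 where "S1 = mk_mat 1 (sqrt 3) (sqrt 3) (- 1)"
definition W0 :: mat22 where "W0 = mk_mat l m m (- l)"
definition Y0 :: mat22 where "Y0 = mk_mat 0 (2 * (l + m * x)) (2 * (l + m * x)) 0"

lemma derivs:
  "evt (\<lambda>r t. (X r has_vector_derivative lie_bracket (P r t) (X r t)) (at t within dom r))"
  "evt (\<lambda>r t. (L r has_vector_derivative lie_bracket (L r t) (X r t)) (at t within dom r))"
  "evt (\<lambda>r t. (M r has_vector_derivative
     (lie_bracket (P r t) (M r t) - trace_form (M r t) (P r t) *\<^sub>R lie_bracket (P r t) (X r t)
       - lie_bracket (A r t) (X r t))) (at t within dom r))"
proof -
  have sub: "dom r \<subseteq> {0..T r}" for r by (auto simp: dom_def)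
  show "evt (\<lambda>r t. (X r has_vector_derivative lie_bracket (P r t) (X r t)) (at t within dom r))"
    using sol by eventually_elim
      (use sub in \<open>auto simp: reinhardt_solution_def P_def intro: has_vector_derivative_within_subset\<close>)
  show "evt (\<lambda>r t. (L r has_vector_derivative lie_bracket (L r t) (X r t)) (at t within dom r))"
    using sol by eventually_elim
      (use sub in \<open>auto simp: reinhardt_solution_def intro: has_vector_derivative_within_subset\<close>)
  show "evt (\<lambda>r t. (M r has_vector_derivative
     (lie_bracket (P r t) (M r t) - trace_form (M r t) (P r t) *\<^sub>R lie_bracket (P r t) (X r t)
       - lie_bracket (A r t) (X r t))) (at t within dom r))"
    using sol by eventually_elim
      (use sub in \<open>auto simp: reinhardt_solution_def P_def A_def intro: has_vector_derivative_within_subset\<close>)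
qed

section \<open>Expansion of X to first order\<close>

lemma init_X: "bnd 2 (\<lambda>r t. X r 0 - J_mat - r *\<^sub>R S0)"
proof -
  have d: "bnd 1 (\<lambda>r t. (1 + r * x) - 1)" using bnd_rt[of 1 0 x] by (simp add: mult.commute)
  have "bnd 0 (\<lambda>r t. (1 / (1 + r * x) - 1 / 1) + 1)"
    by (intro bnd_add bnd_const bnd_mono[OF bnd_inverse(1)[OF d]]) auto
  then have "bnd (2 + 0 + 0) (\<lambda>r t. (- (1 + x\<^sup>2) * r\<^sup>2 * t ^ 0) * ((1 / (1 + r * x) - 1 / 1) + 1))"
    by (intro bnd_mult bnd_rt)
  then have "bnd 2 (\<lambda>r t. mk_mat 0 ((- (1 + x\<^sup>2) * r\<^sup>2) * (1 / (1 + r * x))) 0 0)"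
    using bnd_mono[OF bnd_const[of 0]] bnd_rt[of 2 0 0] by (intro bnd_mk_mat) simp_all
  moreover have "evt (\<lambda>r t. X r 0 - J_mat - r *\<^sub>R S0
      = mk_mat 0 ((- (1 + x\<^sup>2) * r\<^sup>2) * (1 / (1 + r * x))) 0 0)"
    using init
  proof eventually_elim
    case (elim r)
    then have nz: "1 + r * x \<noteq> 0"
      and X0: "X r 0 = mk_mat r (- ((1 + r\<^sup>2) / (1 + r * x))) (1 + r * x) (- r)"
      by (auto simp: represents_def)
    \<comment> \<open>Only the upper right entry carries an error, and it has this closed
      form.\<close>
    have "- ((1 + r\<^sup>2) / (1 + r * x)) + 1 - r * x = (- (1 + x\<^sup>2) * r\<^sup>2) * (1 / (1 + r * x))"
      using nz by (simp add: field_simps power2_eq_square)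
    then show ?case by (simp add: X0 S0_def J_mat_def mat22_simps)
  qed
  ultimately show ?thesis by (rule bnd_cong)
qed

text \<open>\<open>P\<close> is a multiple of \<open>Z\<close>, so invariance of the trace form
  makes \<open>\<langle>Z, X\<rangle>\<close> constant along the flow. The denominator of
  \<open>P\<close> is thus controlled by the initial value, before anything is known of
  \<open>X\<close> at later times.\<close>

lemma Z2_X_const:
  "evt (\<lambda>r t. trace_form (Z_ctrl (e_vec 2)) (X r t) = trace_form (Z_ctrl (e_vec 2)) (X r 0))"
  using derivs(1)
proof eventually_elim
  case (elim r)
  show ?case
  proof
    fix t assume t: "t \<in> dom r"
    let ?f = "\<lambda>s. trace_form (Z_ctrl (e_vec 2)) (X r s)"
    have "norm (?f t - ?f 0) \<le> 0 * t"
    proof (rule increment_bound[where f' = "\<lambda>s. 0"])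
      fix s assume "s \<in> {0..min (T r) (K * r)}"
      then have "(X r has_vector_derivative lie_bracket (P r s) (X r s)) (at s within {0..min (T r) (K * r)})"
        using elim by (simp add: dom_def)
      from bounded_linear.has_vector_derivative[OF trace_form.bounded_linear_right this, of "Z_ctrl (e_vec 2)"]
      show "(?f has_vector_derivative 0) (at s within {0..min (T r) (K * r)})"
        by (simp add: P_def P_ctrl_def trace_form_Z_bracket)
    qed (use t in \<open>auto simp: dom_def\<close>)
    then show "?f t = ?f 0" by simp
  qed
qed

lemma X0_near_J: "bnd 1 (\<lambda>r t. X r 0 - J_mat)"
proof -
  have "bnd 1 (\<lambda>r t. (X r 0 - J_mat - r *\<^sub>R S0) + r *\<^sub>R S0)"
    using bnd_scaleR[OF bnd_r bnd_const[of S0]] bnd_mono[OF init_X, of 1] by (intro bnd_add) auto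
  then show ?thesis by simp
qed

lemma P_near: "bnd 1 (\<lambda>r t. P r t - P0)"
proof -
  let ?Z = "Z_ctrl (e_vec 2)"
  have "trace_form ?Z J_mat = - (2 / 3)" by (simp add: Z_ctrl_2 J_mat_def trace_form_eq)
  then have "bnd 1 (\<lambda>r t. trace_form ?Z (X r 0) - (- (2 / 3)))"
    using bnd_trace_form[OF bnd_const[of ?Z] X0_near_J] by (simp add: trace_form.diff_right)
  then have "bnd 1 (\<lambda>r t. trace_form ?Z (X r t) - (- (2 / 3)))"
    by (rule bnd_cong) (use Z2_X_const in \<open>auto elim: eventually_mono\<close>)
  from bnd_inverse(1)[OF this] have "bnd 1 (\<lambda>r t. 1 / trace_form ?Z (X r t) - 1 / (- (2 / 3)))" by simp
  from bnd_scaleR[OF this bnd_const[of ?Z]]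
  have "bnd 1 (\<lambda>r t. (1 / trace_form ?Z (X r t) - 1 / (- (2 / 3))) *\<^sub>R ?Z)" by simp
  moreover have "(1 / trace_form ?Z (X r t) - 1 / (- (2 / 3))) *\<^sub>R ?Z = P r t - P0" for r t
  proof -
    have eq: "P0 = (1 / (- (2 / 3))) *\<^sub>R ?Z"
      by (simp add: P0_def Z_ctrl_2 mat22_simps field_simps)
    show ?thesis by (simp only: P_def P_ctrl_def eq scaleR_diff_left)
  qed
  ultimately show ?thesis by simp
qed

lemma bnd_plus_const: "bnd 1 (\<lambda>r t. f r t - c) \<Longrightarrow> bnd 0 f"
  using bnd_add[OF bnd_mono[of 1 "\<lambda>r t. f r t - c" 0] bnd_const[of c]] by simp

lemma P_bnd: "bnd 0 P" using P_near by (rule bnd_plus_const)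

lemma bnd_norm: "bnd n f \<Longrightarrow> bnd n (\<lambda>r t. norm (f r t))"
  by (erule bnd_dominated) simp

lemma lie_bracket_norm:
  obtains B where "B > 0" "\<And>Y Z. norm (lie_bracket Y Z) \<le> B * norm Y * norm Z"
    "\<And>Y Z. \<bar>trace_form Y Z\<bar> \<le> B * norm Y * norm Z"
proof -
  obtain B where B: "B > 0" "\<And>Y Z. norm (lie_bracket Y Z) \<le> norm Y * norm Z * B"
    using lie_bracket.pos_bounded by blast
  obtain B' where B': "B' > 0" "\<And>Y Z. norm (trace_form Y Z) \<le> norm Y * norm Z * B'"
    using trace_form.pos_bounded by blast
  have le: "norm Y * norm Z * B \<le> max B B' * norm Y * norm Z" "norm Y * norm Z * B' \<le> max B B' * norm Y * norm Z"
    for Y Z :: mat22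
    using mult_left_mono[of B "max B B'" "norm Y * norm Z"] mult_left_mono[of B' "max B B'" "norm Y * norm Z"]
    by (auto simp: mult_ac)
  show ?thesis
  proof (rule that)
    show "0 < max B B'" using B(1) by simp
  qed (fact order_trans[OF B(2) le(1)], fact order_trans[OF B'(2)[unfolded real_norm_def] le(2)])
qed

text \<open>The first of three passes: boundedness by the Gronwall estimate, then
  \<open>X - J = O(r)\<close>, then the leading term \<open>X1\<close>, each bound being fed into
  the derivative for the next.\<close>

lemma X_bnd: "bnd 0 X"
proof -
  obtain B where B: "B > 0" "\<And>Y Z. norm (lie_bracket Y Z) \<le> B * norm Y * norm Z"
    using lie_bracket_norm by metis
  show ?thesis
  proof (rule bnd_linear_system[OF derivs(1), where p = "\<lambda>r t. B * norm (P r t)" and q = "\<lambda>r t. 0" and n = 0])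
    show "bnd 0 (\<lambda>r t. B * norm (P r t))" by (intro bnd_cmult bnd_norm P_bnd)
    show "bnd 0 (\<lambda>r t. X r 0)" using X0_near_J by (rule bnd_plus_const)
  qed (use B in \<open>auto simp: bnd_const\<close>)
qed

lemma X_near_J: "bnd 1 (\<lambda>r t. X r t - J_mat)"
proof -
  have "bnd (Suc 0) (\<lambda>r t. X r t - J_mat)"
  proof (rule bnd_integrate)
    show "evt (\<lambda>r t. ((\<lambda>t. X r t - J_mat) has_vector_derivative lie_bracket (P r t) (X r t)) (at t within dom r))"
      using derivs(1) by eventually_elim (auto intro!: derivative_eq_intros)
    show "bnd 0 (\<lambda>r t. lie_bracket (P r t) (X r t))" using bnd_lie_bracket[OF P_bnd X_bnd] by simp
    show "bnd (Suc 0) (\<lambda>r t. X r 0 - J_mat)" using X0_near_J by simp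
  qed
  then show ?thesis by simp
qed

lemma P0_J: "lie_bracket P0 J_mat = S1"
  by (simp add: P0_def S1_def J_mat_def mat22_simps)

definition X1 where "X1 r t = r *\<^sub>R S0 + t *\<^sub>R S1"

lemma X_asymptotics: "bnd 2 (\<lambda>r t. X r t - J_mat - X1 r t)"
proof -
  have "bnd (Suc 1) (\<lambda>r t. X r t - J_mat - X1 r t)"
  proof (rule bnd_integrate)
    show "evt (\<lambda>r t. ((\<lambda>t. X r t - J_mat - X1 r t) has_vector_derivative lie_bracket (P r t) (X r t) - S1) (at t within dom r))"
      using derivs(1) by eventually_elim (auto simp: X1_def intro!: derivative_eq_intros)
    have "bnd 1 (\<lambda>r t. lie_bracket (P r t - P0) (X r t) + lie_bracket P0 (X r t - J_mat))"
      using bnd_lie_bracket[OF P_near X_bnd] bnd_lie_bracket[OF bnd_const X_near_J, of P0] by (intro bnd_add) auto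
    then show "bnd 1 (\<lambda>r t. lie_bracket (P r t) (X r t) - S1)"
      by (simp add: lie_bracket.diff_left lie_bracket.diff_right P0_J)
    show "bnd (Suc 1) (\<lambda>r t. X r 0 - J_mat - X1 r 0)"
      using init_X by (simp add: X1_def numeral_2_eq_2)
  qed
  then show ?thesis by (simp add: numeral_2_eq_2)
qed


section \<open>Expansion of Lambda_1 + 3/2 J to second order\<close>

lemma init_A: "bnd 4 (\<lambda>r t. A r 0 - r\<^sup>2 *\<^sub>R W0)"
proof -
  have "bnd 1 (\<lambda>r t. (- (3/2) + r\<^sup>2 * m) - (- (3/2)))"
    using bnd_mono[OF bnd_rt[of 2 0 m], of 1] by (simp add: mult.commute)
  note inv = bnd_inverse[OF this, simplified]
  have "bnd 0 (\<lambda>r t. 1 / (- (3/2) + r\<^sup>2 * m))"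
    using bnd_plus_const[of "\<lambda>r t. 1 / (- (3/2) + r\<^sup>2 * m)" "- (2/3)"] inv(1) by simp
  then have "bnd (4 + 0 + 0) (\<lambda>r t. (- (l\<^sup>2 + m\<^sup>2) * r ^ 4 * t ^ 0) * (1 / (- (3/2) + r\<^sup>2 * m)))"
    by (intro bnd_mult bnd_rt)
  then have "bnd 4 (\<lambda>r t. mk_mat 0 ((- (l\<^sup>2 + m\<^sup>2) * r ^ 4) * (1 / (- (3/2) + r\<^sup>2 * m))) 0 0)"
    using bnd_rt[of 4 0 0] by (intro bnd_mk_mat) simp_all
  moreover have "evt (\<lambda>r t. A r 0 - r\<^sup>2 *\<^sub>R W0
      = mk_mat 0 ((- (l\<^sup>2 + m\<^sup>2) * r ^ 4) * (1 / (- (3/2) + r\<^sup>2 * m))) 0 0)"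
    using init inv(2) zero_in_dom
  proof eventually_elim
    case (elim r)
    define w where "w = - (3/2) + r\<^sup>2 * m"
    have w: "w \<noteq> 0" using elim(2,3) by (auto simp: w_def)
    from elim(1) have L0: "L r 0 $ 1 $ 1 = r\<^sup>2 * l" "L r 0 $ 2 $ 1 = w" "trace (L r 0) = 0" "det (L r 0) = 9/4"
      by (auto simp: represents_def in_sl2_def w_def)
    then have L22: "L r 0 $ 2 $ 2 = - (r\<^sup>2 * l)" by (simp add: trace_22)
    have "L r 0 $ 1 $ 2 * w = - (r ^ 4 * l\<^sup>2) - 9/4"
      using L0 by (simp add: det_2 L22 power2_eq_square power4_eq_xxxx algebra_simps)
    then have "L r 0 $ 1 $ 2 = (- (r ^ 4 * l\<^sup>2) - 9/4) / w" using w by (simp add: eq_divide_eq)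
    \<comment> \<open>The determinant condition has fixed the upper right entry, and everything
      below order 4 cancels against the symmetric choice of \<open>W0\<close>. The order matters
      later, because \<open>\<langle>A, X\<rangle>\<close> starts at order 3.\<close>
    moreover have "(- (r ^ 4 * l\<^sup>2) - 9/4) / w - 3/2 - r\<^sup>2 * m = (- (l\<^sup>2 + m\<^sup>2) * r ^ 4) * (1 / w)"
    proof -
      have "- (r ^ 4 * l\<^sup>2) - 9/4 - (3/2 + r\<^sup>2 * m) * w = - (l\<^sup>2 + m\<^sup>2) * r ^ 4"
        by (simp add: w_def power2_eq_square power4_eq_xxxx algebra_simps)
      then show ?thesis using w by (simp add: field_simps)
    qed
    ultimately show ?case
      using L0 L22 by (simp add: A_def W0_def J_mat_def mat22_simps w_def)
  qed
  ultimately show ?thesis by (rule bnd_cong)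
qed

lemma derivs_A:
  "evt (\<lambda>r t. (A r has_vector_derivative lie_bracket (L r t) (X r t)) (at t within dom r))"
  using derivs(2) by eventually_elim (auto simp: A_def[abs_def] intro!: derivative_eq_intros)

lemma A0_bnd: "bnd 2 (\<lambda>r t. A r 0)"
proof -
  have "bnd 2 (\<lambda>r t. (A r 0 - r\<^sup>2 *\<^sub>R W0) + (1 * r ^ 2 * t ^ 0) *\<^sub>R W0)"
    using bnd_mono[OF init_A, of 2] bnd_scaleR[OF bnd_rt bnd_const, of 2 0 1 W0]
    by (intro bnd_add) auto
  then show ?thesis by simp
qed

lemma L_eq: "L r t = A r t - (3/2) *\<^sub>R J_mat"
  by (simp add: A_def)

lemma L_bnd: "bnd 0 L"
proof -
  obtain B where B: "B > 0" "\<And>Y Z. norm (lie_bracket Y Z) \<le> B * norm Y * norm Z"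
    using lie_bracket_norm by metis
  show ?thesis
  proof (rule bnd_linear_system[OF derivs(2), where p = "\<lambda>r t. B * norm (X r t)" and q = "\<lambda>r t. 0" and n = 0])
    show "bnd 0 (\<lambda>r t. B * norm (X r t))" by (intro bnd_cmult bnd_norm X_bnd)
    have "bnd 0 (\<lambda>r t. A r 0)" by (rule bnd_mono[OF A0_bnd]) simp
    from bnd_diff[OF this bnd_const[of "(3/2) *\<^sub>R J_mat"]]
    show "bnd 0 (\<lambda>r t. L r 0)" by (simp add: A_def)
    show "evt (\<lambda>r t. norm (lie_bracket (L r t) (X r t)) \<le> B * norm (X r t) * norm (L r t) + 0)"
      using B(2)[of "L _ _" "X _ _"] by (auto simp: mult_ac)
  qed (auto simp: bnd_const)
qed

text \<open>Substituting \<open>L = A - (3/2) J\<close> and using \<open>[J, J] = 0\<close> shows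
  that the derivative of \<open>A\<close> is small, which the form \<open>[L, X]\<close>
  hides.\<close>

lemma bracket_L_X: "lie_bracket (L r t) (X r t)
    = lie_bracket (A r t) (X r t) - (3/2) *\<^sub>R lie_bracket J_mat (X r t - J_mat)"
  by (simp add: L_eq lie_bracket.diff_left lie_bracket.diff_right lie_bracket.scaleR_left)
    (simp add: lie_bracket_def)

lemma A_bnd1: "bnd 1 A"
proof -
  have "bnd (Suc 0) A"
  proof (rule bnd_integrate[OF derivs_A])
    show "bnd 0 (\<lambda>r t. lie_bracket (L r t) (X r t))" using bnd_lie_bracket[OF L_bnd X_bnd] by simp
    show "bnd (Suc 0) (\<lambda>r t. A r 0)" using bnd_mono[OF A0_bnd, of 1] by simp
  qed
  then show ?thesis by simp
qed

lemma A_bnd: "bnd 2 A"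
proof -
  have "bnd (Suc 1) A"
  proof (rule bnd_integrate[OF derivs_A])
    have "bnd 1 (\<lambda>r t. lie_bracket (A r t) (X r t) - (3/2) *\<^sub>R lie_bracket J_mat (X r t - J_mat))"
      using bnd_lie_bracket[OF A_bnd1 X_bnd] bnd_lie_bracket[OF bnd_const X_near_J, of J_mat]
      by (intro bnd_diff bnd_cscaleR) auto
    then show "bnd 1 (\<lambda>r t. lie_bracket (L r t) (X r t))" by (simp add: bracket_L_X)
    show "bnd (Suc 1) (\<lambda>r t. A r 0)" using A0_bnd by (simp add: numeral_2_eq_2)
  qed
  then show ?thesis by (simp add: numeral_2_eq_2)
qed

text \<open>The integral of \<open>- (3/2) [J, X1]\<close> from the initial value
  \<open>r\<^sup>2 W0\<close>. The other term \<open>[A, X]\<close> of the derivative is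
  \<open>O(r^2)\<close> and enters only the error.\<close>

definition A1 where
  "A1 r t = r\<^sup>2 *\<^sub>R W0 - (3/2) *\<^sub>R ((r * t) *\<^sub>R lie_bracket J_mat S0 + (t\<^sup>2 / 2) *\<^sub>R lie_bracket J_mat S1)"

lemma A_asymptotics: "bnd 3 (\<lambda>r t. A r t - A1 r t)"
proof -
  have "bnd (Suc 2) (\<lambda>r t. A r t - A1 r t)"
  proof (rule bnd_integrate)
    show "evt (\<lambda>r t. ((\<lambda>t. A r t - A1 r t) has_vector_derivative
        lie_bracket (L r t) (X r t) + (3/2) *\<^sub>R lie_bracket J_mat (X1 r t)) (at t within dom r))"
      using derivs_A
    proof eventually_elim
      case (elim r)
      show ?case
      proof
        fix t assume t: "t \<in> dom r"
        have "(A1 r has_vector_derivative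
            0 - (3/2) *\<^sub>R (r *\<^sub>R lie_bracket J_mat S0 + t *\<^sub>R lie_bracket J_mat S1)) (at t within dom r)"
          unfolding A1_def by (auto intro!: derivative_eq_intros has_vector_derivative_scaleR simp: has_real_derivative_iff_has_vector_derivative[symmetric])
        moreover have "(3/2) *\<^sub>R lie_bracket J_mat (X1 r t)
            = (3/2) *\<^sub>R (r *\<^sub>R lie_bracket J_mat S0 + t *\<^sub>R lie_bracket J_mat S1)"
          by (simp add: X1_def lie_bracket.add_right lie_bracket.scaleR_right)
        ultimately show "((\<lambda>t. A r t - A1 r t) has_vector_derivative
            lie_bracket (L r t) (X r t) + (3/2) *\<^sub>R lie_bracket J_mat (X1 r t)) (at t within dom r)"
          using has_vector_derivative_diff[OF elim[rule_format, OF t]] by fastforce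
      qed
    qed
    have "bnd 2 (\<lambda>r t. lie_bracket (A r t) (X r t))"
      using bnd_lie_bracket[OF A_bnd X_bnd] by simp
    moreover have "bnd 2 (\<lambda>r t. lie_bracket J_mat (X r t - J_mat - X1 r t))"
      using bnd_lie_bracket[OF bnd_const X_asymptotics, of J_mat] by (simp add: numeral_2_eq_2)
    ultimately have "bnd 2 (\<lambda>r t. lie_bracket (A r t) (X r t) - (3/2) *\<^sub>R lie_bracket J_mat (X r t - J_mat - X1 r t))"
      by (intro bnd_diff bnd_cscaleR)
    then show "bnd 2 (\<lambda>r t. lie_bracket (L r t) (X r t) + (3/2) *\<^sub>R lie_bracket J_mat (X1 r t))"
      by (simp add: bracket_L_X lie_bracket.diff_right lie_bracket.add_right algebra_simps)
    show "bnd (Suc 2) (\<lambda>r t. A r 0 - A1 r 0)"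
      using bnd_mono[OF init_A, of 3] by (simp add: A1_def numeral_3_eq_3)
  qed
  then show ?thesis by (simp add: numeral_3_eq_3)
qed

section \<open>Initial value and expansion of Lambda_R to third order\<close>

lemma init_h: "bnd 4 (\<lambda>r t. trace_form (A r 0) (X r 0) - 2 * (l + m * x) * r ^ 3)"
proof -
  \<comment> \<open>\<open>W0\<close> is orthogonal to \<open>J\<close>, so the term of order 2
    vanishes; this is why \<open>\<Lambda>\<^sub>R\<close> starts only at order 3.\<close>
  have WJ: "trace_form W0 J_mat = 0" "trace_form W0 S0 = 2 * (l + m * x)"
    by (simp_all add: W0_def J_mat_def S0_def trace_form_eq algebra_simps)
  have "bnd 4 (\<lambda>r t. trace_form (A r 0 - r\<^sup>2 *\<^sub>R W0) (X r 0)
      + (1 * r ^ 2 * t ^ 0) * trace_form W0 (X r 0 - J_mat - r *\<^sub>R S0))"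
  proof (rule bnd_add)
    show "bnd 4 (\<lambda>r t. trace_form (A r 0 - r\<^sup>2 *\<^sub>R W0) (X r 0))"
      using bnd_trace_form[OF init_A bnd_initial[OF X_bnd]] by simp
    show "bnd 4 (\<lambda>r t. (1 * r ^ 2 * t ^ 0) * trace_form W0 (X r 0 - J_mat - r *\<^sub>R S0))"
      using bnd_mult[OF bnd_rt[of 2 0 1] bnd_trace_form[OF bnd_const[of W0] init_X]] by simp
  qed
  moreover have "trace_form (A r 0 - r\<^sup>2 *\<^sub>R W0) (X r 0) + (1 * r ^ 2 * t ^ 0) * trace_form W0 (X r 0 - J_mat - r *\<^sub>R S0)
      = trace_form (A r 0) (X r 0) - 2 * (l + m * x) * r ^ 3" for r t
    by (simp add: trace_form.diff_left trace_form.diff_right trace_form.add_right trace_form.scaleR_left trace_form.scaleR_right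
        WJ power2_eq_square power3_eq_cube algebra_simps)
  ultimately show ?thesis by simp
qed

text \<open>Let \<open>h = \<langle>A, X\<rangle>\<close>. The Hamiltonian and switching conditions
  say that \<open>M\<close> and \<open>h X\<close> pair equally with the control matrices 2 and 3,
  and these pairings determine every entry but the upper right one. So \<open>M\<close> agrees with
  \<open>h X\<close> outside that entry, which \<open>\<langle>X, M\<rangle> = 0\<close> then
  fixes.\<close>

lemma init_M_eq:
  "\<forall>\<^sub>F r in at_right 0. M r 0 = trace_form (A r 0) (X r 0) *\<^sub>R
     mk_mat r ((1 - r\<^sup>2) * (1 / (1 + r * x))) (1 + r * x) (- r)"
  using init
proof eventually_elim
  case (elim r)
  define y where "y = 1 + r * x"
  define h where "h = trace_form (A r 0) (X r 0)"
  from elim have y: "y \<noteq> 0" and X0: "X r 0 = mk_mat r (- ((1 + r\<^sup>2) / y)) y (- r)"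
    and dn: "denominators_nonzero (X r 0)"
    and M0: "in_sl2 (M r 0)" "trace_form (X r 0) (M r 0) = 0"
      "hamiltonian (Z_ctrl (e_vec 2)) (X r 0) (L r 0) (M r 0) = 0"
      "switching_function 2 3 (X r 0) (M r 0) = 0"
    by (auto simp: represents_def y_def)
  define c2 where "c2 = trace_form (Z_ctrl (e_vec 2)) (X r 0)"
  define c3 where "c3 = trace_form (Z_ctrl (e_vec 3)) (X r 0)"
  have c: "c2 \<noteq> 0" "c3 \<noteq> 0" using dn by (auto simp: denominators_nonzero_def c2_def c3_def)
  have sym: "trace_form Y Z = trace_form Z Y" for Y Z by (simp add: trace_form_eq algebra_simps)
  have "trace_form (M r 0) (Z_ctrl (e_vec 2)) / c2 = h"
    using M0(3) by (simp add: hamiltonian_def h_def A_def c2_def sym[of "X r 0" "Z_ctrl _"])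
  then have e2: "trace_form (M r 0) (Z_ctrl (e_vec 2)) = h * c2" using c by (simp add: field_simps)
  have "trace_form (M r 0) (Z_ctrl (e_vec 3)) / c3 = trace_form (M r 0) (Z_ctrl (e_vec 2)) / c2"
    using M0(4) by (simp add: switching_function_def P_ctrl_def trace_form.diff_right trace_form.scaleR_right c2_def c3_def)
  then have e3: "trace_form (M r 0) (Z_ctrl (e_vec 3)) = h * c3" using c e2 by (simp add: field_simps)
  define p where "p = M r 0 $ 1 $ 1"
  have M22: "M r 0 $ 2 $ 2 = - p" using M0(1) by (simp add: in_sl2_def trace_22 p_def)
  have E2: "2 / sqrt 3 * p - 2/3 * M r 0 $ 2 $ 1 = h * (2 / sqrt 3 * r - 2/3 * y)"
    using e2 by (simp add: c2_def Z_ctrl_2 X0 trace_form_eq M22 p_def algebra_simps)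
  have E3: "- (2 / sqrt 3) * p - 2/3 * M r 0 $ 2 $ 1 = h * (- (2 / sqrt 3) * r - 2/3 * y)"
    using e3 by (simp add: c3_def Z_ctrl_3 X0 trace_form_eq M22 p_def algebra_simps)
  have M21: "M r 0 $ 2 $ 1 = h * y" using E2 E3 by (simp add: algebra_simps)
  have "2 / sqrt 3 * p = 2 / sqrt 3 * (h * r)" using E2 M21 by (simp add: algebra_simps)
  then have p: "p = h * r" by simp
  have "r * p + - ((1 + r\<^sup>2) / y) * M r 0 $ 2 $ 1 + (y * M r 0 $ 1 $ 2 + r * p) = 0"
    using M0(2) by (simp add: X0 trace_form_eq M22 p_def)
  moreover have "- ((1 + r\<^sup>2) / y) * M r 0 $ 2 $ 1 = - ((1 + r\<^sup>2) * h)" using y by (simp add: M21)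
  ultimately have "y * M r 0 $ 1 $ 2 = h * (1 - r\<^sup>2)"
    by (simp add: p power2_eq_square algebra_simps)
  then have "M r 0 $ 1 $ 2 = h * ((1 - r\<^sup>2) * (1 / y))" using y by (simp add: field_simps)
  then show ?case
    using p M21 M22 by (simp add: mat22_eq_iff p_def flip: h_def y_def)
qed

lemma init_M: "bnd 4 (\<lambda>r t. M r 0 - r ^ 3 *\<^sub>R Y0)"
proof -
  define N where "N r = mk_mat r ((1 - r\<^sup>2) * (1 / (1 + r * x))) (1 + r * x) (- r)" for r
  define N0 where "N0 = mk_mat 0 1 1 0"
  define h where "h r = trace_form (A r 0) (X r 0)" for r
  have d: "bnd 1 (\<lambda>r t. (1 + r * x) - 1)" using bnd_rt[of 1 0 x] by (simp add: mult.commute)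
  have i: "bnd 1 (\<lambda>r t. 1 / (1 + r * x) - 1)" using bnd_inverse(1)[OF d] by simp
  have r2: "bnd 1 (\<lambda>r t. r\<^sup>2)" using bnd_mono[OF bnd_rt[of 2 0 1], of 1] by simp
  have "bnd 1 (\<lambda>r t. (1 / (1 + r * x) - 1) - r\<^sup>2 * (1 / (1 + r * x)))"
    using bnd_mult[OF r2 bnd_plus_const[OF i]] by (intro bnd_diff i) simp
  then have n12: "bnd 1 (\<lambda>r t. (1 - r\<^sup>2) * (1 / (1 + r * x)) - 1)"
    by (simp add: algebra_simps diff_divide_distrib)
  have "N r - N0 = mk_mat r ((1 - r\<^sup>2) * (1 / (1 + r * x)) - 1) ((1 + r * x) - 1) (- r)" for r
    by (simp add: N_def N0_def mat22_eq_iff)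
  then have N: "bnd 1 (\<lambda>r t. N r - N0)"
    using bnd_mk_mat[OF bnd_r n12 d bnd_minus[OF bnd_r]] by simp
  have h: "bnd 4 (\<lambda>r t. h r - 2 * (l + m * x) * r ^ 3)" using init_h by (simp add: h_def)
  have "bnd 4 (\<lambda>r t. (h r - 2 * (l + m * x) * r ^ 3) *\<^sub>R N r + (2 * (l + m * x) * r ^ 3 * t ^ 0) *\<^sub>R (N r - N0))"
    using bnd_scaleR[OF h bnd_plus_const[OF N]] bnd_scaleR[OF bnd_rt[of 3 0 "2 * (l + m * x)"] N]
    by (intro bnd_add) simp_all
  moreover have "evt (\<lambda>r t. M r 0 - r ^ 3 *\<^sub>R Y0
      = (h r - 2 * (l + m * x) * r ^ 3) *\<^sub>R N r + (2 * (l + m * x) * r ^ 3 * t ^ 0) *\<^sub>R (N r - N0))"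
    using init_M_eq
  proof eventually_elim
    case (elim r)
    have "Y0 = (2 * (l + m * x)) *\<^sub>R N0" by (simp add: Y0_def N0_def mat22_eq_iff)
    moreover have "M r 0 = h r *\<^sub>R N r" using elim unfolding N_def h_def .
    ultimately show ?case by (simp add: algebra_simps)
  qed
  ultimately show ?thesis by (rule bnd_cong)
qed

definition M' where
  "M' r t = lie_bracket (P r t) (M r t) - trace_form (M r t) (P r t) *\<^sub>R lie_bracket (P r t) (X r t)
       - lie_bracket (A r t) (X r t)"

lemma M0_bnd: "bnd 3 (\<lambda>r t. M r 0)"
proof -
  have "bnd 3 (\<lambda>r t. (M r 0 - r ^ 3 *\<^sub>R Y0) + (1 * r ^ 3 * t ^ 0) *\<^sub>R Y0)"
    using bnd_mono[OF init_M, of 3] bnd_scaleR[OF bnd_rt bnd_const, of 3 0 1 Y0]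
    by (intro bnd_add) auto
  then show ?thesis by simp
qed

lemma P_X_bnd: "bnd 0 (\<lambda>r t. lie_bracket (P r t) (X r t))"
  using bnd_lie_bracket[OF P_bnd X_bnd] by simp

lemma A_X_bnd: "bnd 2 (\<lambda>r t. lie_bracket (A r t) (X r t))"
  using bnd_lie_bracket[OF A_bnd X_bnd] by simp

text \<open>The control terms are linear in \<open>M\<close> with bounded coefficients, and the
  forcing \<open>[A, X]\<close> is \<open>O(r^2)\<close>; over a short window it produces only
  \<open>O(r^3)\<close>.\<close>

lemma M_bnd: "bnd 3 M"
proof -
  obtain B where B: "B > 0" "\<And>Y Z. norm (lie_bracket Y Z) \<le> B * norm Y * norm Z"
    "\<And>Y Z. \<bar>trace_form Y Z\<bar> \<le> B * norm Y * norm Z"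
    using lie_bracket_norm by metis
  define p where "p r t = B * norm (P r t) + B * (norm (P r t) * norm (lie_bracket (P r t) (X r t)))" for r t
  show ?thesis
  proof (rule bnd_linear_system[OF derivs(3), where p = p and n = 2 and q = "\<lambda>r t. norm (lie_bracket (A r t) (X r t))"])
    show "bnd 0 p"
      unfolding p_def using bnd_mult[OF bnd_norm[OF P_bnd] bnd_norm[OF P_X_bnd]]
      by (intro bnd_add bnd_cmult bnd_norm P_bnd) simp
    show "bnd 2 (\<lambda>r t. norm (lie_bracket (A r t) (X r t)))" by (intro bnd_norm A_X_bnd)
    show "bnd 3 (\<lambda>r t. M r 0)" by (rule M0_bnd)
    show "evt (\<lambda>r t. norm (lie_bracket (P r t) (M r t)
        - trace_form (M r t) (P r t) *\<^sub>R lie_bracket (P r t) (X r t) - lie_bracket (A r t) (X r t))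
        \<le> p r t * norm (M r t) + norm (lie_bracket (A r t) (X r t)))"
    proof (intro always_eventually allI ballI)
      fix r t
      let ?Q = "lie_bracket (P r t) (X r t)"
      have "norm (trace_form (M r t) (P r t) *\<^sub>R ?Q) \<le> (B * norm (M r t) * norm (P r t)) * norm ?Q"
        using B(3) by (simp add: mult_right_mono)
      moreover have "norm (lie_bracket (P r t) (M r t)) \<le> B * norm (P r t) * norm (M r t)" by (rule B(2))
      ultimately have "norm (lie_bracket (P r t) (M r t)) + norm (trace_form (M r t) (P r t) *\<^sub>R ?Q) \<le> p r t * norm (M r t)"
        by (simp add: p_def algebra_simps)
      then show "norm (lie_bracket (P r t) (M r t)
          - trace_form (M r t) (P r t) *\<^sub>R ?Q - lie_bracket (A r t) (X r t))
          \<le> p r t * norm (M r t) + norm (lie_bracket (A r t) (X r t))"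
        using norm_triangle_ineq4[of "lie_bracket (P r t) (M r t) - trace_form (M r t) (P r t) *\<^sub>R ?Q" "lie_bracket (A r t) (X r t)"]
          norm_triangle_ineq4[of "lie_bracket (P r t) (M r t)" "trace_form (M r t) (P r t) *\<^sub>R ?Q"]
        by linarith
    qed
  qed simp
qed

text \<open>The integral of \<open>- [A1, J]\<close> from the initial value: the coefficients 3/2 of
  \<open>r t\<close> and 3/4 of \<open>t\<^sup>2\<close> there become 3/4 and 1/4. All terms of the
  equation that contain \<open>M\<close> are \<open>O(r^3)\<close> and enter only the error.\<close>

definition M1 where
  "M1 r t = r ^ 3 *\<^sub>R Y0 - (r\<^sup>2 * t) *\<^sub>R lie_bracket W0 J_mat
     + (3/4 * r * t\<^sup>2) *\<^sub>R lie_bracket (lie_bracket J_mat S0) J_mat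
     + (1/4 * t ^ 3) *\<^sub>R lie_bracket (lie_bracket J_mat S1) J_mat"

lemma M_asymptotics: "bnd 4 (\<lambda>r t. M r t - M1 r t)"
proof -
  have "bnd (Suc 3) (\<lambda>r t. M r t - M1 r t)"
  proof (rule bnd_integrate)
    show "evt (\<lambda>r t. ((\<lambda>t. M r t - M1 r t) has_vector_derivative
        M' r t + lie_bracket (A1 r t) J_mat) (at t within dom r))"
      using derivs(3)
    proof eventually_elim
      case (elim r)
      show ?case
      proof
        fix t assume t: "t \<in> dom r"
        define D where "D = 0 - r\<^sup>2 *\<^sub>R lie_bracket W0 J_mat
            + (3/4 * r * (2 * t)) *\<^sub>R lie_bracket (lie_bracket J_mat S0) J_mat
            + (1/4 * (3 * t\<^sup>2)) *\<^sub>R lie_bracket (lie_bracket J_mat S1) J_mat"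
        have "(M1 r has_vector_derivative D) (at t within dom r)"
          unfolding M1_def D_def by (auto intro!: derivative_eq_intros has_vector_derivative_scaleR simp: has_real_derivative_iff_has_vector_derivative[symmetric])
        from has_vector_derivative_diff[OF elim[rule_format, OF t] this]
        have "((\<lambda>t. M r t - M1 r t) has_vector_derivative M' r t - D) (at t within dom r)"
          unfolding M'_def .
        moreover have "lie_bracket (A1 r t) J_mat = - D"
          by (simp add: D_def A1_def lie_bracket.diff_left lie_bracket.add_left lie_bracket.scaleR_left algebra_simps)
        ultimately show "((\<lambda>t. M r t - M1 r t) has_vector_derivative
            M' r t + lie_bracket (A1 r t) J_mat) (at t within dom r)"
          by simp
      qed
    qed
    have PM: "bnd 3 (\<lambda>r t. lie_bracket (P r t) (M r t))" using bnd_lie_bracket[OF P_bnd M_bnd] by simp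
    have MPX: "bnd 3 (\<lambda>r t. trace_form (M r t) (P r t) *\<^sub>R lie_bracket (P r t) (X r t))"
      using bnd_scaleR[OF bnd_trace_form[OF M_bnd P_bnd] P_X_bnd] by simp
    have A1: "bnd 2 A1"
      using bnd_diff[OF A_bnd bnd_mono[OF A_asymptotics, of 2]] by simp
    have "bnd 3 (\<lambda>r t. lie_bracket (A r t - A1 r t) (X r t))" "bnd 3 (\<lambda>r t. lie_bracket (A1 r t) (X r t - J_mat))"
      using bnd_lie_bracket[OF A_asymptotics X_bnd] bnd_lie_bracket[OF A1 X_near_J] by simp_all
    with PM MPX have "bnd 3 (\<lambda>r t. lie_bracket (P r t) (M r t)
        - trace_form (M r t) (P r t) *\<^sub>R lie_bracket (P r t) (X r t)
        - lie_bracket (A r t - A1 r t) (X r t) - lie_bracket (A1 r t) (X r t - J_mat))"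
      by (intro bnd_diff)
    then show "bnd 3 (\<lambda>r t. M' r t + lie_bracket (A1 r t) J_mat)"
      by (simp add: M'_def lie_bracket.diff_left lie_bracket.diff_right algebra_simps)
    show "bnd (Suc 3) (\<lambda>r t. M r 0 - M1 r 0)"
      using init_M by (simp add: M1_def)
  qed
  then show ?thesis by simp
qed

section \<open>The switching function\<close>

lemma P_ctrl_near:
  assumes "trace_form (Z_ctrl (e_vec j)) J_mat = - (2/3)"
  shows "bnd 1 (\<lambda>r t. P_ctrl (e_vec j) (X r t) - (- (3/2)) *\<^sub>R Z_ctrl (e_vec j))"
proof -
  let ?Z = "Z_ctrl (e_vec j)"
  have "bnd 1 (\<lambda>r t. trace_form ?Z (X r t) - (- (2 / 3)))"
    using bnd_trace_form[OF bnd_const[of ?Z] X_near_J] assms by (simp add: trace_form.diff_right)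
  from bnd_inverse(1)[OF this] have "bnd 1 (\<lambda>r t. 1 / trace_form ?Z (X r t) - (- (3/2)))" by simp
  from bnd_scaleR[OF this bnd_const[of ?Z]] show ?thesis
    unfolding P_ctrl_def by (simp only: scaleR_diff_left) simp
qed

text \<open>As \<open>M = O(r^3)\<close>, the two quotients in the switching function may be
  replaced by their values at \<open>J\<close> at the cost of \<open>O(r^4)\<close>. The plus sign
  in front of the polynomial records that it is minus the leading part.\<close>

lemma switching_asymptotics:
  "bnd 4 (\<lambda>r t. switching_function 2 1 (X r t) (M r t)
     + (6 * (l + m * x) * r ^ 3 + (6 * l + 2 * sqrt 3 * m) * r\<^sup>2 * t + (9 * x - 3 * sqrt 3) * r * t\<^sup>2 + 2 * sqrt 3 * t ^ 3))"
proof -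
  define E where "E = (- (3/2)) *\<^sub>R Z_ctrl (e_vec 1) - (- (3/2)) *\<^sub>R Z_ctrl (e_vec 2)"
  have "bnd 1 (\<lambda>r t. (P_ctrl (e_vec 1) (X r t) - (- (3/2)) *\<^sub>R Z_ctrl (e_vec 1))
      - (P_ctrl (e_vec 2) (X r t) - (- (3/2)) *\<^sub>R Z_ctrl (e_vec 2)))"
    by (intro bnd_diff P_ctrl_near) (simp_all add: Z_ctrl_1 Z_ctrl_2 J_mat_def trace_form_eq)
  then have "bnd 1 (\<lambda>r t. (P_ctrl (e_vec 1) (X r t) - P_ctrl (e_vec 2) (X r t)) - E)"
    by (simp add: E_def algebra_simps)
  from bnd_trace_form[OF M_bnd this] bnd_trace_form[OF M_asymptotics bnd_const[of E]]
  have "bnd 4 (\<lambda>r t. trace_form (M r t) ((P_ctrl (e_vec 1) (X r t) - P_ctrl (e_vec 2) (X r t)) - E)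
      + trace_form (M r t - M1 r t) E)"
    by (intro bnd_add) simp_all
  moreover have "- trace_form (M1 r t) E = 6 * (l + m * x) * r ^ 3 + (6 * l + 2 * sqrt 3 * m) * r\<^sup>2 * t
      + (9 * x - 3 * sqrt 3) * r * t\<^sup>2 + 2 * sqrt 3 * t ^ 3" for r t
  proof -
    have q: "1 / sqrt 3 = sqrt 3 / 3" by (simp add: field_simps)
    show ?thesis
      unfolding E_def M1_def Z_ctrl_1 Z_ctrl_2 q
      by (simp add: trace_form_eq lie_bracket_nth J_mat_def S0_def S1_def W0_def Y0_def)
        (simp add: field_simps)
  qed
  then have "trace_form (M r t) ((P_ctrl (e_vec 1) (X r t) - P_ctrl (e_vec 2) (X r t)) - E) + trace_form (M r t - M1 r t) E
     = switching_function 2 1 (X r t) (M r t)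
     + (6 * (l + m * x) * r ^ 3 + (6 * l + 2 * sqrt 3 * m) * r\<^sup>2 * t + (9 * x - 3 * sqrt 3) * r * t\<^sup>2 + 2 * sqrt 3 * t ^ 3)" for r t
    by (simp add: switching_function_def trace_form.diff_right trace_form.diff_left)
  ultimately show ?thesis by simp
qed

end

section \<open>The return time and the rotation\<close>

text \<open>Complex numbers as matrices, the imaginary unit being \<open>J\<close>; this reduces the
  matrix exponential in \<open>R_mat\<close> to the complex one.\<close>

definition cmat :: "complex \<Rightarrow> mat22" where
  "cmat z = mk_mat (Re z) (- Im z) (Im z) (Re z)"

lemma bounded_linear_cmat: "bounded_linear cmat"
proof -
  have "linear cmat" by (simp add: linear_iff cmat_def mat22_eq_iff)
  then show ?thesis by (rule linear_conv_bounded_linear[THEN iffD1])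
qed

lemma cmat_mult: "cmat z ** cmat w = cmat (z * w)"
  by (simp add: mat22_eq_iff matmul_nth cmat_def)

lemma R_mat_eq: "R_mat = mk_mat (1/2) (- (sqrt 3 / 2)) (sqrt 3 / 2) (1/2)"
proof -
  define z where "z = \<i> * of_real (pi / 3)"
  have J: "(pi / 3) *\<^sub>R J_mat = cmat z"
    by (simp add: z_def J_mat_def cmat_def mat22_eq_iff)
  have one: "mat 1 = cmat 1" by (simp add: cmat_def mat22_eq_iff mat_def)
  have pow: "((**) (cmat z) ^^ n) (mat 1) = cmat (z ^ n)" for n
    by (induction n) (simp_all add: one cmat_mult)
  have "(\<lambda>n. cmat (z ^ n /\<^sub>R fact n)) sums cmat (exp z)"
    by (rule bounded_linear.sums[OF bounded_linear_cmat exp_converges])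
  moreover have "cmat (z ^ n /\<^sub>R fact n) = (1 / fact n) *\<^sub>R cmat (z ^ n)" for n
    using linear_scale[OF bounded_linear.linear[OF bounded_linear_cmat]] by (simp add: inverse_eq_divide)
  ultimately have "(\<Sum>n. (1 / fact n) *\<^sub>R cmat (z ^ n)) = cmat (exp z)"
    by (simp add: sums_iff)
  moreover have "exp z = Complex (1/2) (sqrt 3 / 2)"
    unfolding z_def cis_conv_exp[symmetric] by (simp add: complex_eq_iff cos_60 sin_60)
  ultimately show ?thesis
    by (simp add: R_mat_def matrix_exp_def J pow) (simp add: cmat_def)
qed

lemma matrix_inv_unique:
  fixes A B :: "real^'n^'n"
  assumes "A ** B = mat 1" "B ** A = mat 1"
  shows "matrix_inv A = B"
proof -
  have "matrix_inv A ** A = mat 1"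
    unfolding matrix_inv_def by (rule someI2[of _ B]) (use assms in auto)
  then have "matrix_inv A ** (A ** B) = B" by (simp add: matrix_mul_assoc)
  then show ?thesis by (simp add: assms)
qed

lemma matrix_inv_R_mat: "matrix_inv R_mat = mk_mat (1/2) (sqrt 3 / 2) (- (sqrt 3 / 2)) (1/2)"
  by (rule matrix_inv_unique) (simp_all add: R_mat_eq mat22_eq_iff matmul_nth mat_def)

lemma rotate_back_eq:
  "rotate_back Y = mk_mat (1/2) (sqrt 3 / 2) (- (sqrt 3 / 2)) (1/2) ** Y ** mk_mat (1/2) (- (sqrt 3 / 2)) (sqrt 3 / 2) (1/2)"
  unfolding rotate_back_def matrix_inv_R_mat unfolding R_mat_eq ..

lemma bounded_linear_rotate_back: "bounded_linear rotate_back"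
proof -
  have "linear rotate_back"
    by (simp add: linear_iff rotate_back_eq mat22_eq_iff matmul_nth algebra_simps)
  then show ?thesis by (rule linear_conv_bounded_linear[THEN iffD1])
qed

lemma rotate_back_J: "rotate_back J_mat = J_mat"
  by (simp add: rotate_back_eq mat22_eq_iff matmul_nth J_mat_def)

text \<open>On traceless symmetric matrices conjugation by a rotation doubles the angle: the pair
  \<open>(p, q)\<close> turns by \<open>- 2 \<pi> / 3\<close>, which explains the
  coefficients.\<close>

lemma rotate_back_symmetric:
  "rotate_back (mk_mat p q q (- p)) $ 1 $ 1 = - p / 2 + sqrt 3 / 2 * q"
  "rotate_back (mk_mat p q q (- p)) $ 2 $ 1 = - q / 2 - sqrt 3 / 2 * p"
  by (simp_all add: rotate_back_eq matmul_nth algebra_simps)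

text \<open>With \<open>l21_flow\<close>, the entries of \<open>A1\<close> at time
  \<open>r * \<tau>\<close> divided by \<open>r\<^sup>2\<close>, that is, the rescaled coordinates
  of \<open>\<Lambda>\<^sub>1\<close> before rotation.\<close>

definition l11_flow :: "real \<Rightarrow> real \<Rightarrow> real \<Rightarrow> real" where
  "l11_flow x l \<tau> = l + 3 * (x * \<tau> + sqrt 3 * \<tau>\<^sup>2 / 2)"

definition l21_flow :: "real \<Rightarrow> real \<Rightarrow> real" where
  "l21_flow m \<tau> = m - 3 * (\<tau> + \<tau>\<^sup>2 / 2)"

text \<open>Three negative coefficients below a positive leading one leave, by Descartes' rule, a
  single positive root. \<open>\<tau> < K\<close> places it strictly inside the window.\<close>

locale reinhardt_return = reinhardt_family T K x l m X L M
  for T :: "real \<Rightarrow> real" and K x l m :: real and X L M :: "real \<Rightarrow> real \<Rightarrow> mat22" +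
  fixes \<tau> :: real
  assumes \<tau>: "0 < \<tau>" "\<tau> < K" "\<sigma> \<tau> = 0"
    and signs: "l + m * x < 0" "6 * l + 2 * sqrt 3 * m < 0" "9 * x - 3 * sqrt 3 < 0"
    and first_zero: "\<forall>\<^sub>F r in at_right 0. 0 < T r \<and> switching_function 2 1 (X r (T r)) (M r (T r)) = 0 \<and>
      (\<forall>t. 0 < t \<and> t < T r \<longrightarrow> switching_function 2 1 (X r t) (M r t) \<noteq> 0)"
begin

text \<open>Eliminating the cubic term between \<open>\<sigma> t\<close> and \<open>\<sigma> \<tau> = 0\<close> leaves terms whose signs
  are all decided by that of \<open>\<tau> - t\<close>.\<close>

lemma \<sigma>_times: "\<sigma> t * \<tau> ^ 3 = (\<tau> - t) * (6 * (l + m * x) * (\<tau>\<^sup>2 + \<tau> * t + t\<^sup>2)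
    + (6 * l + 2 * sqrt 3 * m) * (t * \<tau> * (\<tau> + t)) + (9 * x - 3 * sqrt 3) * (t\<^sup>2 * \<tau>\<^sup>2))"
proof -
  have "\<sigma> t * \<tau> ^ 3 = \<sigma> t * \<tau> ^ 3 - \<sigma> \<tau> * t ^ 3" using \<tau> by simp
  also have "\<dots> = (\<tau> - t) * (6 * (l + m * x) * (\<tau>\<^sup>2 + \<tau> * t + t\<^sup>2)
    + (6 * l + 2 * sqrt 3 * m) * (t * \<tau> * (\<tau> + t)) + (9 * x - 3 * sqrt 3) * (t\<^sup>2 * \<tau>\<^sup>2))"
    unfolding switching_cubic_def by algebra
  finally show ?thesis .
qed

text \<open>A linear lower bound away from the root: an error \<open>O(r)\<close> in the value of
  \<open>\<sigma>\<close> becomes an error \<open>O(r)\<close> in the root, without an inverse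
  function theorem.\<close>

lemma \<sigma>_lower:
  assumes t: "0 \<le> t"
  shows "\<bar>6 * (l + m * x)\<bar> / \<tau> * \<bar>\<tau> - t\<bar> \<le> \<bar>\<sigma> t\<bar>"
    and "\<tau> < t \<Longrightarrow> 0 < \<sigma> t"
proof -
  define E where "E = 6 * (l + m * x) * (\<tau>\<^sup>2 + \<tau> * t + t\<^sup>2)
    + (6 * l + 2 * sqrt 3 * m) * (t * \<tau> * (\<tau> + t)) + (9 * x - 3 * sqrt 3) * (t\<^sup>2 * \<tau>\<^sup>2)"
  have "(6 * l + 2 * sqrt 3 * m) * (t * \<tau> * (\<tau> + t)) \<le> 0"
    by (rule mult_nonpos_nonneg) (use signs \<tau> t in auto)
  moreover have "(9 * x - 3 * sqrt 3) * (t\<^sup>2 * \<tau>\<^sup>2) \<le> 0"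
    by (rule mult_nonpos_nonneg) (use signs \<tau> t in auto)
  moreover have "6 * (l + m * x) * (\<tau>\<^sup>2 + \<tau> * t + t\<^sup>2) \<le> 6 * (l + m * x) * \<tau>\<^sup>2"
    using signs \<tau> t by (intro mult_left_mono_neg) auto
  ultimately have E: "E \<le> 6 * (l + m * x) * \<tau>\<^sup>2" by (simp add: E_def)
  have "6 * (l + m * x) * \<tau>\<^sup>2 < 0" by (rule mult_neg_pos) (use signs \<tau> in auto)
  with E have E0: "E < 0" by simp
  have st: "\<sigma> t * \<tau> ^ 3 = (\<tau> - t) * E" unfolding E_def by (rule \<sigma>_times)
  show "0 < \<sigma> t" if "\<tau> < t"
  proof -
    have "0 < (\<tau> - t) * E" using that E0 by (intro mult_neg_neg) auto
    then show ?thesis using st \<tau> by (metis zero_less_mult_pos2 zero_less_power)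
  qed
  have "\<bar>\<sigma> t\<bar> * \<tau> ^ 3 = \<bar>\<tau> - t\<bar> * \<bar>E\<bar>" using arg_cong[OF st, of abs] \<tau> by (simp add: abs_mult)
  moreover have "\<bar>6 * (l + m * x)\<bar> * \<tau>\<^sup>2 \<le> \<bar>E\<bar>"
    using E E0 signs by (simp add: abs_if algebra_simps)
  ultimately have "\<bar>\<tau> - t\<bar> * (\<bar>6 * (l + m * x)\<bar> * \<tau>\<^sup>2) \<le> \<bar>\<sigma> t\<bar> * \<tau> ^ 3"
    by (simp add: mult_left_mono)
  then have "(\<bar>\<tau> - t\<bar> * \<bar>6 * (l + m * x)\<bar>) * \<tau>\<^sup>2 \<le> (\<bar>\<sigma> t\<bar> * \<tau>) * \<tau>\<^sup>2"
    by (simp add: power2_eq_square power3_eq_cube mult_ac)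
  then have "\<bar>\<tau> - t\<bar> * \<bar>6 * (l + m * x)\<bar> \<le> \<bar>\<sigma> t\<bar> * \<tau>"
    using \<tau> by (simp add: mult_le_cancel_right)
  then show "\<bar>6 * (l + m * x)\<bar> / \<tau> * \<bar>\<tau> - t\<bar> \<le> \<bar>\<sigma> t\<bar>"
    using \<tau> by (simp add: field_simps)
qed

lemma switching_continuous:
  "\<forall>\<^sub>F r in at_right 0. continuous_on (dom r) (\<lambda>t. switching_function 2 1 (X r t) (M r t))"
  using derivs(1) derivs(3) sol
proof eventually_elim
  case (elim r)
  have X: "continuous_on (dom r) (X r)" and M: "continuous_on (dom r) (M r)"
    using elim by (auto simp: continuous_on_eq_continuous_within intro: has_vector_derivative_continuous)
  have nz: "\<forall>t\<in>dom r. trace_form (Z_ctrl (e_vec j)) (X r t) \<noteq> 0" for j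
    using elim(3) by (auto simp: reinhardt_solution_def denominators_nonzero_def dom_def)
  show ?case
    unfolding switching_function_def P_ctrl_def
    by (intro trace_form.continuous_on continuous_intros X M nz)
qed

lemma sigma_scaled:
  assumes "r > 0"
  shows "6 * (l + m * x) * r ^ 3 + (6 * l + 2 * sqrt 3 * m) * r\<^sup>2 * t + (9 * x - 3 * sqrt 3) * r * t\<^sup>2 + 2 * sqrt 3 * t ^ 3
    = r ^ 3 * \<sigma> (t / r)"
  using assms by (simp add: switching_cubic_def field_simps power2_eq_square power3_eq_cube)

text \<open>The switching function is close to \<open>- r ^ 3 * \<sigma> (t / r)\<close>, which is
  positive at \<open>t = 0\<close> and negative at \<open>t = K * r\<close>. A zero in between
  forces the first return into the window, and \<open>\<sigma>_lower\<close> then locates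
  it.\<close>

lemma return_time:
  "\<forall>\<^sub>F r in at_right 0. T r \<in> dom r" "((\<lambda>r. T r / r) \<longlongrightarrow> \<tau>) (at_right 0)"
proof -
  define s where "s r t = switching_function 2 1 (X r t) (M r t)" for r t
  obtain C where C: "C > 0" "evt (\<lambda>r t. norm (s r t
     + (6 * (l + m * x) * r ^ 3 + (6 * l + 2 * sqrt 3 * m) * r\<^sup>2 * t + (9 * x - 3 * sqrt 3) * r * t\<^sup>2 + 2 * sqrt 3 * t ^ 3)) \<le> C * r ^ 4)"
    using switching_asymptotics unfolding s_def by (rule bndE)
  have est: "evt (\<lambda>r t. \<bar>s r t / r ^ 3 + \<sigma> (t / r)\<bar> \<le> C * r)"
    using C(2) eventually_pos
  proof eventually_elim
    case (elim r)
    show ?case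
    proof
      fix t assume "t \<in> dom r"
      then have "\<bar>s r t + r ^ 3 * \<sigma> (t / r)\<bar> \<le> C * r ^ 4"
        using elim(1) unfolding sigma_scaled[OF elim(2)] by simp
      moreover have "s r t + r ^ 3 * \<sigma> (t / r) = r ^ 3 * (s r t / r ^ 3 + \<sigma> (t / r))"
        using elim by (simp add: field_simps)
      ultimately have "r ^ 3 * \<bar>s r t / r ^ 3 + \<sigma> (t / r)\<bar> \<le> r ^ 3 * (C * r)"
        using elim by (simp add: abs_mult power4_eq_xxxx power3_eq_cube mult_ac)
      then show "\<bar>s r t / r ^ 3 + \<sigma> (t / r)\<bar> \<le> C * r"
        using elim by (simp add: mult_le_cancel_left)
    qed
  qed
  have \<sigma>0: "\<sigma> 0 < 0" using signs by (simp add: switching_cubic_def)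
  have \<sigma>K: "0 < \<sigma> K" using \<sigma>_lower(2)[of K] \<tau> by simp
  \<comment> \<open>For such \<open>r\<close> the error \<open>C * r\<close> is smaller than the
    size of \<open>\<sigma>\<close> at both ends of the window, so the signs there are
    decided.\<close>
  have small: "\<forall>\<^sub>F r in at_right 0. r < min (- \<sigma> 0) (\<sigma> K) / C"
    using \<sigma>0 \<sigma>K C by (intro eventually_lt) simp
  show in_dom: "\<forall>\<^sub>F r in at_right 0. T r \<in> dom r"
    using first_zero est small eventually_pos switching_continuous
  proof eventually_elim
    case (elim r)
    have "T r < K * r"
    proof (rule ccontr)
      assume "\<not> T r < K * r"
      then have dom: "dom r = {0..K * r}" using elim by (simp add: dom_def)
      have Kr: "0 < K * r" using elim \<tau> by simp
      have Cr: "C * r < - \<sigma> 0" "C * r < \<sigma> K" using elim C by (simp_all add: field_simps)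
      have "\<bar>s r 0 / r ^ 3 + \<sigma> 0\<bar> \<le> C * r" "\<bar>s r (K * r) / r ^ 3 + \<sigma> K\<bar> \<le> C * r"
        using elim(2)[rule_format, of 0] elim(2)[rule_format, of "K * r"] Kr elim by (simp_all add: dom)
      with Cr have "0 < s r 0 / r ^ 3" "s r (K * r) / r ^ 3 < 0" by linarith+
      then have sg: "0 < s r 0" "s r (K * r) < 0" using elim by (simp_all add: field_simps)
      obtain t where t: "0 \<le> t" "t \<le> K * r" "s r t = 0"
        using IVT2'[of "s r" "K * r" 0 0] sg Kr elim(5) unfolding dom s_def by auto
      have "t \<noteq> 0" "t \<noteq> K * r" using t sg by auto
      then have "0 < t" "t < T r" using t \<open>\<not> T r < K * r\<close> by auto
      then show False using elim(1) t(3) by (simp add: s_def)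
    qed
    then show ?case using elim by (simp add: dom_def)
  qed
  have "((\<lambda>r. T r / r - \<tau>) \<longlongrightarrow> 0) (at_right 0)"
  proof (rule Lim_null_comparison)
    define k where "k = \<bar>6 * (l + m * x)\<bar> / \<tau>"
    have k: "k > 0" using signs \<tau> by (simp add: k_def)
    show "\<forall>\<^sub>F r in at_right 0. norm (T r / r - \<tau>) \<le> C / k * r"
      using in_dom est first_zero eventually_pos
    proof eventually_elim
      case (elim r)
      have "\<bar>s r (T r) / r ^ 3 + \<sigma> (T r / r)\<bar> \<le> C * r" using elim by blast
      then have "\<bar>\<sigma> (T r / r)\<bar> \<le> C * r" using elim(3) by (simp add: s_def)
      moreover have "k * \<bar>\<tau> - T r / r\<bar> \<le> \<bar>\<sigma> (T r / r)\<bar>"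
        unfolding k_def using elim by (intro \<sigma>_lower) auto
      ultimately show ?case using k by (simp add: field_simps abs_minus_commute)
    qed
    have "((\<lambda>r. C / k * r) \<longlongrightarrow> C / k * 0) (at_right 0)" by (intro tendsto_intros)
    then show "((\<lambda>r. C / k * r) \<longlongrightarrow> 0) (at_right 0)" by simp
  qed
  then show "((\<lambda>r. T r / r) \<longlongrightarrow> \<tau>) (at_right 0)" by (rule LIM_zero_cancel)
qed

lemma bnd_limit:
  assumes "bnd (Suc n) f"
  shows "((\<lambda>r. (1 / r ^ n) *\<^sub>R f r (T r)) \<longlongrightarrow> 0) (at_right 0)"
proof -
  obtain C where C: "C > 0" "evt (\<lambda>r t. norm (f r t) \<le> C * r ^ Suc n)"
    using assms by (rule bndE)
  show ?thesis
  proof (rule Lim_null_comparison)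
    show "\<forall>\<^sub>F r in at_right 0. norm ((1 / r ^ n) *\<^sub>R f r (T r)) \<le> C * r"
      using C(2) return_time(1) eventually_pos
    proof eventually_elim
      case (elim r)
      then have "norm (f r (T r)) \<le> C * r ^ Suc n" by blast
      then show ?case using elim(3) by (simp add: field_simps)
    qed
    have "((\<lambda>r. C * r) \<longlongrightarrow> C * 0) (at_right 0)" by (intro tendsto_intros)
    then show "((\<lambda>r. C * r) \<longlongrightarrow> 0) (at_right 0)" by simp
  qed
qed

lemma X_limit:
  "((\<lambda>r. (1 / r) *\<^sub>R (X r (T r) - J_mat)) \<longlongrightarrow> mk_mat (1 + \<tau>) (x + sqrt 3 * \<tau>) (x + sqrt 3 * \<tau>) (- (1 + \<tau>))) (at_right 0)"
proof -
  have "((\<lambda>r. (1 / r ^ 1) *\<^sub>R (X r (T r) - J_mat - X1 r (T r)) + (S0 + (T r / r) *\<^sub>R S1)) \<longlongrightarrow> 0 + (S0 + \<tau> *\<^sub>R S1)) (at_right 0)"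
    using X_asymptotics by (intro tendsto_intros return_time bnd_limit) (simp add: numeral_2_eq_2)
  moreover have "\<forall>\<^sub>F r in at_right 0. (1 / r ^ 1) *\<^sub>R (X r (T r) - J_mat - X1 r (T r)) + (S0 + (T r / r) *\<^sub>R S1)
      = (1 / r) *\<^sub>R (X r (T r) - J_mat)"
    using eventually_pos by eventually_elim (simp add: X1_def algebra_simps)
  moreover have "0 + (S0 + \<tau> *\<^sub>R S1) = mk_mat (1 + \<tau>) (x + sqrt 3 * \<tau>) (x + sqrt 3 * \<tau>) (- (1 + \<tau>))"
    by (simp add: S0_def S1_def mat22_eq_iff)
  ultimately show ?thesis using tendsto_cong by force
qed

abbreviation v where "v \<equiv> l11_flow x l \<tau>"
abbreviation u where "u \<equiv> l21_flow m \<tau>"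

lemma A_limit: "((\<lambda>r. (1 / r\<^sup>2) *\<^sub>R A r (T r)) \<longlongrightarrow> mk_mat v u u (- v)) (at_right 0)"
proof -
  define B where "B t = W0 - (3/2) *\<^sub>R (t *\<^sub>R lie_bracket J_mat S0 + (t\<^sup>2 / 2) *\<^sub>R lie_bracket J_mat S1)" for t
  have "((\<lambda>r. (1 / r\<^sup>2) *\<^sub>R (A r (T r) - A1 r (T r)) + B (T r / r)) \<longlongrightarrow> 0 + B \<tau>) (at_right 0)"
    unfolding B_def using A_asymptotics by (intro tendsto_intros return_time bnd_limit) (simp_all add: numeral_3_eq_3)
  moreover have "\<forall>\<^sub>F r in at_right 0. (1 / r\<^sup>2) *\<^sub>R (A r (T r) - A1 r (T r)) + B (T r / r) = (1 / r\<^sup>2) *\<^sub>R A r (T r)"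
    using eventually_pos
  proof eventually_elim
    case (elim r)
    have "(1 / r\<^sup>2) *\<^sub>R A1 r (T r) = B (T r / r)"
      using elim by (simp add: A1_def B_def algebra_simps power2_eq_square)
    then show ?case by (simp add: scaleR_diff_right)
  qed
  moreover have "0 + B \<tau> = mk_mat v u u (- v)"
    by (simp add: B_def W0_def S0_def S1_def J_mat_def mat22_eq_iff lie_bracket_nth l11_flow_def l21_flow_def algebra_simps)
  ultimately show ?thesis using tendsto_cong by force
qed

lemma rotate_X_limit:
  "((\<lambda>r. rotate_back (X r (T r)) $ 1 $ 1 / r) \<longlongrightarrow> - (1 + \<tau>) / 2 + sqrt 3 / 2 * (x + sqrt 3 * \<tau>)) (at_right 0)"
  "((\<lambda>r. (rotate_back (X r (T r)) $ 2 $ 1 - 1) / r) \<longlongrightarrow> - (x + sqrt 3 * \<tau>) / 2 - sqrt 3 / 2 * (1 + \<tau>)) (at_right 0)"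
proof -
  interpret rb: bounded_linear rotate_back by (rule bounded_linear_rotate_back)
  have lim: "((\<lambda>r. rotate_back ((1 / r) *\<^sub>R (X r (T r) - J_mat)) $ i $ j)
      \<longlongrightarrow> rotate_back (mk_mat (1 + \<tau>) (x + sqrt 3 * \<tau>) (x + sqrt 3 * \<tau>) (- (1 + \<tau>))) $ i $ j) (at_right 0)" for i j
    by (intro tendsto_vec_nth rb.tendsto X_limit)
  have eq: "rotate_back ((1 / r) *\<^sub>R (X r (T r) - J_mat)) = (1 / r) *\<^sub>R (rotate_back (X r (T r)) - J_mat)" for r
    by (simp add: rb.scaleR rb.diff rotate_back_J)
  show "((\<lambda>r. rotate_back (X r (T r)) $ 1 $ 1 / r) \<longlongrightarrow> - (1 + \<tau>) / 2 + sqrt 3 / 2 * (x + sqrt 3 * \<tau>)) (at_right 0)"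
    using lim[of 1 1] unfolding eq rotate_back_symmetric by (simp add: J_mat_def)
  show "((\<lambda>r. (rotate_back (X r (T r)) $ 2 $ 1 - 1) / r) \<longlongrightarrow> - (x + sqrt 3 * \<tau>) / 2 - sqrt 3 / 2 * (1 + \<tau>)) (at_right 0)"
    using lim[of 2 1] unfolding eq rotate_back_symmetric by (simp add: J_mat_def)
qed

lemma rotate_L_limit:
  "((\<lambda>r. rotate_back (L r (T r)) $ 1 $ 1 / r\<^sup>2) \<longlongrightarrow> - v / 2 + sqrt 3 / 2 * u) (at_right 0)"
  "((\<lambda>r. (rotate_back (L r (T r)) $ 2 $ 1 + 3/2) / r\<^sup>2) \<longlongrightarrow> - u / 2 - sqrt 3 / 2 * v) (at_right 0)"
proof -
  interpret rb: bounded_linear rotate_back by (rule bounded_linear_rotate_back)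
  have lim: "((\<lambda>r. rotate_back ((1 / r\<^sup>2) *\<^sub>R A r (T r)) $ i $ j)
      \<longlongrightarrow> rotate_back (mk_mat v u u (- v)) $ i $ j) (at_right 0)" for i j
    by (intro tendsto_vec_nth rb.tendsto A_limit)
  have eq: "rotate_back ((1 / r\<^sup>2) *\<^sub>R A r (T r)) = (1 / r\<^sup>2) *\<^sub>R (rotate_back (L r (T r)) + (3/2) *\<^sub>R J_mat)" for r
    by (simp add: A_def rb.scaleR rb.add rotate_back_J)
  show "((\<lambda>r. rotate_back (L r (T r)) $ 1 $ 1 / r\<^sup>2) \<longlongrightarrow> - v / 2 + sqrt 3 / 2 * u) (at_right 0)"
    using lim[of 1 1] unfolding eq rotate_back_symmetric by (simp add: J_mat_def)
  show "((\<lambda>r. (rotate_back (L r (T r)) $ 2 $ 1 + 3/2) / r\<^sup>2) \<longlongrightarrow> - u / 2 - sqrt 3 / 2 * v) (at_right 0)"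
    using lim[of 2 1] unfolding eq rotate_back_symmetric by (simp add: J_mat_def)
qed

end

section \<open>The return map on the exceptional divisor\<close>

lemma switching_cubic_root:
  assumes "l + m * x < 0"
  obtains \<tau> where "0 < \<tau>" "switching_cubic x l m \<tau> = 0"
proof -
  define c0 c1 c2 where "c0 = 6 * (l + m * x)" and "c1 = 6 * l + 2 * sqrt 3 * m" and "c2 = 9 * x - 3 * sqrt 3"
  \<comment> \<open>Large enough for \<open>2 * sqrt 3 * N ^ 3\<close> to outweigh all lower terms
    whatever their signs; existence then depends only on the sign at 0.\<close>
  define N where "N = 1 + \<bar>c0\<bar> + \<bar>c1\<bar> + \<bar>c2\<bar>"
  have N: "N \<ge> 1" by (simp add: N_def)
  have "- \<bar>c0\<bar> * N\<^sup>2 \<le> c0" "- \<bar>c1\<bar> * N\<^sup>2 \<le> c1 * N" "- \<bar>c2\<bar> * N\<^sup>2 \<le> c2 * N\<^sup>2"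
  proof -
    have N2: "1 \<le> N\<^sup>2" "N \<le> N\<^sup>2"
      using one_le_power[OF N, of 2] mult_left_mono[OF N, of N] N by (simp_all add: power2_eq_square)
    show "- \<bar>c0\<bar> * N\<^sup>2 \<le> c0" using mult_left_mono[OF N2(1), of "\<bar>c0\<bar>"] by simp
    have "\<bar>c1\<bar> * N \<le> \<bar>c1\<bar> * N\<^sup>2" using N2(2) by (intro mult_left_mono) auto
    moreover have "- (c1 * N) \<le> \<bar>c1\<bar> * N" using mult_right_mono[of "- c1" "\<bar>c1\<bar>" N] N by simp
    ultimately show "- \<bar>c1\<bar> * N\<^sup>2 \<le> c1 * N" by simp
    show "- \<bar>c2\<bar> * N\<^sup>2 \<le> c2 * N\<^sup>2" by (intro mult_right_mono) auto
  qed
  then have "- ((\<bar>c0\<bar> + \<bar>c1\<bar> + \<bar>c2\<bar>) * N\<^sup>2) \<le> c0 + c1 * N + c2 * N\<^sup>2" by (simp add: algebra_simps)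
  moreover have "(\<bar>c0\<bar> + \<bar>c1\<bar> + \<bar>c2\<bar>) * N\<^sup>2 \<le> 2 * sqrt 3 * N ^ 3"
  proof -
    have "1 \<le> sqrt 3" by simp
    then have "1 \<le> 2 * sqrt 3" by linarith
    then have "1 * N \<le> 2 * sqrt 3 * N" using N by (intro mult_right_mono) auto
    then have "(\<bar>c0\<bar> + \<bar>c1\<bar> + \<bar>c2\<bar>) * N\<^sup>2 \<le> (2 * sqrt 3 * N) * N\<^sup>2"
      by (intro mult_right_mono) (auto simp: N_def)
    then show ?thesis by (simp add: power2_eq_square power3_eq_cube mult_ac)
  qed
  ultimately have "0 \<le> switching_cubic x l m N"
    unfolding switching_cubic_def c0_def[symmetric] c1_def[symmetric] c2_def[symmetric] by linarith
  moreover have neg: "switching_cubic x l m 0 < 0" using assms by (simp add: switching_cubic_def)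
  moreover have "continuous_on {0..N} (switching_cubic x l m)"
    unfolding switching_cubic_def by (intro continuous_intros)
  ultimately obtain \<tau> where t: "0 \<le> \<tau>" "switching_cubic x l m \<tau> = 0"
    using IVT'[of "switching_cubic x l m" 0 0 N] N by auto
  with neg have "\<tau> \<noteq> 0" by auto
  with t(1) have "0 < \<tau>" by simp
  with t(2) show ?thesis by (intro that)
qed

text \<open>Cross-multiplying with \<open>s ^ 3\<close> and \<open>t ^ 3\<close> eliminates the
  cubic terms; what remains is \<open>s - t\<close> times a sum of negative terms.\<close>

lemma switching_cubic_root_unique:
  assumes c: "l + m * x < 0" "6 * l + 2 * sqrt 3 * m < 0" "9 * x - 3 * sqrt 3 < 0"
    and s: "0 < s" "switching_cubic x l m s = 0" and t: "0 < t" "switching_cubic x l m t = 0"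
  shows "s = t"
proof -
  define E where "E = 6 * (l + m * x) * (s\<^sup>2 + s * t + t\<^sup>2)
    + (6 * l + 2 * sqrt 3 * m) * (t * s * (s + t)) + (9 * x - 3 * sqrt 3) * (t\<^sup>2 * s\<^sup>2)"
  have "(s - t) * E = switching_cubic x l m t * s ^ 3 - switching_cubic x l m s * t ^ 3"
    unfolding switching_cubic_def E_def by algebra
  then have "(s - t) * E = 0" by (simp add: s t)
  moreover have "E < 0"
  proof -
    have "6 * (l + m * x) * (s\<^sup>2 + s * t + t\<^sup>2) < 0"
      by (rule mult_neg_pos) (use c s t in \<open>auto intro!: add_pos_pos\<close>)
    moreover have "(6 * l + 2 * sqrt 3 * m) * (t * s * (s + t)) < 0"
      by (rule mult_neg_pos) (use c s t in auto)
    moreover have "(9 * x - 3 * sqrt 3) * (t\<^sup>2 * s\<^sup>2) < 0"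
      by (rule mult_neg_pos) (use c s t in auto)
    ultimately show ?thesis by (simp add: E_def)
  qed
  ultimately show ?thesis by simp
qed

text \<open>The blown-up return map on the exceptional divisor: the equations are cleared of
  denominators, \<open>\<rho>\<close> being the factor by which \<open>r\<close> is multiplied.\<close>

lemma divisor_map:
  assumes ext: "reinhardt_poincare_extension U F" and cont: "isCont F (vector [0, x, l, m])"
    and q: "vector [0, x, l, m] \<in> U"
    and signs: "l + m * x < 0" "6 * l + 2 * sqrt 3 * m < 0" "9 * x - 3 * sqrt 3 < 0"
    and \<tau>: "0 < \<tau>" "switching_cubic x l m \<tau> = 0"
  defines "\<rho> \<equiv> - (1 + \<tau>) / 2 + sqrt 3 / 2 * (x + sqrt 3 * \<tau>)"
  shows "((\<lambda>r. F (vector [r, x, l, m]) $ 1 / r) \<longlongrightarrow> \<rho>) (at_right 0)"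
    and "\<rho> * F (vector [0, x, l, m]) $ 2 = - (x + sqrt 3 * \<tau>) / 2 - sqrt 3 / 2 * (1 + \<tau>)"
    and "\<rho>\<^sup>2 * F (vector [0, x, l, m]) $ 3 = - l11_flow x l \<tau> / 2 + sqrt 3 / 2 * l21_flow m \<tau>"
    and "\<rho>\<^sup>2 * F (vector [0, x, l, m]) $ 4 = - l21_flow m \<tau> / 2 - sqrt 3 / 2 * l11_flow x l \<tau>"
proof -
  define V where "V r = (vector [r, x, l, m] :: real^4)" for r
  have V_eq: "V r = V 0 + r *\<^sub>R axis 1 1" for r
    by (simp add: V_def vec_eq_iff forall_4 axis_def)
  have V_lim: "(V \<longlongrightarrow> V 0) (at_right 0)"
  proof -
    have "((\<lambda>r. V 0 + r *\<^sub>R axis 1 1) \<longlongrightarrow> V 0 + 0 *\<^sub>R axis 1 1) (at_right 0)" by (intro tendsto_intros)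
    then show ?thesis unfolding V_eq[symmetric] .
  qed
  have "open U" and poinc: "\<And>q. q \<in> U \<Longrightarrow> q $ 1 > 0 \<Longrightarrow> reinhardt_poincare q (F q)"
    using ext unfolding reinhardt_poincare_extension_def analytic_diffeomorphism_on_def by blast+
  have evU: "\<forall>\<^sub>F r in at_right 0. V r \<in> U"
    using topological_tendstoD[OF V_lim \<open>open U\<close>] q by (simp add: V_def)
  have ev: "\<forall>\<^sub>F r in at_right 0. 0 < r \<and> V r \<in> U"
    using evU eventually_at_right_less[of "0::real"] by eventually_elim simp
  define Q where "Q r w \<longleftrightarrow> (case w of (T, X, L, M) \<Rightarrow> T > 0 \<and> represents (V r) (X 0) (L 0) (M 0) \<and>
      reinhardt_solution (e_vec 2) T X L M \<and> switching_function 2 1 (X T) (M T) = 0 \<and>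
      (\<forall>t. 0 < t \<and> t < T \<longrightarrow> switching_function 2 1 (X t) (M t) \<noteq> 0) \<and>
      represents (F (V r)) (rotate_back (X T)) (rotate_back (L T)) (rotate_back (M T)))" for r w
  have ex: "\<exists>w. Q r w" if "0 < r" "V r \<in> U" for r
  proof -
    have "reinhardt_poincare (V r) (F (V r))"
      using that by (intro poinc) (simp_all add: V_def)
    then obtain T X L M where "T > 0" "represents (V r) (X 0) (L 0) (M 0)"
      "reinhardt_solution (e_vec 2) T X L M" "switching_function 2 1 (X T) (M T) = 0"
      "\<forall>t. 0 < t \<and> t < T \<longrightarrow> switching_function 2 1 (X t) (M t) \<noteq> 0"
      "represents (F (V r)) (rotate_back (X T)) (rotate_back (L T)) (rotate_back (M T))"
      unfolding reinhardt_poincare_def by blast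
    then have "Q r (T, X, L, M)" by (simp add: Q_def)
    then show ?thesis by blast
  qed
  \<comment> \<open>A trajectory is chosen independently for every small \<open>r\<close>; the
    asymptotic estimates need no more.\<close>
  define w where "w r = (SOME w. Q r w)" for r
  have w: "Q r (w r)" if "0 < r" "V r \<in> U" for r
    unfolding w_def by (rule someI_ex[OF ex[OF that]])
  define T where "T r = fst (w r)" for r
  define X where "X r = fst (snd (w r))" for r
  define L where "L r = fst (snd (snd (w r)))" for r
  define M where "M r = snd (snd (snd (w r)))" for r
  have Q: "\<forall>\<^sub>F r in at_right 0. Q r (T r, X r, L r, M r)"
    using ev by eventually_elim (use w in \<open>simp add: T_def X_def L_def M_def\<close>)
  \<comment> \<open>Any window constant above \<open>\<tau>\<close> would do.\<close>
  interpret reinhardt_return T "\<tau> + 1" x l m X L M \<tau>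
  proof
    show "\<forall>\<^sub>F r in at_right 0. 0 \<le> T r" using Q by eventually_elim (simp add: Q_def)
    show "\<forall>\<^sub>F r in at_right 0. represents (vector [r, x, l, m]) (X r 0) (L r 0) (M r 0)"
      using Q by eventually_elim (simp add: Q_def V_def)
    show "\<forall>\<^sub>F r in at_right 0. reinhardt_solution (e_vec 2) (T r) (X r) (L r) (M r)"
      using Q by eventually_elim (simp add: Q_def)
    show "\<forall>\<^sub>F r in at_right 0. 0 < T r \<and> switching_function 2 1 (X r (T r)) (M r (T r)) = 0 \<and>
      (\<forall>t. 0 < t \<and> t < T r \<longrightarrow> switching_function 2 1 (X r t) (M r t) \<noteq> 0)"
      using Q by eventually_elim (simp add: Q_def)
  qed (use \<tau> signs in auto)
  have fin: "\<forall>\<^sub>F r in at_right 0. 0 < r \<and>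
      rotate_back (X r (T r)) $ 1 $ 1 = F (V r) $ 1 \<and>
      rotate_back (X r (T r)) $ 2 $ 1 = 1 + F (V r) $ 1 * F (V r) $ 2 \<and>
      rotate_back (L r (T r)) $ 1 $ 1 = (F (V r) $ 1)\<^sup>2 * F (V r) $ 3 \<and>
      rotate_back (L r (T r)) $ 2 $ 1 = - (3/2) + (F (V r) $ 1)\<^sup>2 * F (V r) $ 4"
    using Q ev by eventually_elim (auto simp: Q_def represents_def)
  have "((\<lambda>r. F (V r)) \<longlongrightarrow> F (V 0)) (at_right 0)"
    using isCont_tendsto_compose[OF _ V_lim, of F] cont unfolding V_def by blast
  then have Flim: "((\<lambda>r. F (V r) $ i) \<longlongrightarrow> F (V 0) $ i) (at_right 0)" for i
    by (rule tendsto_vec_nth)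
  show R: "((\<lambda>r. F (vector [r, x, l, m]) $ 1 / r) \<longlongrightarrow> \<rho>) (at_right 0)"
    using tendsto_cong[THEN iffD1, OF _ rotate_X_limit(1)] eventually_mono[OF fin]
    unfolding \<rho>_def V_def[symmetric] by fastforce
  have nt: "at_right (0::real) \<noteq> bot" by simp
  \<comment> \<open>Limits are taken of products such as
    \<open>F (V r) $ 1 / r * F (V r) $ 2\<close>, so that continuity of \<open>F\<close> gives the
    equations without a division by \<open>\<rho>\<close>.\<close>
  have lim2: "((\<lambda>r. F (V r) $ 1 / r * F (V r) $ 2) \<longlongrightarrow> \<rho> * F (V 0) $ 2) (at_right 0)"
    using R unfolding V_def[symmetric] by (intro tendsto_mult Flim)
  have "\<forall>\<^sub>F r in at_right 0. (rotate_back (X r (T r)) $ 2 $ 1 - 1) / r = F (V r) $ 1 / r * F (V r) $ 2"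
    using fin by eventually_elim simp
  from tendsto_cong[THEN iffD2, OF this lim2]
  have "((\<lambda>r. (rotate_back (X r (T r)) $ 2 $ 1 - 1) / r) \<longlongrightarrow> \<rho> * F (V 0) $ 2) (at_right 0)" .
  from tendsto_unique[OF nt this rotate_X_limit(2)]
  show "\<rho> * F (vector [0, x, l, m]) $ 2 = - (x + sqrt 3 * \<tau>) / 2 - sqrt 3 / 2 * (1 + \<tau>)" by (simp add: V_def)
  have sq: "((\<lambda>r. (F (V r) $ 1 / r)\<^sup>2 * F (V r) $ i) \<longlongrightarrow> \<rho>\<^sup>2 * F (V 0) $ i) (at_right 0)" for i
    using R unfolding V_def[symmetric] by (intro tendsto_mult tendsto_power Flim)
  have "\<forall>\<^sub>F r in at_right 0. rotate_back (L r (T r)) $ 1 $ 1 / r\<^sup>2 = (F (V r) $ 1 / r)\<^sup>2 * F (V r) $ 3"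
    using fin by eventually_elim (simp add: power_divide)
  from tendsto_cong[THEN iffD2, OF this sq[of 3]] have "((\<lambda>r. rotate_back (L r (T r)) $ 1 $ 1 / r\<^sup>2) \<longlongrightarrow> \<rho>\<^sup>2 * F (V 0) $ 3) (at_right 0)" .
  from tendsto_unique[OF nt this rotate_L_limit(1)]
  show "\<rho>\<^sup>2 * F (vector [0, x, l, m]) $ 3 = - l11_flow x l \<tau> / 2 + sqrt 3 / 2 * l21_flow m \<tau>" by (simp add: V_def)
  have "\<forall>\<^sub>F r in at_right 0. (rotate_back (L r (T r)) $ 2 $ 1 + 3/2) / r\<^sup>2 = (F (V r) $ 1 / r)\<^sup>2 * F (V r) $ 4"
    using fin by eventually_elim (simp add: power_divide)
  from tendsto_cong[THEN iffD2, OF this sq[of 4]] have "((\<lambda>r. (rotate_back (L r (T r)) $ 2 $ 1 + 3/2) / r\<^sup>2) \<longlongrightarrow> \<rho>\<^sup>2 * F (V 0) $ 4) (at_right 0)" .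
  from tendsto_unique[OF nt this rotate_L_limit(2)]
  show "\<rho>\<^sup>2 * F (vector [0, x, l, m]) $ 4 = - l21_flow m \<tau> / 2 - sqrt 3 / 2 * l11_flow x l \<tau>" by (simp add: V_def)
qed

section \<open>The fixed point\<close>

definition sextic :: "real \<Rightarrow> real" where
  "sextic s = 1 - 5 * s - 7 * s^2 - 5 * s^3 - 7 * s^4 - 5 * s^5 + s^6"

text \<open>The sextic is palindromic: in \<open>w = s + 1/s\<close> it becomes
  \<open>w\<^sup>3 - 5 w\<^sup>2 - 10 w + 5\<close>, which has a single root \<open>w > 2\<close>.\<close>

lemma sextic_root_unique:
  assumes s: "s > 1" "sextic s = 0" and t: "t > 1" "sextic t = 0"
  shows "s = t"
proof -
  define w where "w u = u + 1 / u" for u :: real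
  have cubic: "w u ^ 3 - 5 * (w u)\<^sup>2 - 10 * w u + 5 = 0" if "u > 1" "sextic u = 0" for u
  proof -
    have "(w u ^ 3 - 5 * (w u)\<^sup>2 - 10 * w u + 5) * u ^ 3 = sextic u"
      using that(1) by (simp add: w_def sextic_def field_simps power2_eq_square power3_eq_cube eval_nat_numeral)
    then show ?thesis using that by auto
  qed
  \<comment> \<open>For \<open>2 < w \<le> 5\<close> the cubic is at most
    \<open>5 - 10 * w < 0\<close>. Above 5 every summand of the divided difference \<open>E\<close>
    is positive.\<close>
  have w5: "w u > 5" if "u > 1" "sextic u = 0" for u
  proof (rule ccontr)
    assume "\<not> 5 < w u"
    have "w u - 2 = (u - 1)\<^sup>2 / u" using that(1) by (simp add: w_def field_simps power2_eq_square)
    also have "\<dots> > 0" using that(1) by simp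
    finally have w2: "w u > 2" by simp
    have "(w u)\<^sup>2 * (w u - 5) \<le> 0" using \<open>\<not> 5 < w u\<close> by (intro mult_nonneg_nonpos) auto
    moreover have "w u ^ 3 - 5 * (w u)\<^sup>2 - 10 * w u + 5 = (w u)\<^sup>2 * (w u - 5) - 10 * w u + 5"
      by (simp add: power2_eq_square power3_eq_cube algebra_simps)
    ultimately show False using cubic[OF that] w2 by linarith
  qed
  define E where "E = w s * (w s - 5) + w t * (w t - 5) + (w s * w t - 10)"
  have "(w s - w t) * E = (w s ^ 3 - 5 * (w s)\<^sup>2 - 10 * w s + 5) - (w t ^ 3 - 5 * (w t)\<^sup>2 - 10 * w t + 5)"
    by (simp add: E_def power2_eq_square power3_eq_cube algebra_simps)
  then have "(w s - w t) * E = 0" using cubic[OF s] cubic[OF t] by simp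
  moreover have "E > 0"
  proof -
    have "0 < w s * (w s - 5)" "0 < w t * (w t - 5)" using w5[OF s] w5[OF t] by simp_all
    moreover have "5 * 5 < w s * w t" using w5[OF s] w5[OF t] by (intro mult_strict_mono) auto
    ultimately show ?thesis by (simp add: E_def)
  qed
  ultimately have "w s = w t" by simp
  \<comment> \<open>Injectivity of \<open>u + 1 / u\<close> for \<open>u > 1\<close>.\<close>
  then have "(s - t) * (1 - 1 / (s * t)) = 0" using s t by (simp add: w_def field_simps)
  moreover have "1 < s * t" using s t mult_strict_mono[of 1 s 1 t] by simp
  ultimately show ?thesis by simp
qed

text \<open>A sign change brackets a root, and uniqueness identifies it with \<open>s_root\<close>.
  All later numerical bounds descend from this interval of width 1/10000.\<close>

lemma s_root: "sextic s_root = 0" "62741 / 10000 \<le> s_root" "s_root \<le> 62742 / 10000"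
proof -
  have "sextic (62741 / 10000) \<le> 0" "0 \<le> sextic (62742 / 10000)"
    by (simp_all add: sextic_def eval_nat_numeral)
  moreover have "continuous_on {62741 / 10000 .. 62742 / 10000} sextic"
    unfolding sextic_def by (intro continuous_intros)
  ultimately obtain s where s: "62741 / 10000 \<le> s" "s \<le> 62742 / 10000" "sextic s = 0"
    using IVT'[of sextic "62741 / 10000" 0 "62742 / 10000"] by auto
  have "s_root = s"
    unfolding s_root_def sextic_def[symmetric]
    by (rule the_equality) (use s sextic_root_unique in auto)
  with s show "sextic s_root = 0" "62741 / 10000 \<le> s_root" "s_root \<le> 62742 / 10000" by simp_all
qed

text \<open>In the coordinates \<open>x = sqrt 3 * \<xi>\<close>, \<open>l = sqrt 3 * \<nu>\<close>, \<open>m\<close> everything is rational in \<open>s\<close>.\<close>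

definition \<xi> :: real where "\<xi> = - (s_root + 1) / (s_root - 1)"
definition t0 :: real where "t0 = (s_root\<^sup>2 + s_root + 1) / (s_root - 1)"
definition \<nu> :: real where
  "\<nu> = - (3/2) * ((s_root\<^sup>2 + s_root + 1) * (s_root + 1)) / ((s_root\<^sup>2 - s_root + 1) * (s_root - 1))"
definition m0 :: real where
  "m0 = - (3/2) * (s_root ^ 4 - 3 * s_root ^ 3 - 2 * s_root\<^sup>2 - 3 * s_root + 1)
     / ((s_root - 1)\<^sup>2 * (s_root\<^sup>2 - s_root + 1))"

lemma q_out_eq: "q_out = vector [0, sqrt 3 * \<xi>, sqrt 3 * \<nu>, m0]"
proof -
  define s where "s = s_root"
  have s: "s > 1" using s_root by (simp add: s_def)
  define d e where "d = s - 1" and "e = s\<^sup>2 - s + 1"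
  have d: "d > 0" using s by (simp add: d_def)
  have "s * 1 < s * s" using s by (intro mult_strict_left_mono) auto
  then have e: "e > 0" unfolding e_def power2_eq_square by linarith
  have s1: "s + 1 > 0" using s by simp
  have q: "sqrt 3 * sqrt 3 = 3" by simp
  have f: "1 + s ^ 3 = (s + 1) * e" "- 1 + s ^ 3 = d * (s\<^sup>2 + s + 1)" "1 + s + s ^ 3 + s ^ 4 = (s + 1) * ((s + 1) * e)"
    by (simp_all add: d_def e_def power2_eq_square eval_nat_numeral algebra_simps)
  have z1: "Re z1_out = - 1" "Im z1_out = d / (sqrt 3 * (s + 1))"
    by (simp_all add: z1_out_def s_def[symmetric] Let_def d_def add.commute)
  have z2: "Re z2_out = - (d * (s\<^sup>2 + s + 1) / (sqrt 3 * ((s + 1) * e)))"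
    "Im z2_out = (1 - 3 * s - 2 * s\<^sup>2 - 3 * s ^ 3 + s ^ 4) / (3 * ((s + 1) * ((s + 1) * e)))"
    by (simp_all only: z2_out_def s_def[symmetric] Let_def f complex.sel)
  have i2: "(Im z1_out)\<^sup>2 = d\<^sup>2 / (3 * (s + 1)\<^sup>2)"
    by (simp add: z1 power_divide power_mult_distrib)
  have "Re z1_out / Im z1_out = sqrt 3 * \<xi>"
    using d s1 by (simp add: z1 \<xi>_def flip: s_def d_def) (simp add: field_simps)
  moreover have "3 * Re z2_out / (2 * (Im z1_out)\<^sup>2) = sqrt 3 * \<nu>"
    unfolding i2 z2 \<nu>_def s_def[symmetric] d_def[symmetric] e_def[symmetric]
    using d s1 e q by (simp add: divide_simps) (simp add: power2_eq_square algebra_simps)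
  moreover have "- (3 * Im z2_out / (2 * (Im z1_out)\<^sup>2)) = m0"
    unfolding i2 z2 m0_def s_def[symmetric] d_def[symmetric] e_def[symmetric]
    using d s1 e by (simp add: divide_simps) (simp add: power2_eq_square algebra_simps)
  ultimately show ?thesis by (simp add: q_out_def)
qed

text \<open>Only the first equation uses the sextic: with denominators cleared, its left side is
  \<open>2 * (1 + s + s\<^sup>2)\<close> times the sextic. The other four are identities in
  \<open>s\<close>, so the sextic is exactly the condition that \<open>t0\<close> be a switching
  time.\<close>

lemma fixed_point_equations:
  "6 * (\<nu> + m0 * \<xi>) + (6 * \<nu> + 2 * m0) * t0 + (9 * \<xi> - 3) * t0\<^sup>2 + 2 * t0 ^ 3 = 0"
  "t0 + (3 * \<xi> - 1) / 2 = s_root"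
  "s_root * \<xi> = - (\<xi> + 1 + 2 * t0) / 2"
  "s_root\<^sup>2 * \<nu> = ((m0 - 3 * (t0 + t0\<^sup>2 / 2)) - (\<nu> + 3 * (\<xi> * t0 + t0\<^sup>2 / 2))) / 2"
  "s_root\<^sup>2 * m0 = - ((m0 - 3 * (t0 + t0\<^sup>2 / 2)) + 3 * (\<nu> + 3 * (\<xi> * t0 + t0\<^sup>2 / 2))) / 2"
proof -
  define s where "s = s_root"
  have s: "s > 1" "sextic s = 0" using s_root by (simp_all add: s_def)
  define d e where "d = s - 1" and "e = s\<^sup>2 - s + 1"
  have d: "d \<noteq> 0" using s by (simp add: d_def)
  have "s * 1 < s * s" using s by (intro mult_strict_left_mono) auto
  then have "e > 0" unfolding e_def power2_eq_square by linarith
  then have e: "e \<noteq> 0" by simp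
  have x: "\<xi> * d = - (s + 1)" and t: "t0 * d = s\<^sup>2 + s + 1"
    and n: "\<nu> * (e * d) = - (3/2) * ((s\<^sup>2 + s + 1) * (s + 1))"
    and m: "m0 * (d\<^sup>2 * e) = - (3/2) * (s ^ 4 - 3 * s ^ 3 - 2 * s\<^sup>2 - 3 * s + 1)"
    unfolding \<xi>_def t0_def \<nu>_def m0_def s_def[symmetric] d_def[symmetric] e_def[symmetric]
    using d e by simp_all
  have "(6 * (\<nu> + m0 * \<xi>) + (6 * \<nu> + 2 * m0) * t0 + (9 * \<xi> - 3) * t0\<^sup>2 + 2 * t0 ^ 3) * (d ^ 3 * e)
      = 6 * ((\<nu> * (e * d)) * d\<^sup>2 + (m0 * (d\<^sup>2 * e)) * (\<xi> * d))
        + (6 * (\<nu> * (e * d)) * d + 2 * (m0 * (d\<^sup>2 * e))) * (t0 * d)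
        + (9 * (\<xi> * d) - 3 * d) * (t0 * d)\<^sup>2 * e + 2 * (t0 * d) ^ 3 * e"
    by (simp add: power2_eq_square power3_eq_cube algebra_simps)
  also have "\<dots> = 2 * (1 + s + s\<^sup>2) * sextic s"
    unfolding x t n m unfolding d_def e_def sextic_def by (simp add: power2_eq_square eval_nat_numeral field_simps)
  finally show "6 * (\<nu> + m0 * \<xi>) + (6 * \<nu> + 2 * m0) * t0 + (9 * \<xi> - 3) * t0\<^sup>2 + 2 * t0 ^ 3 = 0"
    using d e s by simp
  have "(t0 + (3 * \<xi> - 1) / 2 - s) * d = t0 * d + (3 * (\<xi> * d) - d) / 2 - s * d" by (simp add: field_simps)
  also have "\<dots> = 0" unfolding x t by (simp add: d_def power2_eq_square field_simps)
  finally show "t0 + (3 * \<xi> - 1) / 2 = s_root" using d by (simp add: s_def)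
  have "(s * \<xi> + (\<xi> + 1 + 2 * t0) / 2) * d = s * (\<xi> * d) + (\<xi> * d + d + 2 * (t0 * d)) / 2" by (simp add: field_simps)
  also have "\<dots> = 0" unfolding x t by (simp add: d_def power2_eq_square field_simps)
  finally have "s * \<xi> + (\<xi> + 1 + 2 * t0) / 2 = 0" using d by simp
  then show "s_root * \<xi> = - (\<xi> + 1 + 2 * t0) / 2" unfolding s_def by linarith
  have "(2 * s\<^sup>2 * \<nu> + (\<nu> + 3 * (\<xi> * t0 + t0\<^sup>2 / 2)) - (m0 - 3 * (t0 + t0\<^sup>2 / 2))) * (d\<^sup>2 * e)
      = 2 * s\<^sup>2 * (\<nu> * (e * d)) * d + (\<nu> * (e * d)) * d + 3 * (\<xi> * d) * (t0 * d) * e + 3 * (t0 * d)\<^sup>2 * e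
        - m0 * (d\<^sup>2 * e) + 3 * (t0 * d) * d * e"
    by (simp add: power2_eq_square field_simps)
  also have "\<dots> = 0"
    unfolding x t n m unfolding d_def e_def by (simp add: power2_eq_square eval_nat_numeral field_simps)
  finally have "2 * s\<^sup>2 * \<nu> + (\<nu> + 3 * (\<xi> * t0 + t0\<^sup>2 / 2)) - (m0 - 3 * (t0 + t0\<^sup>2 / 2)) = 0"
    using d e by simp
  then show "s_root\<^sup>2 * \<nu> = ((m0 - 3 * (t0 + t0\<^sup>2 / 2)) - (\<nu> + 3 * (\<xi> * t0 + t0\<^sup>2 / 2))) / 2"
    by (simp add: s_def field_simps)
  have "(2 * s\<^sup>2 * m0 + (m0 - 3 * (t0 + t0\<^sup>2 / 2)) + 3 * (\<nu> + 3 * (\<xi> * t0 + t0\<^sup>2 / 2))) * (d\<^sup>2 * e)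
      = 2 * s\<^sup>2 * (m0 * (d\<^sup>2 * e)) + m0 * (d\<^sup>2 * e) - 3 * (t0 * d) * d * e + 3 * (t0 * d)\<^sup>2 * e
        + 3 * (\<nu> * (e * d)) * d + 9 * (\<xi> * d) * (t0 * d) * e"
    by (simp add: power2_eq_square field_simps)
  also have "\<dots> = 0"
    unfolding x t n m unfolding d_def e_def by (simp add: power2_eq_square eval_nat_numeral field_simps)
  finally have "2 * s\<^sup>2 * m0 + (m0 - 3 * (t0 + t0\<^sup>2 / 2)) + 3 * (\<nu> + 3 * (\<xi> * t0 + t0\<^sup>2 / 2)) = 0"
    using d e by simp
  then show "s_root\<^sup>2 * m0 = - ((m0 - 3 * (t0 + t0\<^sup>2 / 2)) + 3 * (\<nu> + 3 * (\<xi> * t0 + t0\<^sup>2 / 2))) / 2"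
    by (simp add: s_def field_simps)
qed

text \<open>Bounds a quotient \<open>B / A\<close> through inequalities linear in \<open>A\<close>
  and \<open>B\<close>, so that enclosures of the powers of \<open>s_root\<close> and linear
  arithmetic suffice.\<close>

lemma enclosure:
  fixes A B c k a :: real
  assumes "A * x = B" "0 < a" "a \<le> A" "B - c * A \<le> k * a" "c * A - B \<le> k * a"
  shows "\<bar>x - c\<bar> \<le> k"
proof -
  have "\<bar>x - c\<bar> * a \<le> \<bar>x - c\<bar> * A" using assms by (intro mult_left_mono) auto
  also have "\<dots> = \<bar>B - c * A\<bar>"
  proof -
    have "B - c * A = (x - c) * A" using assms(1) by (simp add: algebra_simps)
    then show ?thesis using assms by (simp add: abs_mult)
  qed
  finally have "\<bar>x - c\<bar> * a \<le> k * a" using assms(4,5) by linarith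
  then show ?thesis using assms(2) by (simp add: mult_le_cancel_right)
qed

text \<open>Replaces one factor of a product by a constant, with explicit error, after which the
  product can be treated linearly.\<close>

lemma enclosure_mult:
  fixes y z c k K :: real
  assumes "\<bar>y - c\<bar> \<le> k" "\<bar>z\<bar> \<le> K"
  shows "\<bar>y * z - c * z\<bar> \<le> k * K"
proof -
  have "\<bar>y - c\<bar> * \<bar>z\<bar> \<le> k * K" using assms by (intro mult_mono) auto
  then show ?thesis by (simp add: left_diff_distrib flip: abs_mult)
qed

lemma s_powers:
  "\<bar>s_root - 62741 / 10000\<bar> \<le> 1 / 10000"
  "\<bar>s_root\<^sup>2 - 39364963 / 1000000\<bar> \<le> 13 / 10000"
  "\<bar>s_root ^ 3 - 246982 / 1000\<bar> \<le> 14 / 1000"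
  "\<bar>s_root ^ 4 - 154964 / 100\<bar> \<le> 12 / 100"
proof -
  note s = s_root(2,3)
  have p: "(62741 / 10000) ^ n \<le> s_root ^ n" "s_root ^ n \<le> (62742 / 10000) ^ n" for n
    using s by (auto intro!: power_mono)
  show "\<bar>s_root - 62741 / 10000\<bar> \<le> 1 / 10000" using s unfolding abs_le_iff by simp
  show "\<bar>s_root\<^sup>2 - 39364963 / 1000000\<bar> \<le> 13 / 10000"
    using p[of 2] unfolding abs_le_iff by (simp add: power_divide)
  show "\<bar>s_root ^ 3 - 246982 / 1000\<bar> \<le> 14 / 1000"
    using p[of 3] unfolding abs_le_iff by (simp add: power_divide)
  show "\<bar>s_root ^ 4 - 154964 / 100\<bar> \<le> 12 / 100"
    using p[of 4] unfolding abs_le_iff by (simp add: power_divide)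
qed

lemma numeric:
  "\<bar>\<xi> - (- 13792 / 10000)\<bar> \<le> 1 / 1000" "\<bar>t0 - 8843 / 1000\<bar> \<le> 1 / 1000"
  "\<bar>\<nu> - (- 28303 / 10000)\<bar> \<le> 1 / 500" "\<bar>m0 - (- 11264 / 10000)\<bar> \<le> 1 / 500"
proof -
  note b = s_powers[unfolded abs_le_iff, THEN conjunct1] s_powers[unfolded abs_le_iff, THEN conjunct2]
  have s1: "s_root - 1 \<noteq> 0" using s_root by simp
  have e: "s_root\<^sup>2 - s_root + 1 \<noteq> 0" using b by linarith
  show "\<bar>\<xi> - (- 13792 / 10000)\<bar> \<le> 1 / 1000"
  \<comment> \<open>The last argument, 5 here and 170 and 900 below, is a lower bound for the
    denominator.\<close>
  proof (rule enclosure[of "s_root - 1" _ "- (s_root + 1)" 5])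
    show "(s_root - 1) * \<xi> = - (s_root + 1)" using s1 by (simp add: \<xi>_def)
  qed (use b in \<open>simp_all add: field_simps\<close>)
  show "\<bar>t0 - 8843 / 1000\<bar> \<le> 1 / 1000"
  proof (rule enclosure[of "s_root - 1" _ "s_root\<^sup>2 + s_root + 1" 5])
    show "(s_root - 1) * t0 = s_root\<^sup>2 + s_root + 1" using s1 by (simp add: t0_def)
  qed (use b in \<open>simp_all add: field_simps\<close>)
  show "\<bar>\<nu> - (- 28303 / 10000)\<bar> \<le> 1 / 500"
  \<comment> \<open>Numerator and denominator are expanded in powers of \<open>s_root\<close>, which
    makes the remaining goals linear in the quantities bounded by \<open>s_powers\<close>.\<close>
  proof (rule enclosure[of "s_root ^ 3 - 2 * s_root\<^sup>2 + 2 * s_root - 1" _ "- (3/2) * (s_root ^ 3 + 2 * s_root\<^sup>2 + 2 * s_root + 1)" 170])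
    have "s_root ^ 3 - 2 * s_root\<^sup>2 + 2 * s_root - 1 = (s_root\<^sup>2 - s_root + 1) * (s_root - 1)"
      "s_root ^ 3 + 2 * s_root\<^sup>2 + 2 * s_root + 1 = (s_root\<^sup>2 + s_root + 1) * (s_root + 1)"
      by (simp_all add: power2_eq_square power3_eq_cube algebra_simps)
    then show "(s_root ^ 3 - 2 * s_root\<^sup>2 + 2 * s_root - 1) * \<nu> = - (3/2) * (s_root ^ 3 + 2 * s_root\<^sup>2 + 2 * s_root + 1)"
      using s1 e by (simp add: \<nu>_def)
  qed (use b in \<open>simp_all add: field_simps\<close>)
  show "\<bar>m0 - (- 11264 / 10000)\<bar> \<le> 1 / 500"
  proof (rule enclosure[of "s_root ^ 4 - 3 * s_root ^ 3 + 4 * s_root\<^sup>2 - 3 * s_root + 1" _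
        "- (3/2) * (s_root ^ 4 - 3 * s_root ^ 3 - 2 * s_root\<^sup>2 - 3 * s_root + 1)" 900])
    have "s_root ^ 4 - 3 * s_root ^ 3 + 4 * s_root\<^sup>2 - 3 * s_root + 1 = (s_root - 1)\<^sup>2 * (s_root\<^sup>2 - s_root + 1)"
      by (simp add: power2_eq_square eval_nat_numeral algebra_simps)
    then show "(s_root ^ 4 - 3 * s_root ^ 3 + 4 * s_root\<^sup>2 - 3 * s_root + 1) * m0
        = - (3/2) * (s_root ^ 4 - 3 * s_root ^ 3 - 2 * s_root\<^sup>2 - 3 * s_root + 1)"
      using s1 e by (simp add: m0_def)
  qed (use b in \<open>simp_all add: field_simps\<close>)
qed

lemma numeric_products:
  "\<bar>t0\<^sup>2 - 78199 / 1000\<bar> \<le> 1 / 50" "\<bar>s_root * \<nu> - (- 177576 / 10000)\<bar> \<le> 1 / 50"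
  "\<bar>s_root * m0 - (- 70671 / 10000)\<bar> \<le> 1 / 50" "\<bar>\<xi> * t0 - (- 121963 / 10000)\<bar> \<le> 1 / 50"
  "\<bar>m0 * \<xi> - 155350 / 100000\<bar> \<le> 1 / 100"
proof -
  note n = numeric[unfolded abs_le_iff, THEN conjunct1] numeric[unfolded abs_le_iff, THEN conjunct2]
    s_powers(1)[unfolded abs_le_iff, THEN conjunct1] s_powers(1)[unfolded abs_le_iff, THEN conjunct2]
  have le: "\<bar>t0\<bar> \<le> 9" "\<bar>\<nu>\<bar> \<le> 3" "\<bar>m0\<bar> \<le> 2" "\<bar>\<xi>\<bar> \<le> 2"
    by (rule abs_leI; use n in linarith)+
  show "\<bar>t0\<^sup>2 - 78199 / 1000\<bar> \<le> 1 / 50"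
    using enclosure_mult[OF numeric(2) le(1)] n unfolding power2_eq_square abs_le_iff by auto
  show "\<bar>s_root * \<nu> - (- 177576 / 10000)\<bar> \<le> 1 / 50"
    using enclosure_mult[OF s_powers(1) le(2)] n unfolding abs_le_iff by auto
  show "\<bar>s_root * m0 - (- 70671 / 10000)\<bar> \<le> 1 / 50"
    using enclosure_mult[OF s_powers(1) le(3)] n unfolding abs_le_iff by auto
  show "\<bar>\<xi> * t0 - (- 121963 / 10000)\<bar> \<le> 1 / 50"
    using enclosure_mult[OF numeric(1) le(1)] n unfolding abs_le_iff by auto
  show "\<bar>m0 * \<xi> - 155350 / 100000\<bar> \<le> 1 / 100"
    using enclosure_mult[OF numeric(4) le(4)] n unfolding abs_le_iff by auto
qed

section \<open>The derivative at the fixed point\<close>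

lemma numeric_signs: "\<nu> + m0 * \<xi> < 0" "6 * \<nu> + 2 * m0 < 0" "9 * \<xi> - 3 < 0" "0 < t0"
  using numeric[unfolded abs_le_iff] numeric_products(5)[unfolded abs_le_iff] by auto

text \<open>In scaled coordinates, \<open>(\<eta>, \<zeta>, \<mu>)\<close> is the image of \<open>(x, n, m)\<close> under the return map of the
  divisor, and \<open>\<tau>\<close> the return time.\<close>

definition return_equations :: "real \<Rightarrow> real \<Rightarrow> real \<Rightarrow> real \<Rightarrow> real \<Rightarrow> real \<Rightarrow> real \<Rightarrow> bool" where
  "return_equations x n m \<tau> \<eta> \<zeta> \<mu> \<longleftrightarrow>
     6 * (n + m * x) + (6 * n + 2 * m) * \<tau> + (9 * x - 3) * \<tau>\<^sup>2 + 2 * \<tau> ^ 3 = 0 \<and>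
     (\<tau> + (3 * x - 1) / 2) * \<eta> = - (x + 1 + 2 * \<tau>) / 2 \<and>
     (\<tau> + (3 * x - 1) / 2)\<^sup>2 * \<zeta> = ((m - 3 * (\<tau> + \<tau>\<^sup>2 / 2)) - (n + 3 * (x * \<tau> + \<tau>\<^sup>2 / 2))) / 2 \<and>
     (\<tau> + (3 * x - 1) / 2)\<^sup>2 * \<mu> = - ((m - 3 * (\<tau> + \<tau>\<^sup>2 / 2)) + 3 * (n + 3 * (x * \<tau> + \<tau>\<^sup>2 / 2))) / 2"

text \<open>The derivative of \<open>return_equations\<close> at the fixed point in direction
  \<open>(\<alpha>, \<beta>, \<gamma>)\<close>: \<open>dt\<close> is the derivative of the return
  time, and the factor multiplying \<open>r\<close> has derivative
  \<open>dt + 3/2 * \<alpha>\<close>. Products such as \<open>s_root * \<nu>\<close> and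
  \<open>\<xi> * t0\<close> are kept together because they are enclosed as such.\<close>

definition linearised_equations :: "real \<Rightarrow> real \<Rightarrow> real \<Rightarrow> real \<Rightarrow> real \<Rightarrow> real \<Rightarrow> real \<Rightarrow> bool" where
  "linearised_equations \<alpha> \<beta> \<gamma> dt d2 d3 d4 \<longleftrightarrow>
     (6 * \<nu> + 2 * m0 + 2 * (9 * (\<xi> * t0) - 3 * t0) + 6 * t0\<^sup>2) * dt
       = - ((6 * m0 + 9 * t0\<^sup>2) * \<alpha> + (6 + 6 * t0) * \<beta> + (6 * \<xi> + 2 * t0) * \<gamma>) \<and>
     s_root * d2 = - (1/2 + 3/2 * \<xi>) * \<alpha> - dt * (1 + \<xi>) \<and>
     s_root\<^sup>2 * d3 = \<gamma> / 2 - \<beta> / 2 - (3/2 * t0 + 3 * (s_root * \<nu>)) * \<alpha>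
       - dt * (3/2 * (1 + \<xi> + 2 * t0) + 2 * (s_root * \<nu>)) \<and>
     s_root\<^sup>2 * d4 = - \<gamma> / 2 - 3/2 * \<beta> - (9/2 * t0 + 3 * (s_root * m0)) * \<alpha>
       + dt * (3/2 * (1 + t0) - 9/2 * (\<xi> + t0) - 2 * (s_root * m0))"

text \<open>The return time is known to solve the equations, but not to be differentiable. The
  second equation is linear in it with coefficient \<open>\<eta> + 1\<close>, nonzero near the fixed
  point; solving expresses \<open>\<tau>\<close> by the differentiable functions \<open>x\<close>
  and \<open>\<eta>\<close>, and then all four equations may be differentiated.\<close>

lemma implicit_derivative:
  fixes \<tau> \<eta> \<zeta> \<mu> :: "real \<Rightarrow> real" and \<alpha> \<beta> \<gamma> d2 d3 d4 :: real
  defines "x \<equiv> \<lambda>h. \<xi> + h * \<alpha>" and "n \<equiv> \<lambda>h. \<nu> + h * \<beta>" and "m \<equiv> \<lambda>h. m0 + h * \<gamma>"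
  assumes D: "(\<eta> has_real_derivative d2) (at 0)" "(\<zeta> has_real_derivative d3) (at 0)" "(\<mu> has_real_derivative d4) (at 0)"
    and at0: "\<eta> 0 = \<xi>" "\<zeta> 0 = \<nu>" "\<mu> 0 = m0" "\<tau> 0 = t0"
    and eqs: "\<forall>\<^sub>F h in nhds 0. return_equations (x h) (n h) (m h) (\<tau> h) (\<eta> h) (\<zeta> h) (\<mu> h)"
  obtains dt where "linearised_equations \<alpha> \<beta> \<gamma> dt d2 d3 d4"
proof -
  note ev = eqs[unfolded return_equations_def] and fp = fixed_point_equations
  have x0: "x 0 = \<xi>" "n 0 = \<nu>" "m 0 = m0" by (simp_all add: x_def n_def m_def)
  have dx: "(x has_real_derivative \<alpha>) (at 0)" "(n has_real_derivative \<beta>) (at 0)" "(m has_real_derivative \<gamma>) (at 0)"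
    unfolding x_def n_def m_def by (auto intro!: derivative_eq_intros)
  have nz: "\<xi> + 1 \<noteq> 0" using numeric(1)[unfolded abs_le_iff] by auto
  define g where "g h = - ((x h + 1) + (3 * x h - 1) * \<eta> h) / (2 * (\<eta> h + 1))" for h
  have "\<exists>dt. (g has_real_derivative dt) (at 0)"
    unfolding g_def
    by (rule exI, rule DERIV_divide, (rule derivative_eq_intros dx D refl)+) (use nz at0 in auto)
  then obtain dt where g: "(g has_real_derivative dt) (at 0)" by blast
  have "isCont \<eta> 0" using D(1) by (rule DERIV_isCont)
  then have "(\<eta> \<longlongrightarrow> \<eta> 0) (nhds 0)" unfolding isCont_def tendsto_at_iff_tendsto_nhds .
  then have "(\<eta> \<longlongrightarrow> \<xi>) (nhds 0)" unfolding at0 .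
  then have "\<forall>\<^sub>F h in nhds 0. \<eta> h \<noteq> - 1" using nz by (intro tendsto_imp_eventually_ne) auto
  then have "\<forall>\<^sub>F h in nhds 0. \<tau> h = g h"
    using ev
  proof eventually_elim
    case (elim h)
    then have "(\<tau> h + (3 * x h - 1) / 2) * \<eta> h = - (x h + 1 + 2 * \<tau> h) / 2" by blast
    moreover have "\<eta> h + 1 \<noteq> 0" using elim(1) by auto
    ultimately show ?case by (simp add: g_def field_simps)
  qed
  then have dt: "(\<tau> has_real_derivative dt) (at 0)"
    using g DERIV_cong_ev[of 0 0 \<tau> g dt dt] by simp
  have zero: "(k has_real_derivative 0) (at 0)" if "\<forall>\<^sub>F h in nhds 0. k h = 0" for k :: "real \<Rightarrow> real"
    using DERIV_cong_ev[OF refl that refl, of 0] by simp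
  note di = derivative_eq_intros dt dx D refl
  define E1 where "E1 h = 6 * (n h + m h * x h) + (6 * n h + 2 * m h) * \<tau> h + (9 * x h - 3) * (\<tau> h)\<^sup>2 + 2 * \<tau> h ^ 3" for h
  define E2 where "E2 h = (\<tau> h + (3 * x h - 1) / 2) * \<eta> h + (x h + 1 + 2 * \<tau> h) / 2" for h
  define E3 where "E3 h = (\<tau> h + (3 * x h - 1) / 2)\<^sup>2 * \<zeta> h
      - ((m h - 3 * (\<tau> h + (\<tau> h)\<^sup>2 / 2)) - (n h + 3 * (x h * \<tau> h + (\<tau> h)\<^sup>2 / 2))) / 2" for h
  define E4 where "E4 h = (\<tau> h + (3 * x h - 1) / 2)\<^sup>2 * \<mu> h
      + ((m h - 3 * (\<tau> h + (\<tau> h)\<^sup>2 / 2)) + 3 * (n h + 3 * (x h * \<tau> h + (\<tau> h)\<^sup>2 / 2))) / 2" for h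
  have \<rho>: "\<tau> 0 + (3 * x 0 - 1) / 2 = s_root" using fp(2) by (simp add: x0 at0)
  have Z: "(E1 has_real_derivative 0) (at 0)" "(E2 has_real_derivative 0) (at 0)"
    "(E3 has_real_derivative 0) (at 0)" "(E4 has_real_derivative 0) (at 0)"
    by (rule zero, rule eventually_mono[OF ev], elim conjE, simp only: E1_def E2_def E3_def E4_def, linarith?)+
  have E1: "(E1 has_real_derivative (6 * (\<beta> + (\<gamma> * x 0 + m 0 * \<alpha>)) + ((6 * \<beta> + 2 * \<gamma>) * \<tau> 0 + (6 * n 0 + 2 * m 0) * dt)
      + (9 * \<alpha> * (\<tau> 0)\<^sup>2 + (9 * x 0 - 3) * (2 * \<tau> 0 * dt)) + 2 * (3 * (\<tau> 0)\<^sup>2 * dt))) (at 0)"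
    unfolding E1_def by (rule di)+ (simp add: algebra_simps)
  have E2: "(E2 has_real_derivative ((dt + 3 * \<alpha> / 2) * \<eta> 0 + (\<tau> 0 + (3 * x 0 - 1) / 2) * d2 + (\<alpha> + 2 * dt) / 2)) (at 0)"
    unfolding E2_def by ((rule di | simp)+, (simp add: field_simps)?)
  have E3: "(E3 has_real_derivative (2 * (\<tau> 0 + (3 * x 0 - 1) / 2) * (dt + 3 * \<alpha> / 2) * \<zeta> 0 + (\<tau> 0 + (3 * x 0 - 1) / 2)\<^sup>2 * d3
      - ((\<gamma> - 3 * (dt + \<tau> 0 * dt)) - (\<beta> + 3 * (\<alpha> * \<tau> 0 + x 0 * dt + \<tau> 0 * dt))) / 2)) (at 0)"
    unfolding E3_def by ((rule di | simp)+, (simp add: field_simps)?)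
  have E4: "(E4 has_real_derivative (2 * (\<tau> 0 + (3 * x 0 - 1) / 2) * (dt + 3 * \<alpha> / 2) * \<mu> 0 + (\<tau> 0 + (3 * x 0 - 1) / 2)\<^sup>2 * d4
      + ((\<gamma> - 3 * (dt + \<tau> 0 * dt)) + 3 * (\<beta> + 3 * (\<alpha> * \<tau> 0 + x 0 * dt + \<tau> 0 * dt))) / 2)) (at 0)"
    unfolding E4_def by ((rule di | simp)+, (simp add: field_simps)?)
  show ?thesis
  proof (rule that[of dt], unfold linearised_equations_def, intro conjI, goal_cases)
    case 1
    show ?case using DERIV_unique[OF E1 Z(1)] unfolding x0 at0 by (simp add: algebra_simps)
  next
    case 2
    show ?case using DERIV_unique[OF E2 Z(2)] unfolding \<rho> unfolding at0 by (simp add: field_simps)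
  next
    case 3
    show ?case using DERIV_unique[OF E3 Z(3)] unfolding \<rho> unfolding x0 at0 by (simp add: field_simps)
  next
    case 4
    show ?case using DERIV_unique[OF E4 Z(4)] unfolding \<rho> unfolding x0 at0 by (simp add: field_simps)
  qed
qed

text \<open>Cancellation dictates the accuracy: in direction \<open>(1, 0, 0)\<close> the right side
  of the third equation is a difference of about 40.0 and 37.5. So \<open>dt\<close> is enclosed
  first, to within 1/40, and its products are handled by \<open>enclosure_mult\<close>.\<close>

lemma derivative_bounds:
  fixes \<alpha> \<beta> \<gamma> :: real
  assumes lin: "linearised_equations \<alpha> \<beta> \<gamma> dt d2 d3 d4"
    and cases: "(\<alpha>, \<beta>, \<gamma>) \<in> {(1, 0, 0), (0, 1, 0), (0, 0, 1)}"
  shows "\<bar>d2\<bar> \<le> 1/8" "\<bar>d3\<bar> \<le> 1/8" "\<bar>d4\<bar> \<le> 1/8"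
proof -
  from lin have dt: "(6 * \<nu> + 2 * m0 + 2 * (9 * (\<xi> * t0) - 3 * t0) + 6 * t0\<^sup>2) * dt
       = - ((6 * m0 + 9 * t0\<^sup>2) * \<alpha> + (6 + 6 * t0) * \<beta> + (6 * \<xi> + 2 * t0) * \<gamma>)"
    and d2: "s_root * d2 = - (1/2 + 3/2 * \<xi>) * \<alpha> - dt * (1 + \<xi>)"
    and d3: "s_root\<^sup>2 * d3 = \<gamma> / 2 - \<beta> / 2 - (3/2 * t0 + 3 * (s_root * \<nu>)) * \<alpha>
      - dt * (3/2 * (1 + \<xi> + 2 * t0) + 2 * (s_root * \<nu>))"
    and d4: "s_root\<^sup>2 * d4 = - \<gamma> / 2 - 3/2 * \<beta> - (9/2 * t0 + 3 * (s_root * m0)) * \<alpha>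
      + dt * (3/2 * (1 + t0) - 9/2 * (\<xi> + t0) - 2 * (s_root * m0))"
    unfolding linearised_equations_def by blast+
  note n = numeric[unfolded abs_le_iff, THEN conjunct1] numeric[unfolded abs_le_iff, THEN conjunct2]
    numeric_products[unfolded abs_le_iff, THEN conjunct1] numeric_products[unfolded abs_le_iff, THEN conjunct2]
  have cases': "\<alpha> = 1 \<and> \<beta> = 0 \<and> \<gamma> = 0 \<or> \<alpha> = 0 \<and> \<beta> = 1 \<and> \<gamma> = 0 \<or> \<alpha> = 0 \<and> \<beta> = 0 \<and> \<gamma> = 1"
    using cases by simp
  \<comment> \<open>The approximate solution \<open>dt\<close> of the first equation, with
    coefficients near 697/177.4, 59.1/177.4 and 9.4/177.4. The 176 below is a lower bound for the
    factor of \<open>dt\<close>.\<close>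
  define c where "c = - (393/100) * \<alpha> - 333/1000 * \<beta> - 53/1000 * \<gamma>"
  have t: "\<bar>dt - c\<bar> \<le> 1/40"
  proof (rule enclosure[OF dt, of 176])
    show "176 \<le> 6 * \<nu> + 2 * m0 + 2 * (9 * (\<xi> * t0) - 3 * t0) + 6 * t0\<^sup>2"
      using n(2-4,6-9,12,14,17) by (simp add: field_simps)
  qed (use n(1-9,12,14,17) cases' in \<open>auto simp: c_def field_simps\<close>)
  define z2 z3 z4 where "z2 = 1 + \<xi>" and "z3 = 3/2 * (1 + \<xi> + 2 * t0) + 2 * (s_root * \<nu>)"
    and "z4 = 3/2 * (1 + t0) - 9/2 * (\<xi> + t0) - 2 * (s_root * m0)"
  have z: "- (381/1000) \<le> z2" "z2 \<le> - (378/1000)" "- (962/100) \<le> z3" "z3 \<le> - (949/100)" "- (478/100) \<le> z4" "z4 \<le> - (460/100)"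
    using n by (simp_all add: z2_def z3_def z4_def field_simps)
  have zz: "\<bar>z2\<bar> \<le> 1/2" "\<bar>z3\<bar> \<le> 10" "\<bar>z4\<bar> \<le> 5" using z by (simp_all add: abs_le_iff)
  note p = enclosure_mult[OF t zz(1)] enclosure_mult[OF t zz(2)] enclosure_mult[OF t zz(3)]
  note p = p[unfolded abs_le_iff, THEN conjunct1] p[unfolded abs_le_iff, THEN conjunct2]
  have s6: "6 \<le> s_root" using s_root(2) by simp
  have s2: "39 \<le> s_root\<^sup>2" using s_powers(2)[unfolded abs_le_iff] by auto
  have div: "\<bar>d\<bar> \<le> 1/8" if "A * d = B" "A \<ge> a" "a > 0" "B \<le> a / 8" "- B \<le> a / 8" for A a d B :: real
    using enclosure[OF that(1,3,2), of 0 "1/8"] that(4,5) by simp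
  show "\<bar>d2\<bar> \<le> 1/8"
    using cases'
  proof (elim disjE conjE)
    assume c: "\<alpha> = 1" "\<beta> = 0" "\<gamma> = 0"
    show ?thesis
      by (rule div[OF d2[folded z2_def] s6])
        (use p(1,4) z(1,2) n(1,5) in \<open>simp_all add: c c_def field_simps\<close>)
  next
    assume c: "\<alpha> = 0" "\<beta> = 1" "\<gamma> = 0"
    show ?thesis
      by (rule div[OF d2[folded z2_def] s6])
        (use p(1,4) z(1,2) n(1,5) in \<open>simp_all add: c c_def field_simps\<close>)
  next
    assume c: "\<alpha> = 0" "\<beta> = 0" "\<gamma> = 1"
    show ?thesis
      by (rule div[OF d2[folded z2_def] s6])
        (use p(1,4) z(1,2) n(1,5) in \<open>simp_all add: c c_def field_simps\<close>)
  qed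
  show "\<bar>d3\<bar> \<le> 1/8"
    using cases'
  proof (elim disjE conjE)
    assume c: "\<alpha> = 1" "\<beta> = 0" "\<gamma> = 0"
    show ?thesis
      by (rule div[OF d3[folded z3_def] s2])
        (use p(2,5) z(3,4) n(2,6,10,15) in \<open>simp_all add: c c_def field_simps\<close>)
  next
    assume c: "\<alpha> = 0" "\<beta> = 1" "\<gamma> = 0"
    show ?thesis
      by (rule div[OF d3[folded z3_def] s2])
        (use p(2,5) z(3,4) n(2,6,10,15) in \<open>simp_all add: c c_def field_simps\<close>)
  next
    assume c: "\<alpha> = 0" "\<beta> = 0" "\<gamma> = 1"
    show ?thesis
      by (rule div[OF d3[folded z3_def] s2])
        (use p(2,5) z(3,4) n(2,6,10,15) in \<open>simp_all add: c c_def field_simps\<close>)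
  qed
  show "\<bar>d4\<bar> \<le> 1/8"
    using cases'
  proof (elim disjE conjE)
    assume c: "\<alpha> = 1" "\<beta> = 0" "\<gamma> = 0"
    show ?thesis
      by (rule div[OF d4[folded z4_def] s2])
        (use p(3,6) z(5,6) n(2,6,11,16) in \<open>simp_all add: c c_def field_simps\<close>)
  next
    assume c: "\<alpha> = 0" "\<beta> = 1" "\<gamma> = 0"
    show ?thesis
      by (rule div[OF d4[folded z4_def] s2])
        (use p(3,6) z(5,6) n(2,6,11,16) in \<open>simp_all add: c c_def field_simps\<close>)
  next
    assume c: "\<alpha> = 0" "\<beta> = 0" "\<gamma> = 1"
    show ?thesis
      by (rule div[OF d4[folded z4_def] s2])
        (use p(3,6) z(5,6) n(2,6,11,16) in \<open>simp_all add: c c_def field_simps\<close>)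
  qed
qed

text \<open>Measuring \<open>x\<close> and \<open>l\<close> in units of \<open>sqrt 3\<close>
  removes the square roots from the equations and turns \<open>\<rho>\<close> into
  \<open>\<tau> + (3 * x - 1) / 2\<close>.\<close>

lemma scaled_divisor_map:
  assumes ext: "reinhardt_poincare_extension U F" and cont: "isCont F (vector [0, sqrt 3 * x, sqrt 3 * n, m])"
    and q: "vector [0, sqrt 3 * x, sqrt 3 * n, m] \<in> U"
    and signs: "n + m * x < 0" "6 * n + 2 * m < 0" "9 * x - 3 < 0"
  obtains \<tau> where "0 < \<tau>"
    "((\<lambda>r. F (vector [r, sqrt 3 * x, sqrt 3 * n, m]) $ 1 / r) \<longlongrightarrow> \<tau> + (3 * x - 1) / 2) (at_right 0)"
    "return_equations x n m \<tau> (F (vector [0, sqrt 3 * x, sqrt 3 * n, m]) $ 2 / sqrt 3)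
       (F (vector [0, sqrt 3 * x, sqrt 3 * n, m]) $ 3 / sqrt 3) (F (vector [0, sqrt 3 * x, sqrt 3 * n, m]) $ 4)"
proof -
  have s: "sqrt 3 > 0" and ss: "sqrt 3 * sqrt 3 = 3" by simp_all
  have "sqrt 3 * n + m * (sqrt 3 * x) = sqrt 3 * (n + m * x)" "6 * (sqrt 3 * n) + 2 * sqrt 3 * m = sqrt 3 * (6 * n + 2 * m)"
    "9 * (sqrt 3 * x) - 3 * sqrt 3 = sqrt 3 * (9 * x - 3)" by (simp_all add: algebra_simps)
  then have sg: "sqrt 3 * n + m * (sqrt 3 * x) < 0" "6 * (sqrt 3 * n) + 2 * sqrt 3 * m < 0" "9 * (sqrt 3 * x) - 3 * sqrt 3 < 0"
    using signs s by (simp_all only: mult_less_0_iff) auto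
  obtain \<tau> where \<tau>: "0 < \<tau>" "switching_cubic (sqrt 3 * x) (sqrt 3 * n) m \<tau> = 0"
    using switching_cubic_root[OF sg(1)] by blast
  note dm = divisor_map[OF ext cont q sg \<tau>]
  have \<rho>: "- (1 + \<tau>) / 2 + sqrt 3 / 2 * (sqrt 3 * x + sqrt 3 * \<tau>) = \<tau> + (3 * x - 1) / 2"
  proof -
    have "r / 2 * (r * x + r * \<tau>) = (r * r) * (x + \<tau>) / 2" for r :: real by (simp add: field_simps)
    from this[of "sqrt 3"] show ?thesis unfolding ss by (simp add: field_simps)
  qed
  have "switching_cubic (sqrt 3 * x) (sqrt 3 * n) m \<tau>
      = sqrt 3 * (6 * (n + m * x) + (6 * n + 2 * m) * \<tau> + (9 * x - 3) * \<tau>\<^sup>2 + 2 * \<tau> ^ 3)"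
    by (simp add: switching_cubic_def algebra_simps)
  with \<tau>(2) s have c: "6 * (n + m * x) + (6 * n + 2 * m) * \<tau> + (9 * x - 3) * \<tau>\<^sup>2 + 2 * \<tau> ^ 3 = 0" by simp
  have l: "l11_flow (sqrt 3 * x) (sqrt 3 * n) \<tau> = sqrt 3 * (n + 3 * (x * \<tau> + \<tau>\<^sup>2 / 2))"
    by (simp add: l11_flow_def algebra_simps)
  show ?thesis
  proof (rule that[OF \<tau>(1)])
    show "((\<lambda>r. F (vector [r, sqrt 3 * x, sqrt 3 * n, m]) $ 1 / r) \<longlongrightarrow> \<tau> + (3 * x - 1) / 2) (at_right 0)"
      using dm(1) unfolding \<rho> .
    have k: "sqrt 3 / 2 * (sqrt 3 * y) = 3 / 2 * y" for y using ss by simp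
    show "return_equations x n m \<tau> (F (vector [0, sqrt 3 * x, sqrt 3 * n, m]) $ 2 / sqrt 3)
       (F (vector [0, sqrt 3 * x, sqrt 3 * n, m]) $ 3 / sqrt 3) (F (vector [0, sqrt 3 * x, sqrt 3 * n, m]) $ 4)"
      unfolding return_equations_def
    proof (intro conjI c, goal_cases)
      case 1
      show ?case using dm(2) s unfolding \<rho> by (simp add: divide_simps) (simp add: algebra_simps)
    next
      case 2
      show ?case using dm(3) s unfolding \<rho> l l21_flow_def times_divide_eq_right by (simp add: field_simps)
    next
      case 3
      show ?case using dm(4) unfolding \<rho> l l21_flow_def k by (simp add: field_simps)
    qed
  qed
qed

lemma cubic_root_t0:
  assumes t: "0 < t" and eqs: "return_equations \<xi> \<nu> m0 t \<eta> \<zeta> \<mu>"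
  shows "t = t0"
proof -
  have sc: "switching_cubic (sqrt 3 * \<xi>) (sqrt 3 * \<nu>) m0 t
      = sqrt 3 * (6 * (\<nu> + m0 * \<xi>) + (6 * \<nu> + 2 * m0) * t + (9 * \<xi> - 3) * t\<^sup>2 + 2 * t ^ 3)" for t
    by (simp add: switching_cubic_def algebra_simps)
  have e: "sqrt 3 * \<nu> + m0 * (sqrt 3 * \<xi>) = sqrt 3 * (\<nu> + m0 * \<xi>)"
    "6 * (sqrt 3 * \<nu>) + 2 * sqrt 3 * m0 = sqrt 3 * (6 * \<nu> + 2 * m0)"
    "9 * (sqrt 3 * \<xi>) - 3 * sqrt 3 = sqrt 3 * (9 * \<xi> - 3)" by (simp_all add: algebra_simps)
  show ?thesis
  proof (rule switching_cubic_root_unique)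
    show "sqrt 3 * \<nu> + m0 * (sqrt 3 * \<xi>) < 0"
      unfolding e by (rule mult_pos_neg) (simp_all add: numeric_signs)
    show "6 * (sqrt 3 * \<nu>) + 2 * sqrt 3 * m0 < 0"
      unfolding e by (rule mult_pos_neg) (use numeric_signs(2) in simp_all)
    show "9 * (sqrt 3 * \<xi>) - 3 * sqrt 3 < 0"
      unfolding e by (rule mult_pos_neg) (use numeric_signs(3) in simp_all)
    show "switching_cubic (sqrt 3 * \<xi>) (sqrt 3 * \<nu>) m0 t = 0" using eqs unfolding sc return_equations_def by simp
    show "switching_cubic (sqrt 3 * \<xi>) (sqrt 3 * \<nu>) m0 t0 = 0"
      unfolding sc fixed_point_equations(1) by simp
  qed (fact t numeric_signs(4))+
qed

text \<open>The row condition forces \<open>c = \<mu>\<close> if the eigenvector has a nonzero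
  \<open>a\<close>-component. Otherwise it lies in the complexified hyperplane, where the column
  sums give \<open>cmod c \<le> \<kappa>\<close>.\<close>

lemma hyperbolic_saddle_matrix:
  fixes T :: "real^'n^'n"
  assumes row: "\<And>j. T $ a $ j = (if j = a then \<mu> else 0)" and \<mu>: "\<mu> > 1"
    and columns: "\<And>j. j \<noteq> a \<Longrightarrow> (\<Sum>i\<in>UNIV. \<bar>T $ i $ j\<bar>) \<le> \<kappa>" and \<kappa>: "\<kappa> < 1"
    and c: "complex_eigenvalue ((*v) T) c"
  shows "cmod c \<noteq> 1"
proof -
  obtain v where v: "v \<noteq> 0" and eig: "(\<chi> i j. complex_of_real (T $ i $ j)) *v v = c *s v"
    using c by (auto simp: complex_eigenvalue_def)
  have eq: "(\<Sum>j\<in>UNIV. complex_of_real (T $ i $ j) * v $ j) = c * v $ i" for i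
    using eig by (simp add: vec_eq_iff matrix_vector_mult_def)
  show ?thesis
  proof (cases "v $ a = 0")
    case False
    have "(\<Sum>j\<in>UNIV. complex_of_real (T $ a $ j) * v $ j) = complex_of_real \<mu> * v $ a"
      by (subst sum.remove[of _ a]) (auto simp: row intro!: sum.neutral)
    with eq[of a] False have "c = complex_of_real \<mu>" by simp
    then show ?thesis using \<mu> by simp
  next
    case True
    define S where "S = (\<Sum>i\<in>UNIV. cmod (v $ i))"
    have "cmod c * S = (\<Sum>i\<in>UNIV. cmod (\<Sum>j\<in>UNIV. complex_of_real (T $ i $ j) * v $ j))"
      by (simp add: eq S_def sum_distrib_left norm_mult)
    also have "\<dots> \<le> (\<Sum>i\<in>UNIV. \<Sum>j\<in>UNIV. \<bar>T $ i $ j\<bar> * cmod (v $ j))"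
      by (intro sum_mono order_trans[OF norm_sum]) (simp add: norm_mult)
    also have "\<dots> = (\<Sum>j\<in>UNIV. (\<Sum>i\<in>UNIV. \<bar>T $ i $ j\<bar>) * cmod (v $ j))"
      by (subst sum.swap) (simp add: sum_distrib_right)
    also have "\<dots> \<le> (\<Sum>j\<in>UNIV. \<kappa> * cmod (v $ j))"
    proof (intro sum_mono)
      fix j
      show "(\<Sum>i\<in>UNIV. \<bar>T $ i $ j\<bar>) * cmod (v $ j) \<le> \<kappa> * cmod (v $ j)"
        using columns[of j] True by (cases "j = a") (auto intro: mult_right_mono)
    qed
    finally have le: "cmod c * S \<le> \<kappa> * S" by (simp add: S_def sum_distrib_left)
    have "S \<noteq> 0"
    proof
      assume "S = 0"
      then have "v $ i = 0" for i using member_le_sum[of i UNIV "\<lambda>i. cmod (v $ i)"] by (simp add: S_def)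
      with v show False by (simp add: vec_eq_iff)
    qed
    moreover have "S \<ge> 0" by (simp add: S_def sum_nonneg)
    ultimately have "cmod c \<le> \<kappa>" using le by (simp add: mult_le_cancel_right)
    then show ?thesis using \<kappa> by simp
  qed
qed

lemma poincare_derivative:
  assumes ext: "reinhardt_poincare_extension U F"
  obtains T where "F q_out = q_out" "(F has_derivative (*v) T) (at q_out)"
    "\<And>j. T $ 1 $ j = (if j = 1 then s_root else 0)" "\<And>j. j \<noteq> 1 \<Longrightarrow> (\<Sum>i\<in>UNIV. \<bar>T $ i $ j\<bar>) \<le> 3/4"
proof -
  have U: "open U" "q_out \<in> U" and an: "real_analytic_on F U"
    and img: "F ` {q \<in> U. q $ 1 = 0} = {q \<in> F ` U. q $ 1 = 0}"
    using ext by (simp_all add: reinhardt_poincare_extension_def analytic_diffeomorphism_on_def)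
  have inv: "F q $ 1 = 0" if "q \<in> U" "q $ 1 = 0" for q
    using img that by blast
  have cont: "isCont F q" if "q \<in> U" for q
    using real_analytic_on_has_derivative[OF an U(1) that] has_derivative_continuous by metis
  obtain T where T: "(F has_derivative (*v) T) (at q_out)"
    using real_analytic_on_has_derivative[OF an U] by blast
  define V where "V x n m = (vector [0, sqrt 3 * x, sqrt 3 * n, m] :: real^4)" for x n m
  have q_out: "q_out = V \<xi> \<nu> m0" by (simp add: q_out_eq V_def)
  note signs = numeric_signs(1-3)
  obtain t where t: "0 < t"
    "((\<lambda>r. F (vector [r, sqrt 3 * \<xi>, sqrt 3 * \<nu>, m0]) $ 1 / r) \<longlongrightarrow> t + (3 * \<xi> - 1) / 2) (at_right 0)"
    "return_equations \<xi> \<nu> m0 t (F (vector [0, sqrt 3 * \<xi>, sqrt 3 * \<nu>, m0]) $ 2 / sqrt 3) (F (vector [0, sqrt 3 * \<xi>, sqrt 3 * \<nu>, m0]) $ 3 / sqrt 3) (F (vector [0, sqrt 3 * \<xi>, sqrt 3 * \<nu>, m0]) $ 4)"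
    by (rule scaled_divisor_map[OF ext cont[OF U(2), unfolded q_out_eq] U(2)[unfolded q_out_eq] signs])
  note R = t(2)
  have t0: "t = t0" using t(1,3) by (rule cubic_root_t0)
  \<comment> \<open>At \<open>t0\<close> the image coordinates satisfy the same equations as those
    of \<open>q_out\<close>, with the nonzero factors \<open>s_root\<close> and its square;
    cancelling them proves that the point is fixed.\<close>
  have eqs: "s_root * (F q_out $ 2 / sqrt 3) = s_root * \<xi>" "s_root\<^sup>2 * (F q_out $ 3 / sqrt 3) = s_root\<^sup>2 * \<nu>"
    "s_root\<^sup>2 * F q_out $ 4 = s_root\<^sup>2 * m0"
    using t(3) unfolding return_equations_def t0 fixed_point_equations q_out_eq by blast+
  note fp = fixed_point_equations
  have s: "s_root > 1" using s_root by simp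
  have F2: "F q_out $ 2 / sqrt 3 = \<xi>" and F3: "F q_out $ 3 / sqrt 3 = \<nu>" and F4: "F q_out $ 4 = m0"
    using eqs s by (simp_all only: mult_cancel_left) simp_all
  have F1: "F q_out $ 1 = 0" by (rule inv[OF U(2)]) (simp add: q_out_eq)
  have fixed: "F q_out = q_out"
    using F1 F2 F3 F4 by (simp add: q_out_eq vec_eq_iff forall_4 field_simps)

  have dir: "((\<lambda>h. F (q_out + h *\<^sub>R w) $ i) has_real_derivative (T *v w) $ i) (at 0)" for w i
  proof -
    have "((\<lambda>h. q_out + h *\<^sub>R w) has_derivative (\<lambda>h. h *\<^sub>R w)) (at 0)"
      by (auto intro!: derivative_eq_intros)
    then have "((\<lambda>h. F (q_out + h *\<^sub>R w)) has_derivative (\<lambda>h. T *v (h *\<^sub>R w))) (at 0)"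
      by (rule has_derivative_compose) (use T in simp)
    from bounded_linear.has_derivative[OF bounded_linear_vec_nth this, of i]
    show ?thesis
      by (simp add: has_field_derivative_def matrix_vector_mult_scaleR mult_commute_abs)
  qed
  \<comment> \<open>The derivative exists, so this entry can be read off from the one-sided limit
    over \<open>r > 0\<close>, the only side on which the trajectories give information.\<close>
  have T11: "T $ 1 $ 1 = s_root"
  proof -
    have col: "(T *v axis 1 1) $ 1 = T $ 1 $ 1" by (simp add: matrix_vector_mult_basis column_def)
    have "((\<lambda>h. (F (q_out + h *\<^sub>R axis 1 1) $ 1 - 0) / h) \<longlongrightarrow> T $ 1 $ 1) (at 0)"
      using dir[of "axis 1 1" 1] F1 unfolding DERIV_def col by simp
    then have "((\<lambda>h. F (q_out + h *\<^sub>R axis 1 1) $ 1 / h) \<longlongrightarrow> T $ 1 $ 1) (at_right 0)"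
      by (auto intro: filterlim_at_within_If tendsto_within_subset)
    moreover have "q_out + h *\<^sub>R axis 1 1 = vector [h, sqrt 3 * \<xi>, sqrt 3 * \<nu>, m0]" for h
      by (simp add: q_out_eq vec_eq_iff forall_4 axis_def)
    ultimately have "((\<lambda>h. F (vector [h, sqrt 3 * \<xi>, sqrt 3 * \<nu>, m0]) $ 1 / h) \<longlongrightarrow> T $ 1 $ 1) (at_right 0)"
      by simp
    from tendsto_unique[OF _ this R] show ?thesis using t0 fp(2) by simp
  qed

  \<comment> \<open>Along the divisor the first coordinate stays 0. The other derivatives are tested
    in three directions spanning the divisor, through \<open>implicit_derivative\<close>.\<close>
  have near: "(T *v w) $ 1 = 0" "\<bar>(T *v w) $ 2 / sqrt 3\<bar> \<le> 1/8" "\<bar>(T *v w) $ 3 / sqrt 3\<bar> \<le> 1/8" "\<bar>(T *v w) $ 4\<bar> \<le> 1/8"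
    if w: "w = vector [0, sqrt 3 * \<alpha>, sqrt 3 * \<beta>, \<gamma>]" and cases: "(\<alpha>, \<beta>, \<gamma>) \<in> {(1, 0, 0), (0, 1, 0), (0, 0, 1)}"
    for w \<alpha> \<beta> \<gamma>
  proof -
    have path: "q_out + h *\<^sub>R w = V (\<xi> + h * \<alpha>) (\<nu> + h * \<beta>) (m0 + h * \<gamma>)" for h
      by (simp add: q_out V_def w vec_eq_iff forall_4 algebra_simps)
    have lim: "((\<lambda>h. q_out + h *\<^sub>R w) \<longlongrightarrow> q_out + 0 *\<^sub>R w) (nhds 0)"
      by (intro tendsto_intros filterlim_ident)
    have evU: "\<forall>\<^sub>F h in nhds 0. q_out + h *\<^sub>R w \<in> U"
      using topological_tendstoD[OF lim U(1)] U(2) by simp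
    have l: "((\<lambda>h. \<xi> + h * \<alpha>) \<longlongrightarrow> \<xi> + 0 * \<alpha>) (nhds 0)" "((\<lambda>h. \<nu> + h * \<beta>) \<longlongrightarrow> \<nu> + 0 * \<beta>) (nhds 0)"
      "((\<lambda>h. m0 + h * \<gamma>) \<longlongrightarrow> m0 + 0 * \<gamma>) (nhds 0)"
      by (intro tendsto_intros filterlim_ident)+
    have ev: "\<forall>\<^sub>F h in nhds 0. q_out + h *\<^sub>R w \<in> U \<and>
        (\<nu> + h * \<beta>) + (m0 + h * \<gamma>) * (\<xi> + h * \<alpha>) < 0 \<and> 6 * (\<nu> + h * \<beta>) + 2 * (m0 + h * \<gamma>) < 0 \<and> 9 * (\<xi> + h * \<alpha>) - 3 < 0"
      using signs
      by (intro eventually_conj evU order_tendstoD(2)[OF tendsto_add[OF l(2) tendsto_mult[OF l(3,1)]]]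
          order_tendstoD(2)[OF tendsto_add[OF tendsto_mult[OF tendsto_const l(2)] tendsto_mult[OF tendsto_const l(3)]]]
          order_tendstoD(2)[OF tendsto_diff[OF tendsto_mult[OF tendsto_const l(1)] tendsto_const]]) simp_all
    have "(T *v w) $ 1 = 0"
    proof (rule DERIV_unique[OF dir])
      have "\<forall>\<^sub>F h in nhds 0. F (q_out + h *\<^sub>R w) $ 1 = 0"
        using evU by eventually_elim (auto intro!: inv simp: q_out_eq w)
      then show "((\<lambda>h. F (q_out + h *\<^sub>R w) $ 1) has_real_derivative 0) (at 0)"
        using DERIV_cong_ev[OF refl _ refl, of "\<lambda>h. F (q_out + h *\<^sub>R w) $ 1" "\<lambda>h. 0" 0 0] by simp
    qed
    define Q where "Q h \<tau> \<longleftrightarrow> 0 < \<tau> \<and> return_equations (\<xi> + h * \<alpha>) (\<nu> + h * \<beta>) (m0 + h * \<gamma>) \<tau>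
      (F (q_out + h *\<^sub>R w) $ 2 / sqrt 3) (F (q_out + h *\<^sub>R w) $ 3 / sqrt 3) (F (q_out + h *\<^sub>R w) $ 4)" for h \<tau>
    \<comment> \<open>Again a mere choice for each \<open>h\<close>: regularity comes from
      \<open>implicit_derivative\<close>, the value at 0 from uniqueness of the positive
      root.\<close>
    define \<tau> where "\<tau> h = (SOME t. Q h t)" for h
    have Q: "\<forall>\<^sub>F h in nhds 0. Q h (\<tau> h)"
      using ev
    proof eventually_elim
      case (elim h)
      have "q_out + h *\<^sub>R w \<in> U" "isCont F (q_out + h *\<^sub>R w)" using elim cont by blast+
      note * = this[unfolded path V_def]
      have "\<exists>t. Q h t"
      proof (rule scaled_divisor_map[OF ext *(2,1)])
        fix t
        assume "0 < t" "return_equations (\<xi> + h * \<alpha>) (\<nu> + h * \<beta>) (m0 + h * \<gamma>) t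
          (F (vector [0, sqrt 3 * (\<xi> + h * \<alpha>), sqrt 3 * (\<nu> + h * \<beta>), m0 + h * \<gamma>]) $ 2 / sqrt 3)
          (F (vector [0, sqrt 3 * (\<xi> + h * \<alpha>), sqrt 3 * (\<nu> + h * \<beta>), m0 + h * \<gamma>]) $ 3 / sqrt 3)
          (F (vector [0, sqrt 3 * (\<xi> + h * \<alpha>), sqrt 3 * (\<nu> + h * \<beta>), m0 + h * \<gamma>]) $ 4)"
        then have "Q h t" unfolding Q_def path V_def by (intro conjI)
        then show ?thesis by blast
      qed (use elim in blast)+
      then show ?case unfolding \<tau>_def by (rule someI_ex)
    qed
    have "Q 0 (\<tau> 0)" using eventually_nhds_x_imp_x[OF Q] .
    then have tau0: "\<tau> 0 = t0" unfolding Q_def by (intro cubic_root_t0) auto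
    note d2 = DERIV_cdivide[OF dir[of w 2], of "sqrt 3"] and d3 = DERIV_cdivide[OF dir[of w 3], of "sqrt 3"]
    have v0: "F (q_out + 0 *\<^sub>R w) $ 2 / sqrt 3 = \<xi>" "F (q_out + 0 *\<^sub>R w) $ 3 / sqrt 3 = \<nu>" "F (q_out + 0 *\<^sub>R w) $ 4 = m0"
      using F2 F3 F4 by simp_all
    obtain dt where "linearised_equations \<alpha> \<beta> \<gamma> dt ((T *v w) $ 2 / sqrt 3) ((T *v w) $ 3 / sqrt 3) ((T *v w) $ 4)"
      by (rule implicit_derivative[where \<eta> = "\<lambda>h. F (q_out + h *\<^sub>R w) $ 2 / sqrt 3"
            and \<zeta> = "\<lambda>h. F (q_out + h *\<^sub>R w) $ 3 / sqrt 3" and \<mu> = "\<lambda>h. F (q_out + h *\<^sub>R w) $ 4"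
            and \<tau> = \<tau> and \<alpha> = \<alpha> and \<beta> = \<beta> and \<gamma> = \<gamma>, OF d2 d3 dir[of w 4] v0 tau0])
        (rule eventually_mono[OF Q], simp add: Q_def)
    from derivative_bounds[OF this cases] \<open>(T *v w) $ 1 = 0\<close>
    show "(T *v w) $ 1 = 0" "\<bar>(T *v w) $ 2 / sqrt 3\<bar> \<le> 1/8" "\<bar>(T *v w) $ 3 / sqrt 3\<bar> \<le> 1/8" "\<bar>(T *v w) $ 4\<bar> \<le> 1/8"
      by auto
  qed
  have s3: "1 \<le> sqrt 3" "sqrt 3 \<le> 2" by (simp_all add: real_le_lsqrt)
  have cols: "(T *v vector [0, sqrt 3 * 1, sqrt 3 * 0, 0]) $ i = sqrt 3 * T $ i $ 2"
    "(T *v vector [0, sqrt 3 * 0, sqrt 3 * 1, 0]) $ i = sqrt 3 * T $ i $ 3"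
    "(T *v vector [0, sqrt 3 * 0, sqrt 3 * 0, 1]) $ i = T $ i $ 4" for i
    by (simp_all add: matrix_vector_mult_def sum_4)
  let ?B = "{(1, 0, 0), (0, 1, 0), (0, 0, 1)} :: (real \<times> real \<times> real) set"
  have unit: "(1, 0, 0) \<in> ?B" "(0, 1, 0) \<in> ?B" "(0, 0, 1) \<in> ?B" by simp_all
  note n2 = near[OF refl unit(1), unfolded cols] and n3 = near[OF refl unit(2), unfolded cols]
    and n4 = near[OF refl unit(3), unfolded cols]
  have small: "\<bar>x\<bar> \<le> 1/8" if "\<bar>sqrt 3 * x\<bar> \<le> 1/8" for x
  proof -
    have "1 * \<bar>x\<bar> \<le> sqrt 3 * \<bar>x\<bar>" using s3 by (intro mult_right_mono) auto
    then show ?thesis using that by (simp add: abs_mult)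
  qed
  have big: "\<bar>x\<bar> \<le> 1/4" if "\<bar>x / sqrt 3\<bar> \<le> 1/8" for x
  proof -
    have "\<bar>x\<bar> \<le> sqrt 3 * (1/8)" using that by (simp add: field_simps)
    then show ?thesis using s3 by linarith
  qed
  \<comment> \<open>Undoing the scaling with \<open>1 \<le> sqrt 3 \<le> 2\<close> worsens only two
    entries of column 4, to 1/4; the column sums are then at most 5/8.\<close>
  have b: "\<bar>T $ 2 $ 2\<bar> \<le> 1/8" "\<bar>T $ 3 $ 2\<bar> \<le> 1/8" "\<bar>T $ 4 $ 2\<bar> \<le> 1/8"
    "\<bar>T $ 2 $ 3\<bar> \<le> 1/8" "\<bar>T $ 3 $ 3\<bar> \<le> 1/8" "\<bar>T $ 4 $ 3\<bar> \<le> 1/8"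
    "\<bar>T $ 2 $ 4\<bar> \<le> 1/4" "\<bar>T $ 3 $ 4\<bar> \<le> 1/4" "\<bar>T $ 4 $ 4\<bar> \<le> 1/8"
  proof -
    have c: "sqrt 3 * y / sqrt 3 = y" for y by simp
    show "\<bar>T $ 2 $ 2\<bar> \<le> 1/8" "\<bar>T $ 3 $ 2\<bar> \<le> 1/8" using n2(2,3) unfolding c .
    show "\<bar>T $ 2 $ 3\<bar> \<le> 1/8" "\<bar>T $ 3 $ 3\<bar> \<le> 1/8" using n3(2,3) unfolding c .
  qed (fact small[OF n2(4)] small[OF n3(4)] big[OF n4(2)] big[OF n4(3)] n4(4))+
  have r: "T $ 1 $ j = (if j = 1 then s_root else 0)" for j
    using exhaust_4[of j] T11 n2(1) n3(1) n4(1) by auto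
  show ?thesis
  proof (rule that[OF fixed T r])
    show "(\<Sum>i\<in>UNIV. \<bar>T $ i $ j\<bar>) \<le> 3/4" if j1: "j \<noteq> 1" for j
    proof -
      consider "j = 2" | "j = 3" | "j = 4" using exhaust_4[of j] j1 by blast
      then show ?thesis
      proof cases
        case 1
        show ?thesis unfolding 1 sum_4 r using b(1-3) by simp
      next
        case 2
        show ?thesis unfolding 2 sum_4 r using b(4-6) by simp
      next
        case 3
        show ?thesis unfolding 3 sum_4 r using b(7-9) by simp
      qed
    qed
  qed
qed

text \<open>Working inside \<open>M \<inter> U\<close> keeps the orbits where \<open>F\<close> is
  analytic and injective. The box shape of \<open>N\<close> is what lets the stable manifold fill
  the whole slice of \<open>N\<close> in the divisor, with no further shrinking.\<close>

theorem theorem14p3p3: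
  fixes F :: "real^4 \<Rightarrow> real^4" and U :: "(real^4) set"
  assumes "reinhardt_poincare_extension U F"
  shows "hyperbolic_fixed_point F q_out \<and>
    (\<forall>M. open M \<and> q_out \<in> M \<longrightarrow>
      (\<exists>N. open N \<and> q_out \<in> N \<and> N \<subseteq> M \<inter> U \<and>
           smooth_curve (local_unstable_manifold F N q_out) \<and>
           local_stable_manifold F N q_out = {q \<in> N. q $ 1 = 0}))"
proof -
  obtain T where fixed: "F q_out = q_out" and T: "(F has_derivative (*v) T) (at q_out)"
    and row: "\<And>j. T $ 1 $ j = (if j = 1 then s_root else 0)"
    and columns: "\<And>j. j \<noteq> 1 \<Longrightarrow> (\<Sum>i\<in>UNIV. \<bar>T $ i $ j\<bar>) \<le> 3/4"
    using poincare_derivative[OF assms] by blast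
  have s: "s_root > 1" using s_root by simp
  have U: "open U" "q_out \<in> U" and an: "real_analytic_on F U"
    and img: "F ` {q \<in> U. q $ 1 = 0} = {q \<in> F ` U. q $ 1 = 0}"
    using assms by (simp_all add: reinhardt_poincare_extension_def analytic_diffeomorphism_on_def)
  have q1: "q_out $ 1 = 0" by (simp add: q_out_eq)
  have inv: "F q $ 1 = q_out $ 1" if "q \<in> U" "q $ 1 = q_out $ 1" for q
    using img that q1 by auto
  have "hyperbolic_fixed_point F q_out"
    unfolding hyperbolic_fixed_point_def
    using fixed T hyperbolic_saddle_matrix[OF row s columns] by (intro conjI exI[of _ "(*v) T"]) auto
  moreover have "\<exists>N. open N \<and> q_out \<in> N \<and> N \<subseteq> M \<inter> U \<and>
           smooth_curve (local_unstable_manifold F N q_out) \<and>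
           local_stable_manifold F N q_out = {q \<in> N. q $ 1 = 0}" if M: "open M" "q_out \<in> M" for M
  proof -
    have k: "(3/4 :: real) < 1" by simp
    have "open (M \<inter> U)" "q_out \<in> M \<inter> U" using M U by auto
    show ?thesis
    proof (rule analytic_saddle_manifolds[OF an U fixed inv T row s columns k \<open>open (M \<inter> U)\<close> \<open>q_out \<in> M \<inter> U\<close>])
      fix N assume "open N" "q_out \<in> N" "N \<subseteq> M \<inter> U"
        "smooth_curve (local_unstable_manifold F N q_out)"
        "local_stable_manifold F N q_out = {q \<in> N. q $ 1 = q_out $ 1}"
      then show ?thesis unfolding q1 by blast
    qed
  qed
  ultimately show ?thesis by blast
qed

end
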